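(* Consider the construction in the context along any sequence with $M\to\infty$, $N\to\infty$, $\log N/\log M\to\infty$. Fix $\eta\in(0,\lambda_{\rm c})$, where $\lambda_{\rm c}:=16\sqrt2-1$, and let $\Lambda_{\rm opt}(\eta):=[\lambda_{\rm c}+\eta,\infty)$, $\Lambda_{\rm under}(\eta):=[0,\lambda_{\rm c}-\eta]$. Then: (1) There is $a_\eta>0$, depending only on $\eta$, such that for all sufficiently large $M,N$, \[ \sup_{\lambda\in\Lambda_{\rm opt}(\eta)}\left[Q_\tau\{\widehat\Theta_\lambda(Y)\in C_N\}+\sup_{\theta\in H_M}P_\theta\{\widehat\Theta_\lambda(Y)\in C_N\}\right]\le N^{-a_\eta}. \] Consequently, for every $\lambda\in\Lambda_{\rm opt}(\eta)$, with $\Delta=R/3$, \[ \rho_{\Delta,Q_\tau}(\widehat\Theta_\lambda)=\mathbb E_{Y\sim Q_\tau}\pi\bigl(B_d(\widehat\Theta_\lambda(Y),\Delta)\bigr)\le\frac CM . \] (2) $\displaystyle\inf_{\lambda\in\Lambda_{\rm under}(\eta)}\inf_{\theta\in H_M}P_\theta\{\widehat\Theta_\lambda(Y)\in C_N\}\longrightarrow1.$ (3) There are constants $0<c_\eta<C_\eta<\infty$, depending only on $\eta$, such that (for all sufficiently large $M,N$) \[ c_\eta R\le\mathfrak R_{\rm RNN}^H(\Lambda_{\rm opt}(\eta))\le C_\eta R,\qquad c_\eta S\le\mathfrak R_{\rm RNN}^H(\Lambda_{\rm under}(\eta))\le C_\eta S . \] (4) The full-class minimax risk satisfies \[ \mathfrak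 R_{\rm mm}^{\rm full}(T_{M,N},\tau):=\inf_{\widehat\theta}\sup_{\theta\in T_{M,N}}\mathbb E_\theta d(\theta,\widehat\theta(Y))\asymp S, \] the infimum being over all measurable estimators with values in the ambient Euclidean space. Hence \[ \frac{\mathfrak R_{\rm RNN}^H(\Lambda_{\rm under}(\eta))}{\mathfrak R_{\rm RNN}^H(\Lambda_{\rm opt}(\eta))}\asymp\frac{\mathfrak R_{\rm mm}^{\rm full}(T_{M,N},\tau)}{\mathfrak R_{\rm RNN}^H(\Lambda_{\rm opt}(\eta))}\asymp\frac SR=\frac18\sqrt{\frac{\log N}{\log M}} . \] (5) Let $X_t=\langle Z,t\rangle$ and let $Y=\Theta+\tau Z$ with $\Theta\sim\pi$, $Z\sim N(0,I_{M+N+1})$ independent. Every $\lambda\in\Lambda_{\rm opt}(\eta)$ satisfies, almost surely, $\|Y-\widehat\Theta_\lambda\|^2+\lambda\|\widehat\Theta_\lambda\|^2\le\|Y-\Theta\|^2+\lambda\|\Theta\|^2$ and $\lambda\|\widehat\Theta_\lambda\|^2\ge\lambda\|\Theta\|^2$, and \[ \mathcal G_{\rm alg}(\lambda):=\mathbb E_{\Theta,Z}\bigl[X_{\widehat\Theta_\lambda(\Theta+\tau Z)}-X_\Theta\bigr]\asymp R\sqrt{\log M},\qquad\lambda\in\Lambda_{\rm opt}(\eta). \] This matches $\Gamma_H:=\mathbb E\sup_{s,u\in H_M}(X_s-X_u)\asymp R\sqrt{\log M}$, whereas \[ \Gamma_{\rm full}:=\mathbb E\sup_{s,u\in T_{M,N}}(X_s-X_u)\asymp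 S\sqrt{\log N}=\frac18R\frac{\log N}{\sqrt{\log M}} . \] Along $N=M^K$ with $K\to\infty$, the penalty-revealed minimax-risk gap $\mathfrak R_{\rm RNN}^H(\Lambda_{\rm under}(\eta))/\mathfrak R_{\rm RNN}^H(\Lambda_{\rm opt}(\eta))$ is $\asymp\sqrt K$, and the Gaussian-range gap $\Gamma_{\rm full}/\mathcal G_{\rm alg}(\lambda)$ is $\asymp K$.
   Context: Construction. Let $M,N\ge2$ and let $e_0,\ldots,e_M,f_1,\ldots,f_N$ be orthonormal vectors in $\mathbb R^{M+N+1}$. Fix $R>0$ and set \[ \tau:=\frac R{\sqrt{\log M}},\qquad S:=\frac18\tau\sqrt{\log N}=\frac R8\sqrt{\frac{\log N}{\log M}}, \] \[ H_M:=\{Re_0,\ldots,Re_M\},\quad C_N:=\{Sf_1,\ldots,Sf_N\},\quad T_{M,N}:=H_M\cup C_N, \] $d(s,t)=\|s-t\|_2$, $B_d(a,r)=\{s\in T_{M,N}:d(a,s)\le r\}$. The prior $\pi$ on $T_{M,N}$ is $\pi(Re_0)=\frac12$, $\pi(Re_i)=\frac1{2M}$ for $1\le i\le M$, $\pi(Sf_j)=0$. $Q_\tau:=N(0,\tau^2I_{M+N+1})$, $P_\theta:=N(\theta,\tau^2I_{M+N+1})$; $\mathbb E_\theta$ is expectation under $Y\sim P_\theta$. For $\lambda\ge0$ the full-atlas norm-regularized nearest-neighbor rule is \[ \widehat\Theta_\lambda(Y)\in\arg\min_{a\in T_{M,N}}\{\|Y-a\|_2^2+\lambda\|a\|_2^2\}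 \] with an arbitrary deterministic tie-breaking rule. For nonempty $\Lambda\subset[0,\infty)$, the penalty-revealed algorithmic minimax value is \[ \mathfrak R_{\rm RNN}^H(\Lambda):=\inf_{\lambda\in\Lambda}\sup_{\theta\in H_M}\mathbb E_\theta d(\theta,\widehat\Theta_\lambda(Y)). \] $C$ denotes a constant, and $a\asymp b$ means equality up to positive multiplicative constants, depending on nothing except possibly the fixed $\eta$, for all sufficiently large $M,N$ along the sequence.
   Formalization: In (5) the almost sure inequality λ‖Θ̂_λ‖² ≥ λ‖Θ‖² is proved for all sufficiently large M,N along the sequence; without this it fails at early terms with S<R (e.g. M=N=2, where S=R/8 and a point of C_N is chosen with positive probability). *)

theory Defs
  imports "HOL-Probability.Probability"
begin

text \<open>
  The ambient dimension varies along the sequence, so real vectors of dimension \<open>D\<close> are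
  functions on \<open>nat\<close> supported (extensionally) on \<open>{..<D}\<close>, i.e. the points of the product
  measurable space \<open>vspace D\<close>. All operations below only read the coordinates below \<open>D\<close>.
\<close>

type_synonym vec = "nat \<Rightarrow> real"

definition vspace :: "nat \<Rightarrow> vec measure" where
  "vspace D = PiM {..<D} (\<lambda>_. borel)"

definition vscale :: "nat \<Rightarrow> real \<Rightarrow> vec \<Rightarrow> vec" where
  "vscale D c v = (\<lambda>i\<in>{..<D}. c * v i)"

definition vadd :: "nat \<Rightarrow> vec \<Rightarrow> vec \<Rightarrow> vec" where
  "vadd D u v = (\<lambda>i\<in>{..<D}. u i + v i)"

definition ip :: "nat \<Rightarrow> vec \<Rightarrow> vec \<Rightarrow> real" where
  "ip D u v = (\<Sum>i<D. u i * v i)"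

definition vnorm :: "nat \<Rightarrow> vec \<Rightarrow> real" where
  "vnorm D u = L2_set u {..<D}"

definition vdist :: "nat \<Rightarrow> vec \<Rightarrow> vec \<Rightarrow> real" where
  "vdist D u v = vnorm D (\<lambda>i. u i - v i)"

definition gaussian_borel :: "nat \<Rightarrow> vec \<Rightarrow> real \<Rightarrow> vec measure" where
  "gaussian_borel D m s = PiM {..<D} (\<lambda>i. density lborel (normal_density (m i) s))"

text \<open>
  \<open>N(m, s\<^sup>2 I)\<close>, where \<open>s\<close> is the standard deviation. The law is completed because a
  nearest-neighbor rule with arbitrary tie-breaking is Borel only up to the null set of ties;
  on Borel sets and functions nothing changes.
\<close>

definition gaussian :: "nat \<Rightarrow> vec \<Rightarrow> real \<Rightarrow> vec measure" where
  "gaussian D m s = completion (gaussian_borel D m s)"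

record atlas =
  nM :: nat
  nN :: nat
  rad :: real
  evec :: "nat \<Rightarrow> vec"
  fvec :: "nat \<Rightarrow> vec"

definition dm :: "atlas \<Rightarrow> nat" where
  "dm A = nM A + nN A + 1"

definition valid_atlas :: "atlas \<Rightarrow> bool" where
  "valid_atlas A \<longleftrightarrow> 2 \<le> nM A \<and> 2 \<le> nN A \<and> 0 < rad A \<and>
     (\<forall>i\<le>nM A. evec A i \<in> space (vspace (dm A))) \<and>
     (\<forall>j\<in>{1..nN A}. fvec A j \<in> space (vspace (dm A))) \<and>
     (\<forall>i\<le>nM A. \<forall>i'\<le>nM A. ip (dm A) (evec A i) (evec A i') = (if i = i' then 1 else 0)) \<and>
     (\<forall>j\<in>{1..nN A}. \<forall>j'\<in>{1..nN A}. ip (dm A) (fvec A j) (fvec A j') = (if j = j' then 1 else 0)) \<and>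
     (\<forall>i\<le>nM A. \<forall>j\<in>{1..nN A}. ip (dm A) (evec A i) (fvec A j) = 0)"

definition tau :: "atlas \<Rightarrow> real" where
  "tau A = rad A / sqrt (ln (real (nM A)))"

definition S_rad :: "atlas \<Rightarrow> real" where
  "S_rad A = 1 / 8 * tau A * sqrt (ln (real (nN A)))"

definition hub :: "atlas \<Rightarrow> nat \<Rightarrow> vec" where
  "hub A i = vscale (dm A) (rad A) (evec A i)"

definition far :: "atlas \<Rightarrow> nat \<Rightarrow> vec" where
  "far A j = vscale (dm A) (S_rad A) (fvec A j)"

definition H_set :: "atlas \<Rightarrow> vec set" where
  "H_set A = hub A ` {0..nM A}"

definition C_set :: "atlas \<Rightarrow> vec set" where
  "C_set A = far A ` {1..nN A}"

definition T_set :: "atlas \<Rightarrow> vec set" where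
  "T_set A = H_set A \<union> C_set A"

definition T_ball :: "atlas \<Rightarrow> vec \<Rightarrow> real \<Rightarrow> vec set" where
  "T_ball A a r = {s \<in> T_set A. vdist (dm A) a s \<le> r}"

definition prior :: "atlas \<Rightarrow> vec pmf" where
  "prior A = bind_pmf (bernoulli_pmf (1 / 2))
     (\<lambda>b. if b then return_pmf (hub A 0) else map_pmf (hub A) (pmf_of_set {1..nM A}))"

definition Q_law :: "atlas \<Rightarrow> vec measure" where
  "Q_law A = gaussian (dm A) (\<lambda>_. 0) (tau A)"

definition P_law :: "atlas \<Rightarrow> vec \<Rightarrow> vec measure" where
  "P_law A \<theta> = gaussian (dm A) \<theta> (tau A)"

definition Z_law :: "atlas \<Rightarrow> vec measure" where
  "Z_law A = gaussian (dm A) (\<lambda>_. 0) 1"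

definition rnn_obj :: "atlas \<Rightarrow> real \<Rightarrow> vec \<Rightarrow> vec \<Rightarrow> real" where
  "rnn_obj A l y a = (vdist (dm A) y a)\<^sup>2 + l * (vnorm (dm A) a)\<^sup>2"

text \<open>
  \<open>h l y\<close> is the output of the rule with penalty \<open>l\<close> on the observation \<open>y\<close>; ties may be
  broken in any way, depending on \<open>l\<close> and \<open>y\<close>.
\<close>

definition rnn_rule :: "atlas \<Rightarrow> (real \<Rightarrow> vec \<Rightarrow> vec) \<Rightarrow> bool" where
  "rnn_rule A h \<longleftrightarrow> (\<forall>l\<ge>0. \<forall>y\<in>space (vspace (dm A)).
     is_arg_min (rnn_obj A l y) (\<lambda>a. a \<in> T_set A) (h l y))"

definition rnn_risk :: "atlas \<Rightarrow> (real \<Rightarrow> vec \<Rightarrow> vec) \<Rightarrow> real set \<Rightarrow> real" where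
  "rnn_risk A h \<Lambda> =
     (INF l\<in>\<Lambda>. SUP \<theta>\<in>H_set A. \<integral>y. vdist (dm A) \<theta> (h l y) \<partial>P_law A \<theta>)"

definition rho :: "atlas \<Rightarrow> real \<Rightarrow> vec measure \<Rightarrow> (vec \<Rightarrow> vec) \<Rightarrow> real" where
  "rho A \<Delta> Q est = (\<integral>y. measure_pmf.prob (prior A) (T_ball A (est y) \<Delta>) \<partial>Q)"

text \<open>
  The risk of an arbitrary measurable estimator may be infinite, so the minimax value is formed
  in \<open>ennreal\<close>. As \<open>enn2real\<close> sends infinity to \<open>0\<close>, a positive lower bound on
  \<open>minimax_full\<close> includes the finiteness of the minimax value.
\<close>

definition minimax_full :: "atlas \<Rightarrow> real" where
  "minimax_full A = enn2real
     (INF est \<in> vspace (dm A) \<rightarrow>\<^sub>M vspace (dm A).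
        SUP \<theta>\<in>T_set A. \<integral>\<^sup>+y. ennreal (vdist (dm A) \<theta> (est y)) \<partial>P_law A \<theta>)"

text \<open>Joint law of the independent pair \<open>(\<Theta>, Z)\<close>, again completed.\<close>

definition joint_law :: "atlas \<Rightarrow> (vec \<times> vec) measure" where
  "joint_law A = completion (measure_pmf (prior A) \<Otimes>\<^sub>M gaussian_borel (dm A) (\<lambda>_. 0) 1)"

definition obs :: "atlas \<Rightarrow> vec \<Rightarrow> vec \<Rightarrow> vec" where
  "obs A \<theta> z = vadd (dm A) \<theta> (vscale (dm A) (tau A) z)"

definition G_alg :: "atlas \<Rightarrow> (real \<Rightarrow> vec \<Rightarrow> vec) \<Rightarrow> real \<Rightarrow> real" where
  "G_alg A h l =
     (\<integral>(\<theta>, z). ip (dm A) z (h l (obs A \<theta> z)) - ip (dm A) z \<theta> \<partial>joint_law A)"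

definition gauss_range :: "atlas \<Rightarrow> vec set \<Rightarrow> real" where
  "gauss_range A V = (\<integral>z. (SUP (s, u)\<in>V \<times> V. ip (dm A) z s - ip (dm A) z u) \<partial>Z_law A)"

definition lambda_c :: real where
  "lambda_c = 16 * sqrt 2 - 1"

definition Lambda_opt :: "real \<Rightarrow> real set" where
  "Lambda_opt \<eta> = {lambda_c + \<eta>..}"

definition Lambda_under :: "real \<Rightarrow> real set" where
  "Lambda_under \<eta> = {0..lambda_c - \<eta>}"

definition asymp_within :: "real \<Rightarrow> real \<Rightarrow> real \<Rightarrow> real \<Rightarrow> bool" where
  "asymp_within c C a b \<longleftrightarrow> c * b \<le> a \<and> a \<le> C * b"

lemma hub_inj:
  assumes "valid_atlas A"
  shows "inj_on (hub A) {0..nM A}"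
proof (rule inj_onI)
  fix i j assume ij: "i \<in> {0..nM A}" "j \<in> {0..nM A}" and eq: "hub A i = hub A j"
  have co: "evec A i k = evec A j k" if "k < dm A" for k
    using fun_cong[OF eq, of k] that assms
    by (auto simp: hub_def vscale_def valid_atlas_def)
  have "ip (dm A) (evec A i) (evec A j) = ip (dm A) (evec A i) (evec A i)"
    unfolding ip_def by (rule sum.cong) (auto simp: co)
  moreover have "ip (dm A) (evec A i) (evec A i) = 1"
    using assms ij by (auto simp: valid_atlas_def)
  moreover have "ip (dm A) (evec A i) (evec A j) = (if i = j then 1 else 0)"
    using assms ij by (auto simp: valid_atlas_def)
  ultimately show "i = j" by (auto split: if_splits)
qed

lemma far_notin_H:
  assumes "valid_atlas A" "j \<in> {1..nN A}"
  shows "far A j \<notin> H_set A"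
proof
  assume "far A j \<in> H_set A"
  then obtain i where i: "i \<le> nM A" and eq: "far A j = hub A i" by (auto simp: H_set_def)
  have co: "S_rad A * fvec A j k = rad A * evec A i k" if "k < dm A" for k
    using fun_cong[OF eq, of k] that by (auto simp: hub_def far_def vscale_def)
  have "rad A * ip (dm A) (evec A i) (evec A i) = S_rad A * ip (dm A) (evec A i) (fvec A j)"
    unfolding ip_def sum_distrib_left by (rule sum.cong) (auto simp: co algebra_simps)
  moreover have "ip (dm A) (evec A i) (evec A i) = 1" "ip (dm A) (evec A i) (fvec A j) = 0"
    using assms i by (auto simp: valid_atlas_def)
  ultimately show False using assms by (auto simp: valid_atlas_def)
qed

lemma pmf_prior:
  assumes "valid_atlas A"
  shows "pmf (prior A) (hub A 0) = 1 / 2"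
    and "i \<in> {1..nM A} \<Longrightarrow> pmf (prior A) (hub A i) = 1 / (2 * real (nM A))"
    and "j \<in> {1..nN A} \<Longrightarrow> pmf (prior A) (far A j) = 0"
proof -
  have M: "2 \<le> nM A" using assms by (simp add: valid_atlas_def)
  have unif: "map_pmf (hub A) (pmf_of_set {1..nM A}) = pmf_of_set (hub A ` {1..nM A})"
    using M by (intro map_pmf_of_set_inj inj_on_subset[OF hub_inj[OF assms]]) auto
  have card: "card (hub A ` {1..nM A}) = nM A"
    using card_image[OF inj_on_subset[OF hub_inj[OF assms], of "{1..nM A}"]] by auto
  have val: "pmf (prior A) v = 1 / 2 * indicator {hub A 0} v
      + 1 / 2 * (indicator (hub A ` {1..nM A}) v / real (nM A))" for v
    unfolding prior_def pmf_bind using M by (simp add: unif[simplified] card[simplified] indicator_def)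
  have z: "hub A 0 \<notin> hub A ` {1..nM A}"
    using inj_on_image_mem_iff[OF hub_inj[OF assms], of 0 "{1..nM A}"] by auto
  show "pmf (prior A) (hub A 0) = 1 / 2" using z by (simp add: val)
  show "pmf (prior A) (hub A i) = 1 / (2 * real (nM A))" if "i \<in> {1..nM A}"
  proof -
    have "hub A i \<noteq> hub A 0" using z imageI[OF that, of "hub A"] by metis
    then show ?thesis using that by (simp add: val)
  qed
  show "pmf (prior A) (far A j) = 0" if "j \<in> {1..nN A}"
  proof -
    have "far A j \<noteq> hub A 0" "far A j \<notin> hub A ` {1..nM A}"
      using far_notin_H[OF assms that] by (auto simp: H_set_def)
    then show ?thesis by (simp add: val)
  qed
qed

end

theory Submission
  imports Defs
begin

text \<open>
  No independence of the Gaussian coordinates \<open>\<langle>Z, f\<^sub>j\<rangle>\<close> is needed. The only input on the law of \<open>Z\<close> is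
  the Cameron-Martin formula. It yields the moment generating function, hence Chernoff bounds,
  and the strong converse of channel coding: if \<open>n\<close> means have \<open>|\<theta>\<^sub>i|\<^sup>2 = q \<tau>\<^sup>2\<close> with \<open>q / 2\<close>
  below \<open>ln n\<close> by a constant factor, every decoder errs with probability tending to 1. Applied to
  the nearest-neighbor decoder of the codewords \<open>s f\<^sub>j\<close> with \<open>s\<^sup>2 < 2 ln N\<close>, the converse says that
  some \<open>\<langle>Z, f\<^sub>j\<rangle>\<close> exceeds about \<open>s\<close>, which is the sharp lower bound \<open>sqrt (2 ln N)\<close> for the maximum
  and gives (2). The converse also gives the lower bounds for the hub risk, the minimax risk and
  the Gaussian ranges. The upper bound (1) is a union bound for the functionals
  \<open>\<langle>Z, S f\<^sub>j - R e\<^sub>i\<rangle>\<close>; the critical value is where \<open>(1 + \<lambda>)\<^sup>2 / 512\<close> crosses 1. The bound on \<open>\<rho>\<close> uses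
  exchangeability of the \<open>\<langle>Z, e\<^sub>i\<rangle>\<close>, i.e. invariance under reflections. For the lower bound on the
  algorithmic Gaussian range, the optimality of the rule gives \<open>2 \<tau> \<langle>Z, \<Theta>' - \<Theta>\<rangle> \<ge> |\<Theta>' - \<Theta>|\<^sup>2\<close>.
\<close>

section \<open>Standard Gaussian vectors\<close>

text \<open>Origin of the threshold: with R negligible against S, a far point pays (1 + l) S^2 and
  gains about 2 \<tau> S sqrt (2 ln N) from the best of N noise coordinates. For S = \<tau> sqrt (ln
  N) / 8 the two balance at 1 + l = 16 sqrt 2, and (16 sqrt 2)^2 = 512 is the number in the exponent
  of the union bound. Two obstacles shape the development. The rule breaks ties arbitrarily, so it
  is not Borel; every probability and expectation is therefore first rewritten as one over
  \<open>std_gauss\<close> for a Borel version of the rule. And the statements are uniform over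
  uncountable sets of penalties, so all estimates are proved for one fixed atlas, with explicit
  rates that do not depend on the penalty; limits enter only in the last proof. There the constants
  of all comparisons turn out to be absolute: \<eta> enters only through the decay rates and through
  how large the atlas must be.\<close>

abbreviation std_gauss :: "nat \<Rightarrow> vec measure" where
  "std_gauss D \<equiv> gaussian_borel D (\<lambda>_. 0) 1"

section \<open>Borel structure and inner-product algebra of coordinate vectors\<close>

lemma space_vspace: "space (vspace D) = PiE {..<D} (\<lambda>_. UNIV)"
  by (simp add: vspace_def space_PiM)

lemma sets_gaussian_borel [measurable_cong, simp]: "sets (gaussian_borel D m s) = sets (vspace D)"
  unfolding gaussian_borel_def vspace_def by (rule sets_PiM_cong) auto

lemma space_gaussian_borel [simp]: "space (gaussian_borel D m s) = space (vspace D)"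
  by (rule sets_eq_imp_space_eq) simp

lemma prob_space_gaussian_borel: "0 < s \<Longrightarrow> prob_space (gaussian_borel D m s)"
  unfolding gaussian_borel_def by (intro prob_space_PiM prob_space_normal_density)

lemma coord_measurable: "i < D \<Longrightarrow> (\<lambda>z. z i) \<in> borel_measurable (vspace D)"
  unfolding vspace_def by (rule measurable_component_singleton) auto

lemma ip_measurable [measurable]:
  assumes f: "f \<in> N \<rightarrow>\<^sub>M vspace D"
  shows "(\<lambda>z. ip D (f z) v) \<in> borel_measurable N" "(\<lambda>z. ip D v (f z)) \<in> borel_measurable N"
  unfolding ip_def
  by (auto intro!: borel_measurable_sum borel_measurable_times measurable_compose[OF f coord_measurable])

lemma ip_measurable2 [measurable]:
  assumes f: "f \<in> N \<rightarrow>\<^sub>M vspace D" and g: "g \<in> N \<rightarrow>\<^sub>M vspace D"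
  shows "(\<lambda>z. ip D (f z) (g z)) \<in> borel_measurable N"
  unfolding ip_def
  by (auto intro!: borel_measurable_sum borel_measurable_times measurable_compose[OF f coord_measurable]
    measurable_compose[OF g coord_measurable])

lemma vadd_measurable [measurable]:
  assumes f: "f \<in> N \<rightarrow>\<^sub>M vspace D" and g: "g \<in> N \<rightarrow>\<^sub>M vspace D"
  shows "(\<lambda>z. vadd D (f z) (g z)) \<in> N \<rightarrow>\<^sub>M vspace D"
  unfolding vadd_def
  by (subst vspace_def, rule measurable_restrict)
     (auto intro!: borel_measurable_add measurable_compose[OF f coord_measurable] measurable_compose[OF g coord_measurable])

lemma vadd_const_measurable [measurable]:
  assumes f: "f \<in> N \<rightarrow>\<^sub>M vspace D"
  shows "(\<lambda>z. vadd D m (f z)) \<in> N \<rightarrow>\<^sub>M vspace D" "(\<lambda>z. vadd D (f z) m) \<in> N \<rightarrow>\<^sub>M vspace D"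
  unfolding vadd_def
  by (subst vspace_def, rule measurable_restrict, auto intro!: borel_measurable_add measurable_compose[OF f coord_measurable])+

lemma vscale_measurable [measurable]:
  assumes f: "f \<in> N \<rightarrow>\<^sub>M vspace D" and [measurable]: "c \<in> borel_measurable N"
  shows "(\<lambda>z. vscale D (c z) (f z)) \<in> N \<rightarrow>\<^sub>M vspace D"
  unfolding vscale_def
  by (subst vspace_def, rule measurable_restrict)
     (auto intro!: borel_measurable_times measurable_compose[OF f coord_measurable])

lemma vscale_const_measurable [measurable]:
  assumes [measurable]: "c \<in> borel_measurable N"
  shows "(\<lambda>z. vscale D (c z) v) \<in> N \<rightarrow>\<^sub>M vspace D"
  unfolding vscale_def by (subst vspace_def, rule measurable_restrict, simp)

lemma vadd_space [simp]: "vadd D u v \<in> space (vspace D)"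
  and vscale_space [simp]: "vscale D c v \<in> space (vspace D)"
  by (auto simp: space_vspace vadd_def vscale_def)

lemma vspace_eqI:
  "u \<in> space (vspace D) \<Longrightarrow> v \<in> space (vspace D) \<Longrightarrow> (\<And>i. i < D \<Longrightarrow> u i = v i) \<Longrightarrow> u = v"
  unfolding space_vspace by (rule PiE_ext) auto

lemma ip_commute: "ip D u v = ip D v u"
  by (simp add: ip_def mult.commute)

lemma ip_vadd [simp]: "ip D (vadd D u v) w = ip D u w + ip D v w" "ip D w (vadd D u v) = ip D w u + ip D w v"
  by (simp_all add: ip_def vadd_def algebra_simps sum.distrib)

lemma ip_vscale [simp]: "ip D (vscale D c v) w = c * ip D v w" "ip D w (vscale D c v) = c * ip D w v"
  by (simp_all add: ip_def vscale_def algebra_simps sum_distrib_left)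

lemma vnorm_sq: "(vnorm D v)\<^sup>2 = ip D v v"
  by (simp add: vnorm_def L2_set_def ip_def sum_nonneg power2_eq_square)

lemma vdist_sq: "(vdist D u v)\<^sup>2 = ip D u u - 2 * ip D u v + ip D v v"
  by (simp add: vdist_def vnorm_sq ip_def sum_subtractf sum.distrib sum_distrib_left algebra_simps)

lemma vdist_nonneg [simp]: "0 \<le> vdist D u v"
  by (simp add: vdist_def vnorm_def)

lemma vdist_eq: "vdist D u v = sqrt (ip D u u - 2 * ip D u v + ip D v v)"
  by (metis vdist_sq vdist_nonneg real_sqrt_unique)

lemma vdist_commute: "vdist D u v = vdist D v u"
  by (simp add: vdist_def vnorm_def L2_set_def power2_commute)

lemma vdist_triangle: "vdist D u w \<le> vdist D u v + vdist D v w"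
  using L2_set_triangle_ineq[of "\<lambda>i. u i - v i" "\<lambda>i. v i - w i" "{..<D}"]
  by (simp add: vdist_def vnorm_def)

text \<open>A product measure is determined by its values on boxes, and the preimage of a box under
  z -> m + s z is again a box, so the claim reduces to affine images of one-dimensional normal laws.
  It lets all laws of the model live on the single space \<open>std_gauss\<close>.\<close>

lemma gaussian_borel_affine:
  assumes s: "0 < s"
  shows "gaussian_borel D m s = distr (std_gauss D) (vspace D) (\<lambda>z. vadd D m (vscale D s z))"
proof -
  have pn: "prob_space (density lborel (normal_density a b))" if "0 < b" for a b
    using that by (rule prob_space_normal_density)
  interpret P: product_prob_space "\<lambda>i. density lborel (normal_density (m i) s)" "{..<D}"
    by (intro product_prob_spaceI pn s)
  interpret Z: product_prob_space "\<lambda>i::nat. density lborel (normal_density 0 1)" "{..<D}"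
    by (intro product_prob_spaceI pn) simp
  have one: "distr (density lborel (normal_density 0 1)) borel (\<lambda>x. a + x * s)
      = density lborel (normal_density a s)" for a
  proof -
    have "distributed (density lborel (normal_density 0 1)) lborel (\<lambda>x. x) (normal_density 0 1)"
      by (simp add: distributed_def distr_id2)
    from prob_space.normal_density_affine[OF pn this, of s a] s
    show ?thesis by (simp add: distributed_def mult.commute cong: distr_cong)
  qed
  have "distr (std_gauss D) (vspace D) (\<lambda>z. vadd D m (vscale D s z)) = gaussian_borel D m s"
    unfolding gaussian_borel_def
  proof (rule P.PiM_eqI)
    show "sets (distr (Pi\<^sub>M {..<D} (\<lambda>i. density lborel (\<lambda>x. ennreal (normal_density 0 1 x)))) (vspace D)
      (\<lambda>z. vadd D m (vscale D s z))) = sets (Pi\<^sub>M {..<D} (\<lambda>i. density lborel (\<lambda>x. ennreal (normal_density (m i) s x))))"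
      by (simp add: vspace_def cong: sets_PiM_cong)
    fix B assume B: "\<And>i. i \<in> {..<D} \<Longrightarrow> B i \<in> sets (density lborel (\<lambda>x. ennreal (normal_density (m i) s x)))"
    have meas: "(\<lambda>z. vadd D m (vscale D s z)) \<in> std_gauss D \<rightarrow>\<^sub>M vspace D" by measurable
    have BP: "Pi\<^sub>E {..<D} B \<in> sets (vspace D)" unfolding vspace_def using B by (intro sets_PiM_I_finite) auto
    have pm: "(\<lambda>x. m i + x * s) -` B i \<in> sets borel" if "i < D" for i
    proof -
      have "(\<lambda>x. m i + x * s) -` B i \<inter> space borel \<in> sets borel"
        by (rule measurable_sets[where A = borel]) (use B that in auto)
      then show ?thesis by simp
    qed
    have pre: "(\<lambda>z. vadd D m (vscale D s z)) -` Pi\<^sub>E {..<D} B \<inter> space (std_gauss D)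
       = Pi\<^sub>E {..<D} (\<lambda>i. (\<lambda>x. m i + x * s) -` B i)"
      by (auto simp: space_vspace vadd_def vscale_def PiE_def Pi_def mult.commute)
    have "emeasure (distr (std_gauss D) (vspace D) (\<lambda>z. vadd D m (vscale D s z))) (Pi\<^sub>E {..<D} B)
       = emeasure (std_gauss D) (Pi\<^sub>E {..<D} (\<lambda>i. (\<lambda>x. m i + x * s) -` B i))"
      by (subst emeasure_distr[OF meas BP]) (simp only: pre)
    also have "\<dots> = (\<Prod>i<D. emeasure (density lborel (normal_density 0 1)) ((\<lambda>x. m i + x * s) -` B i))"
      unfolding gaussian_borel_def
      by (rule Z.emeasure_PiM) (simp_all add: pm)
    also have "\<dots> = (\<Prod>i<D. emeasure (density lborel (normal_density (m i) s)) (B i))"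
    proof (rule prod.cong)
      fix i assume "i \<in> {..<D}"
      then show "emeasure (density lborel (normal_density 0 1)) ((\<lambda>x. m i + x * s) -` B i)
        = emeasure (density lborel (normal_density (m i) s)) (B i)"
        using B by (subst one[symmetric], subst emeasure_distr) auto
    qed simp
    finally show "emeasure (distr (Pi\<^sub>M {..<D} (\<lambda>i. density lborel (\<lambda>x. ennreal (normal_density 0 1 x)))) (vspace D)
      (\<lambda>z. vadd D m (vscale D s z))) (Pi\<^sub>E {..<D} B) =
      (\<Prod>i\<in>{..<D}. emeasure (density lborel (\<lambda>x. ennreal (normal_density (m i) s x))) (B i))"
      by (simp add: gaussian_borel_def)
  qed simp
  then show ?thesis by simp
qed

text \<open>The ratio of two normal densities with unit variance is exp (x m - m^2 / 2), and these
  ratios multiply over the coordinates. Unit variance is enough because other noise levels are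
  reached by rescaling the mean.\<close>

lemma gaussian_borel_density:
  "gaussian_borel D m 1 = density (std_gauss D) (\<lambda>z. ennreal (exp (ip D z m - ip D m m / 2)))"
proof -
  have pn: "prob_space (density lborel (normal_density a b))" if "0 < b" for a b
    using that by (rule prob_space_normal_density)
  interpret P: product_prob_space "\<lambda>i. density lborel (normal_density (m i) 1)" "{..<D}"
    by (intro product_prob_spaceI pn) simp
  interpret Z: product_prob_space "\<lambda>i::nat. density lborel (normal_density 0 1)" "{..<D}"
    by (intro product_prob_spaceI pn) simp
  let ?g = "\<lambda>i x. ennreal (exp (x * m i - m i * m i / 2))"
  have "density (std_gauss D) (\<lambda>z. ennreal (exp (ip D z m - ip D m m / 2))) = gaussian_borel D m 1"
    unfolding gaussian_borel_def[of D m]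
  proof (rule P.PiM_eqI)
    show "sets (density (std_gauss D) (\<lambda>z. ennreal (exp (ip D z m - ip D m m / 2))))
       = sets (Pi\<^sub>M {..<D} (\<lambda>i. density lborel (\<lambda>x. ennreal (normal_density (m i) 1 x))))"
      by (simp add: vspace_def cong: sets_PiM_cong)
    fix B assume B: "\<And>i. i \<in> {..<D} \<Longrightarrow> B i \<in> sets (density lborel (\<lambda>x. ennreal (normal_density (m i) 1 x)))"
    have BP: "Pi\<^sub>E {..<D} B \<in> sets (std_gauss D)" 
      unfolding sets_gaussian_borel vspace_def using B by (intro sets_PiM_I_finite) auto
    have "emeasure (density (std_gauss D) (\<lambda>z. ennreal (exp (ip D z m - ip D m m / 2)))) (Pi\<^sub>E {..<D} B)
      = (\<integral>\<^sup>+z. ennreal (exp (ip D z m - ip D m m / 2)) * indicator (Pi\<^sub>E {..<D} B) z \<partial>std_gauss D)"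
      by (rule emeasure_density) (use BP in \<open>measurable\<close>)
    also have "\<dots> = (\<integral>\<^sup>+z. (\<Prod>i<D. ?g i (z i) * indicator (B i) (z i)) \<partial>std_gauss D)"
    proof (rule nn_integral_cong)
      fix z assume z: "z \<in> space (std_gauss D)"
      have "(\<Prod>i<D. ?g i (z i)) = ennreal (exp (ip D z m - ip D m m / 2))"
        by (simp add: prod_ennreal ip_def exp_sum[symmetric] sum_subtractf sum_divide_distrib)
      moreover have "(\<Prod>i<D. indicator (B i) (z i) :: ennreal) = indicator (Pi\<^sub>E {..<D} B) z"
        using z by (auto simp: indicator_def space_vspace PiE_def Pi_def prod_eq_1_iff)
      ultimately show "ennreal (exp (ip D z m - ip D m m / 2)) * indicator (Pi\<^sub>E {..<D} B) z
         = (\<Prod>i<D. ?g i (z i) * indicator (B i) (z i))"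
        by (simp add: prod.distrib)
    qed
    also have "\<dots> = (\<Prod>i<D. \<integral>\<^sup>+x. ?g i x * indicator (B i) x \<partial>density lborel (normal_density 0 1))"
      unfolding gaussian_borel_def
      by (rule Z.product_nn_integral_prod) (use B in \<open>auto intro!: borel_measurable_times borel_measurable_indicator\<close>)
    also have "\<dots> = (\<Prod>i<D. emeasure (density lborel (normal_density (m i) 1)) (B i))"
    proof (rule prod.cong)
      fix i assume i: "i \<in> {..<D}"
      then have [measurable]: "B i \<in> sets borel" using B by auto
      have "(\<integral>\<^sup>+x. ?g i x * indicator (B i) x \<partial>density lborel (normal_density 0 1))
         = (\<integral>\<^sup>+x. ennreal (normal_density 0 1 x) * (?g i x * indicator (B i) x) \<partial>lborel)"
        by (rule nn_integral_density) auto
      also have "\<dots> = (\<integral>\<^sup>+x. ennreal (normal_density (m i) 1 x) * indicator (B i) x \<partial>lborel)"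
      proof (rule nn_integral_cong)
        fix x
        have "normal_density 0 1 x * exp (x * m i - m i * m i / 2) = normal_density (m i) 1 x"
          by (simp add: normal_density_def exp_add[symmetric] power2_eq_square field_simps)
        then show "ennreal (normal_density 0 1 x) * (?g i x * indicator (B i) x)
           = ennreal (normal_density (m i) 1 x) * indicator (B i) x"
          by (simp add: mult.assoc[symmetric] ennreal_mult[symmetric])
      qed
      finally show "(\<integral>\<^sup>+x. ?g i x * indicator (B i) x \<partial>density lborel (normal_density 0 1))
         = emeasure (density lborel (normal_density (m i) 1)) (B i)"
        by (subst emeasure_density) auto
    qed simp
    finally show "emeasure (density (std_gauss D) (\<lambda>z. ennreal (exp (ip D z m - ip D m m / 2)))) (Pi\<^sub>E {..<D} B) =
       (\<Prod>i\<in>{..<D}. emeasure (density lborel (\<lambda>x. ennreal (normal_density (m i) 1 x))) (B i))" .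
  qed simp
  then show ?thesis by simp
qed

lemma prob_space_std_gauss: "prob_space (std_gauss D)"
  by (rule prob_space_gaussian_borel) simp

lemma std_gauss_space [simp]:
  "emeasure (std_gauss D) (space (vspace D)) = 1" "measure (std_gauss D) (space (vspace D)) = 1"
  using prob_space.emeasure_space_1[OF prob_space_std_gauss[of D]]
    prob_space.prob_space[OF prob_space_std_gauss[of D]] by simp_all

text \<open>The law with mean m has two descriptions, as an image under a shift and as a density;
  equating the integrals of f under both gives the formula.\<close>

lemma cameron_martin:
  assumes f [measurable]: "f \<in> borel_measurable (vspace D)"
  shows "(\<integral>\<^sup>+z. f (vadd D m z) \<partial>std_gauss D)
    = (\<integral>\<^sup>+z. ennreal (exp (ip D z m - ip D m m / 2)) * f z \<partial>std_gauss D)"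
proof -
  have eq: "vadd D m (vscale D 1 z) = vadd D m z" for z
    by (auto simp: vadd_def vscale_def)
  have "(\<integral>\<^sup>+z. f (vadd D m z) \<partial>std_gauss D) = (\<integral>\<^sup>+z. f z \<partial>gaussian_borel D m 1)"
    by (subst gaussian_borel_affine, simp, subst nn_integral_distr) (auto simp: eq)
  also have "\<dots> = (\<integral>\<^sup>+z. ennreal (exp (ip D z m - ip D m m / 2)) * f z \<partial>std_gauss D)"
    unfolding gaussian_borel_density[of D m] by (rule nn_integral_density) measurable
  finally show ?thesis .
qed

text \<open>Cameron-Martin for the constant function 1 says that the density has total mass
  1.\<close>

lemma gaussian_mgf: "(\<integral>\<^sup>+z. ennreal (exp (ip D z m)) \<partial>std_gauss D) = ennreal (exp (ip D m m / 2))"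
proof -
  interpret prob_space "std_gauss D" by (rule prob_space_std_gauss)
  have "1 = (\<integral>\<^sup>+z. ennreal (exp (ip D z m - ip D m m / 2)) * 1 \<partial>std_gauss D)"
    by (subst cameron_martin[symmetric]) (auto simp: emeasure_space_1)
  also have "\<dots> = (\<integral>\<^sup>+z. ennreal (exp (- ip D m m / 2)) * ennreal (exp (ip D z m)) \<partial>std_gauss D)"
    by (rule nn_integral_cong) (simp add: ennreal_mult[symmetric] exp_add[symmetric])
  also have "\<dots> = ennreal (exp (- ip D m m / 2)) * (\<integral>\<^sup>+z. ennreal (exp (ip D z m)) \<partial>std_gauss D)"
    by (rule nn_integral_cmult) measurable
  finally have "ennreal (exp (ip D m m / 2)) * 1 = ennreal (exp (ip D m m / 2)) *
     (ennreal (exp (- ip D m m / 2)) * (\<integral>\<^sup>+z. ennreal (exp (ip D z m)) \<partial>std_gauss D))"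
    by simp
  then show ?thesis
    by (simp add: mult.assoc[symmetric] ennreal_mult[symmetric] exp_add[symmetric])
qed

lemma gaussian_tail:
  assumes q: "ip D v v \<le> q" "0 < q" and t: "0 \<le> t"
  shows "measure (std_gauss D) {z \<in> space (vspace D). t \<le> ip D z v} \<le> exp (- (t\<^sup>2 / (2 * q)))"
proof -
  interpret prob_space "std_gauss D" by (rule prob_space_std_gauss)
  \<comment> \<open>The slope t / q minimizes the Chernoff exponent - s t + s^2 q / 2.\<close>
  let ?E = "{z \<in> space (vspace D). t \<le> ip D z v}" and ?s = "t / q"
  have [measurable]: "?E \<in> sets (vspace D)" by measurable
  have "emeasure (std_gauss D) ?E = (\<integral>\<^sup>+z. indicator ?E z \<partial>std_gauss D)" by simp
  also have "\<dots> \<le> (\<integral>\<^sup>+z. ennreal (exp (- ?s * t)) * ennreal (exp (ip D z (vscale D ?s v))) \<partial>std_gauss D)"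
  proof (rule nn_integral_mono)
    fix z assume "z \<in> space (std_gauss D)"
    have "1 \<le> exp (- ?s * t) * exp (ip D z (vscale D ?s v))" if "t \<le> ip D z v"
      using mult_left_mono[OF that, of ?s] t q by (simp add: exp_add[symmetric])
    then show "indicator ?E z \<le> ennreal (exp (- ?s * t)) * ennreal (exp (ip D z (vscale D ?s v)))"
      by (auto simp: indicator_def ennreal_mult[symmetric] ennreal_1[symmetric] simp del: ennreal_1)
  qed
  also have "\<dots> = ennreal (exp (- ?s * t)) * ennreal (exp (ip D (vscale D ?s v) (vscale D ?s v) / 2))"
    by (subst nn_integral_cmult, measurable) (simp only: gaussian_mgf)
  also have "\<dots> \<le> ennreal (exp (- ?s * t) * exp (?s * (?s * q) / 2))"
    unfolding ennreal_mult[symmetric, OF exp_ge_zero exp_ge_zero] ip_vscale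
    by (intro ennreal_leI mult_left_mono exp_le_cancel_iff[THEN iffD2] divide_right_mono) (use q t in auto)
  also have "exp (- ?s * t) * exp (?s * (?s * q) / 2) = exp (- (t\<^sup>2 / (2 * q)))"
    using q by (simp add: exp_add[symmetric] power2_eq_square field_simps)
  finally show ?thesis by (simp add: emeasure_eq_measure)
qed

text \<open>
  By the Cameron-Martin formula parallel hyperplanes are either all null or all of positive
  measure, and only countably many disjoint sets have positive measure.
\<close>

lemma gaussian_hyperplane_null:
  assumes v: "0 < ip D v v"
  shows "AE z in std_gauss D. ip D z v \<noteq> c"
proof -
  interpret prob_space "std_gauss D" by (rule prob_space_std_gauss)
  let ?H = "\<lambda>c. {z \<in> space (vspace D). ip D z v = c}"
  have [measurable]: "?H c \<in> sets (vspace D)" for c by measurable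
  interpret N: prob_space "distr (std_gauss D) borel (\<lambda>z. ip D z v)"
    by (rule prob_space_distr) measurable
  have dm: "measure (distr (std_gauss D) borel (\<lambda>z. ip D z v)) {c} = measure (std_gauss D) (?H c)" for c
    by (subst measure_distr) (auto intro!: arg_cong[where f="measure (std_gauss D)"])
  have zero: "emeasure (std_gauss D) (?H (c - t * ip D v v)) = 0"
    if 0: "emeasure (std_gauss D) (?H c) = 0" for c t
  proof -
    have "emeasure (std_gauss D) (?H (c - t * ip D v v))
        = (\<integral>\<^sup>+z. indicator (?H c) (vadd D (vscale D t v) z) \<partial>std_gauss D)"
      by (subst nn_integral_indicator[symmetric], measurable, intro nn_integral_cong) (auto simp: indicator_def)
    also have "\<dots> = (\<integral>\<^sup>+z. ennreal (exp (ip D z (vscale D t v) - ip D (vscale D t v) (vscale D t v) / 2))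
        * indicator (?H c) z \<partial>std_gauss D)"
      by (rule cameron_martin) measurable
    also have "\<dots> = 0"
      by (rule nn_integral_null_set) (use 0 in \<open>auto simp: null_sets_def\<close>)
    finally show ?thesis .
  qed
  have "emeasure (std_gauss D) (?H c) = 0"
  proof (rule ccontr)
    assume c: "emeasure (std_gauss D) (?H c) \<noteq> 0"
    \<comment> \<open>Shifting by a multiple of v moves level d to level c, so a null level d would
      make level c null.\<close>
    have "measure (distr (std_gauss D) borel (\<lambda>z. ip D z v)) {d} \<noteq> 0" for d
      using zero[of d "(d - c) / ip D v v"] c v by (auto simp: dm emeasure_eq_measure)
    then have "{x. measure (distr (std_gauss D) borel (\<lambda>z. ip D z v)) {x} \<noteq> 0} = UNIV" by auto
    with N.countable_support show False using uncountable_UNIV_real by simp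
  qed
  then show ?thesis by (subst AE_iff_measurable[OF _ refl]) auto
qed

text \<open>
  The sum of the success probabilities of a decoder with decision regions \<open>A i\<close>. The likelihood
  ratio of mean \<open>\<theta> i\<close> against mean \<open>0\<close> is truncated at \<open>exp T\<close>; the excess is a Gaussian tail.
\<close>

lemma sum_success_le:
  assumes I: "finite I" and s: "0 < s" and disj: "disjoint_family_on A I"
    and A: "\<And>i. i \<in> I \<Longrightarrow> A i \<in> sets (vspace D)"
    and \<theta>: "\<And>i. i \<in> I \<Longrightarrow> ip D (\<theta> i) (\<theta> i) = q * s\<^sup>2" and q: "0 < q" and T: "q / 2 \<le> T"
  shows "(\<Sum>i\<in>I. measure (std_gauss D) {z \<in> space (vspace D). vadd D (\<theta> i) (vscale D s z) \<in> A i})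
    \<le> exp T + real (card I) * exp (- ((T - q / 2)\<^sup>2 / (2 * q)))"
proof -
  interpret prob_space "std_gauss D" by (rule prob_space_std_gauss)
  \<comment> \<open>Dividing by s reduces to unit noise; the rescaled means have squared norm
    q.\<close>
  define m where "m i = vscale D (1 / s) (\<theta> i)" for i
  define B where "B i = {w \<in> space (vspace D). vscale D s w \<in> A i}" for i
  have mm: "ip D (m i) (m i) = q" if "i \<in> I" for i
    using \<theta>[OF that] s by (simp add: m_def power2_eq_square)
  have B [measurable]: "B i \<in> sets (vspace D)" if "i \<in> I" for i
  proof -
    note A[OF that, measurable]
    show ?thesis unfolding B_def by measurable
  qed
  have disjB: "disjoint_family_on B I"
    using disj by (auto simp: disjoint_family_on_def B_def)
  let ?r = "exp (- ((T - q / 2)\<^sup>2 / (2 * q)))"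
  have one: "measure (std_gauss D) {z \<in> space (vspace D). vadd D (\<theta> i) (vscale D s z) \<in> A i}
      \<le> exp T * measure (std_gauss D) (B i) + ?r" if i: "i \<in> I" for i
  proof -
    note B[OF i, measurable]
    let ?G = "{z \<in> space (vspace D). T < ip D z (m i) - q / 2}"
    have [measurable]: "?G \<in> sets (vspace D)" by measurable
    have v: "vadd D (\<theta> i) (vscale D s z) = vscale D s (vadd D (m i) z)" for z
      using s by (auto simp: vadd_def vscale_def m_def field_simps)
    have "emeasure (std_gauss D) {z \<in> space (vspace D). vadd D (\<theta> i) (vscale D s z) \<in> A i}
      = (\<integral>\<^sup>+z. indicator (B i) (vadd D (m i) z) \<partial>std_gauss D)"
    proof (subst nn_integral_indicator[symmetric])
      show "{z \<in> space (vspace D). vadd D (\<theta> i) (vscale D s z) \<in> A i} \<in> sets (std_gauss D)"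
        using A[OF i, measurable] by measurable
      show "(\<integral>\<^sup>+z. indicator {z \<in> space (vspace D). vadd D (\<theta> i) (vscale D s z) \<in> A i} z \<partial>std_gauss D)
         = (\<integral>\<^sup>+z. indicator (B i) (vadd D (m i) z) \<partial>std_gauss D)"
        by (intro nn_integral_cong) (auto simp: indicator_def v B_def)
    qed
    also have "\<dots> = (\<integral>\<^sup>+z. ennreal (exp (ip D z (m i) - ip D (m i) (m i) / 2)) * indicator (B i) z \<partial>std_gauss D)"
      by (rule cameron_martin) measurable
    \<comment> \<open>Off \<open>?G\<close> the likelihood ratio is at most exp T; on
      \<open>?G\<close> the full density is kept and the region is forgotten.\<close>
    also have "\<dots> \<le> (\<integral>\<^sup>+z. ennreal (exp T) * indicator (B i) z
        + ennreal (exp (ip D z (m i) - ip D (m i) (m i) / 2)) * indicator ?G z \<partial>std_gauss D)"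
      by (rule nn_integral_mono) (auto simp: indicator_def mm[OF i] intro!: ennreal_leI)
    also have "\<dots> = ennreal (exp T) * emeasure (std_gauss D) (B i)
        + (\<integral>\<^sup>+z. ennreal (exp (ip D z (m i) - ip D (m i) (m i) / 2)) * indicator ?G z \<partial>std_gauss D)"
      by (subst nn_integral_add) (auto simp: nn_integral_cmult)
    \<comment> \<open>Cameron-Martin read backwards: the kept part is the probability of
      \<open>?G\<close> under mean m i, where the log ratio is shifted by q, so the threshold T + q
      / 2 becomes T - q / 2.\<close>
    also have "(\<integral>\<^sup>+z. ennreal (exp (ip D z (m i) - ip D (m i) (m i) / 2)) * indicator ?G z \<partial>std_gauss D)
       = (\<integral>\<^sup>+z. indicator ?G (vadd D (m i) z) \<partial>std_gauss D)"
      by (rule cameron_martin[symmetric]) measurable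
    also have "\<dots> = emeasure (std_gauss D) {z \<in> space (vspace D). T - q / 2 < ip D z (m i)}"
      by (subst nn_integral_indicator[symmetric], measurable, intro nn_integral_cong)
         (auto simp: indicator_def mm[OF i])
    also have "\<dots> \<le> emeasure (std_gauss D) {z \<in> space (vspace D). T - q / 2 \<le> ip D z (m i)}"
      by (rule emeasure_mono) auto
    also have "\<dots> \<le> ennreal ?r"
      unfolding emeasure_eq_measure
      by (intro ennreal_leI gaussian_tail) (use mm[OF i] q T in auto)
    finally show ?thesis
      by (simp add: emeasure_eq_measure ennreal_mult[symmetric] ennreal_plus[symmetric] del: ennreal_plus)
  qed
  have "(\<Sum>i\<in>I. measure (std_gauss D) {z \<in> space (vspace D). vadd D (\<theta> i) (vscale D s z) \<in> A i})
      \<le> (\<Sum>i\<in>I. exp T * measure (std_gauss D) (B i) + ?r)"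
    by (intro sum_mono one)
  also have "\<dots> = exp T * (\<Sum>i\<in>I. measure (std_gauss D) (B i)) + real (card I) * ?r"
    by (simp add: sum.distrib sum_distrib_left)
  \<comment> \<open>Disjoint decision regions share total mass 1 under mean zero. This is why the
    first term is exp T and not card I times exp T.\<close>
  also have "(\<Sum>i\<in>I. measure (std_gauss D) (B i)) = measure (std_gauss D) (\<Union>i\<in>I. B i)"
    by (rule finite_measure_finite_Union[symmetric]) (use I disjB in auto)
  also have "exp T * measure (std_gauss D) (\<Union>i\<in>I. B i) \<le> exp T * 1"
    by (intro mult_left_mono prob_le_1) auto
  finally show ?thesis by simp
qed

text \<open>Completing the square: in each coordinate the tilted density is 1 / sqrt 2 times exp
  (w^2 / 4) times a normal density with mean w / 2 and variance 1 / 2. The integrand is chosen to be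
  a Cameron-Martin density in y or in w, while its integral depends on w only through the norm,
  hence is invariant under reflections.\<close>

lemma gaussian_quadratic_tilt:
  "\<exists>c>0. \<forall>w. (\<integral>\<^sup>+y. ennreal (exp (ip D w y - ip D y y / 2)) \<partial>std_gauss D) = ennreal (c * exp (ip D w w / 4))"
proof (intro exI conjI allI)
  have pn: "prob_space (density lborel (normal_density a b))" if "0 < b" for a b
    using that by (rule prob_space_normal_density)
  interpret Z: product_prob_space "\<lambda>i::nat. density lborel (normal_density 0 1)" "{..<D}"
    by (intro product_prob_spaceI pn) simp
  show "(0::real) < (1 / sqrt 2) ^ D" by simp
  fix w :: vec
  have "(\<integral>\<^sup>+y. ennreal (exp (ip D w y - ip D y y / 2)) \<partial>std_gauss D)
     = (\<integral>\<^sup>+y. (\<Prod>i<D. ennreal (exp (w i * y i - y i * y i / 2))) \<partial>std_gauss D)"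
    by (intro nn_integral_cong)
       (simp add: prod_ennreal ip_def exp_sum[symmetric] sum_subtractf sum_divide_distrib)
  also have "\<dots> = (\<Prod>i<D. \<integral>\<^sup>+y. ennreal (exp (w i * y - y * y / 2)) \<partial>density lborel (normal_density 0 1))"
    unfolding gaussian_borel_def by (rule Z.product_nn_integral_prod) auto
  also have "\<dots> = (\<Prod>i<D. ennreal ((1 / sqrt 2) * exp (w i * w i / 4)))"
  proof (rule prod.cong)
    fix i
    have "(\<integral>\<^sup>+y. ennreal (exp (w i * y - y * y / 2)) \<partial>density lborel (normal_density 0 1))
       = (\<integral>\<^sup>+y. ennreal (normal_density 0 1 y) * ennreal (exp (w i * y - y * y / 2)) \<partial>lborel)"
      by (rule nn_integral_density) auto
    also have "\<dots> = (\<integral>\<^sup>+y. ennreal ((1 / sqrt 2) * exp (w i * w i / 4)) * ennreal (normal_density (w i / 2) (1 / sqrt 2) y) \<partial>lborel)"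
    proof (rule nn_integral_cong)
      fix y :: real
      have "normal_density 0 1 y * exp (w i * y - y * y / 2) 
          = (1 / sqrt 2) * exp (w i * w i / 4) * normal_density (w i / 2) (1 / sqrt 2) y"
        by (simp add: normal_density_def real_sqrt_divide real_sqrt_mult power_divide)
           (simp add: exp_add[symmetric] power2_eq_square field_simps)
      then show "ennreal (normal_density 0 1 y) * ennreal (exp (w i * y - y * y / 2))
        = ennreal ((1 / sqrt 2) * exp (w i * w i / 4)) * ennreal (normal_density (w i / 2) (1 / sqrt 2) y)"
        by (simp add: ennreal_mult[symmetric])
    qed
    also have "\<dots> = ennreal ((1 / sqrt 2) * exp (w i * w i / 4)) * emeasure (density lborel (normal_density (w i / 2) (1 / sqrt 2))) UNIV"
      by (subst nn_integral_cmult, simp, subst emeasure_density) auto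
    also have "emeasure (density lborel (normal_density (w i / 2) (1 / sqrt 2))) UNIV = 1"
      using prob_space.emeasure_space_1[OF pn[of "1 / sqrt 2" "w i / 2"]] by simp
    finally show "(\<integral>\<^sup>+y. ennreal (exp (w i * y - y * y / 2)) \<partial>density lborel (normal_density 0 1))
      = ennreal ((1 / sqrt 2) * exp (w i * w i / 4))" by simp
  qed simp
  also have "\<dots> = ennreal ((1 / sqrt 2) ^ D * exp (ip D w w / 4))"
    by (simp add: prod_ennreal prod.distrib ip_def exp_sum[symmetric] sum_divide_distrib power_divide prod_dividef)
  finally show "(\<integral>\<^sup>+y. ennreal (exp (ip D w y - ip D y y / 2)) \<partial>std_gauss D)
    = ennreal ((1 / sqrt 2) ^ D * exp (ip D w w / 4))" .
qed

text \<open>The reflection in the hyperplane orthogonal to d, written for d of squared norm 2, where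
  the factor 2 / |d|^2 is 1. For orthonormal u and v the choice d = u - v exchanges u and v.\<close>

definition reflect :: "nat \<Rightarrow> vec \<Rightarrow> vec \<Rightarrow> vec" where
  "reflect D d z = vadd D z (vscale D (- ip D z d) d)"

lemma reflect_measurable [measurable]: "reflect D d \<in> vspace D \<rightarrow>\<^sub>M vspace D"
  unfolding reflect_def[abs_def] by measurable

text \<open>
  With \<open>K w\<close> the integral in \<open>gaussian_quadratic_tilt\<close> and \<open>U\<close> the reflection, the double integral
  of \<open>f (U z + y)\<close> equals the integral of \<open>f (U z) * K (U z)\<close> when \<open>z\<close> is shifted, and that of
  \<open>f y * K y\<close> when \<open>y\<close> is shifted.
\<close>

lemma gaussian_reflect:
  assumes d: "ip D d d = 2" and g [measurable]: "g \<in> borel_measurable (vspace D)"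
  shows "(\<integral>\<^sup>+z. g (reflect D d z) \<partial>std_gauss D) = (\<integral>\<^sup>+z. g z \<partial>std_gauss D)"
proof -
  interpret prob_space "std_gauss D" by (rule prob_space_std_gauss)
  interpret PP: pair_sigma_finite "std_gauss D" "std_gauss D" ..
  obtain c where c: "c > 0" and
    K: "\<And>w. (\<integral>\<^sup>+y. ennreal (exp (ip D w y - ip D y y / 2)) \<partial>std_gauss D) = ennreal (c * exp (ip D w w / 4))"
    using gaussian_quadratic_tilt by blast
  define U where "U = reflect D d"
  have Um [measurable]: "U \<in> vspace D \<rightarrow>\<^sub>M vspace D" by (simp add: U_def)
  have UU: "ip D (U x) (U y) = ip D x y" for x y
    using ip_commute[of D d y] ip_commute[of D d x] by (simp add: U_def reflect_def d algebra_simps)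
  have Usym: "ip D (U x) y = ip D x (U y)" for x y
    using ip_commute[of D d y] ip_commute[of D d x] by (simp add: U_def reflect_def)
  have Uc: "U z i = z i - ip D z d * d i" if "i < D" for z i
    using that by (simp add: U_def reflect_def vadd_def vscale_def)
  have Ulin: "U (vadd D z (U y)) = vadd D (U z) y" if y: "y \<in> space (vspace D)" for y z
  proof (rule vspace_eqI[of _ D])
    show "U (vadd D z (U y)) \<in> space (vspace D)" by (simp add: U_def reflect_def)
    have "ip D (U y) d = - ip D y d"
      by (simp add: U_def reflect_def d)
    then have e: "ip D (vadd D z (U y)) d = ip D z d - ip D y d" by simp
    fix i assume i: "i < D"
    show "U (vadd D z (U y)) i = vadd D (U z) y i"
      unfolding Uc[OF i] e using i by (simp add: vadd_def Uc algebra_simps)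
  qed simp
  \<comment> \<open>Dividing out the tilt makes f times the tilt equal to g; the tilt is positive,
    so this is legitimate.\<close>
  define f where "f z = g z * ennreal (inverse (c * exp (ip D z z / 4)))" for z
  have f [measurable]: "f \<in> borel_measurable (vspace D)" unfolding f_def[abs_def] by measurable
  have fK: "f z * ennreal (c * exp (ip D z z / 4)) = g z" for z
    using c by (simp add: f_def mult.assoc ennreal_mult[symmetric] field_simps)
  have "(\<integral>\<^sup>+z. g (U z) \<partial>std_gauss D) = (\<integral>\<^sup>+z. f (U z) * ennreal (c * exp (ip D (U z) (U z) / 4)) \<partial>std_gauss D)"
    by (simp add: fK)
  also have "\<dots> = (\<integral>\<^sup>+z. \<integral>\<^sup>+y. ennreal (exp (ip D z (U y) - ip D (U y) (U y) / 2)) * f (U z) \<partial>std_gauss D \<partial>std_gauss D)"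
  proof (intro nn_integral_cong)
    fix z
    show "f (U z) * ennreal (c * exp (ip D (U z) (U z) / 4))
      = (\<integral>\<^sup>+y. ennreal (exp (ip D z (U y) - ip D (U y) (U y) / 2)) * f (U z) \<partial>std_gauss D)"
      unfolding K[symmetric]
      by (subst nn_integral_multc, measurable) (simp only: UU Usym[of z] mult.commute)
  qed
  also have "\<dots> = (\<integral>\<^sup>+y. \<integral>\<^sup>+z. ennreal (exp (ip D z (U y) - ip D (U y) (U y) / 2)) * f (U z) \<partial>std_gauss D \<partial>std_gauss D)"
    by (rule PP.Fubini'[symmetric]) measurable
  also have "\<dots> = (\<integral>\<^sup>+y. \<integral>\<^sup>+z. f (U (vadd D (U y) z)) \<partial>std_gauss D \<partial>std_gauss D)"
    by (intro nn_integral_cong cameron_martin[symmetric]) measurable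
  also have "\<dots> = (\<integral>\<^sup>+y. \<integral>\<^sup>+z. f (vadd D (U z) y) \<partial>std_gauss D \<partial>std_gauss D)"
  proof (intro nn_integral_cong)
    fix y z assume "y \<in> space (std_gauss D)"
    moreover have "vadd D (U y) z = vadd D z (U y)" by (auto simp: vadd_def)
    ultimately show "f (U (vadd D (U y) z)) = f (vadd D (U z) y)" using Ulin by simp
  qed
  also have "\<dots> = (\<integral>\<^sup>+z. \<integral>\<^sup>+y. f (vadd D (U z) y) \<partial>std_gauss D \<partial>std_gauss D)"
    by (rule PP.Fubini') measurable
  also have "\<dots> = (\<integral>\<^sup>+z. \<integral>\<^sup>+y. ennreal (exp (ip D y (U z) - ip D (U z) (U z) / 2)) * f y \<partial>std_gauss D \<partial>std_gauss D)"
    by (intro nn_integral_cong cameron_martin) measurable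
  also have "\<dots> = (\<integral>\<^sup>+y. \<integral>\<^sup>+z. ennreal (exp (ip D y (U z) - ip D (U z) (U z) / 2)) * f y \<partial>std_gauss D \<partial>std_gauss D)"
    by (rule PP.Fubini'[symmetric]) measurable
  also have "\<dots> = (\<integral>\<^sup>+y. f y * ennreal (c * exp (ip D (U y) (U y) / 4)) \<partial>std_gauss D)"
  proof (intro nn_integral_cong)
    fix y
    show "(\<integral>\<^sup>+z. ennreal (exp (ip D y (U z) - ip D (U z) (U z) / 2)) * f y \<partial>std_gauss D)
      = f y * ennreal (c * exp (ip D (U y) (U y) / 4))"
      unfolding K[symmetric]
      by (subst nn_integral_multc, measurable) (simp only: UU Usym[of y] mult.commute)
  qed
  also have "\<dots> = (\<integral>\<^sup>+y. g y \<partial>std_gauss D)"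
    by (simp add: fK UU)
  finally show ?thesis by (simp add: U_def)
qed

section \<open>Orthonormal functionals of a Gaussian vector\<close>

definition orthonormal_fam :: "nat \<Rightarrow> 'i set \<Rightarrow> ('i \<Rightarrow> vec) \<Rightarrow> bool" where
  "orthonormal_fam D I u \<longleftrightarrow> (\<forall>i\<in>I. \<forall>j\<in>I. ip D (u i) (u j) = (if i = j then 1 else 0))"

text \<open>
  The bound \<open>sum_success_le\<close> divided by the number \<open>n\<close> of means.
\<close>

definition converse_err :: "real \<Rightarrow> real \<Rightarrow> real \<Rightarrow> real" where
  "converse_err n q T = exp T / n + exp (- ((T - q / 2)\<^sup>2 / (2 * q)))"

text \<open>This is \<open>sum_success_le\<close> with unit noise for the nearest-neighbor decoder
  of the codewords s u_i. They have equal norms, so the nearest one has the largest inner product,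
  and sending s u_i raises only the i-th functional, by s.\<close>

lemma sum_nn_cells_le:
  assumes I: "finite I" and u: "orthonormal_fam D I u" and s: "0 < s" and T: "s\<^sup>2 / 2 \<le> T"
  shows "(\<Sum>i\<in>I. measure (std_gauss D) {z \<in> space (vspace D). \<forall>j\<in>I. j \<noteq> i \<longrightarrow> ip D z (u j) < ip D z (u i) + s})
    \<le> real (card I) * converse_err (card I) (s\<^sup>2) T"
proof (cases "I = {}")
  case False
  define A where "A i = {w \<in> space (vspace D). \<forall>j\<in>I. j \<noteq> i \<longrightarrow> ip D w (u j) < ip D w (u i)}" for i
  have "(\<Sum>i\<in>I. measure (std_gauss D) {z \<in> space (vspace D). vadd D (vscale D s (u i)) (vscale D 1 z) \<in> A i})
      \<le> exp T + real (card I) * exp (- ((T - s\<^sup>2 / 2)\<^sup>2 / (2 * s\<^sup>2)))"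
  proof (rule sum_success_le[OF I])
    show "disjoint_family_on A I"
      unfolding disjoint_family_on_def A_def by (auto dest: less_asym)
    show "A i \<in> sets (vspace D)" for i
      unfolding A_def using I by measurable
    show "ip D (vscale D s (u i)) (vscale D s (u i)) = s\<^sup>2 * 1\<^sup>2" if "i \<in> I" for i
      using u that by (simp add: orthonormal_fam_def power2_eq_square)
  qed (use s T in auto)
  also have "(\<Sum>i\<in>I. measure (std_gauss D) {z \<in> space (vspace D). vadd D (vscale D s (u i)) (vscale D 1 z) \<in> A i})
     = (\<Sum>i\<in>I. measure (std_gauss D) {z \<in> space (vspace D). \<forall>j\<in>I. j \<noteq> i \<longrightarrow> ip D z (u j) < ip D z (u i) + s})"
  proof (intro sum.cong refl arg_cong[where f = "measure (std_gauss D)"] Collect_cong conj_cong)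
    fix i z assume i: "i \<in> I"
    have "(ip D (vadd D (vscale D s (u i)) (vscale D 1 z)) (u j) < ip D (vadd D (vscale D s (u i)) (vscale D 1 z)) (u i))
       = (ip D z (u j) < ip D z (u i) + s)" if "j \<in> I" "j \<noteq> i" for j
      using u i that by (auto simp: orthonormal_fam_def)
    then show "(vadd D (vscale D s (u i)) (vscale D 1 z) \<in> A i) = (\<forall>j\<in>I. j \<noteq> i \<longrightarrow> ip D z (u j) < ip D z (u i) + s)"
      unfolding A_def by auto
  qed
  finally show ?thesis using False I by (simp add: converse_err_def algebra_simps)
qed simp

text \<open>
  The event on the left of \<open>sum_nn_cells_le\<close> contains the complement of the event below for every
  \<open>i\<close>, so averaging over \<open>i\<close> loses nothing.
\<close>

lemma range_prob_ge:
  assumes I: "finite I" "I \<noteq> {}" and u: "orthonormal_fam D I u" and s: "0 < s" and T: "s\<^sup>2 / 2 \<le> T"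
  shows "1 - converse_err (card I) (s\<^sup>2) T
    \<le> measure (std_gauss D) {z \<in> space (vspace D). \<exists>i\<in>I. \<exists>j\<in>I. s \<le> ip D z (u j) - ip D z (u i)}"
proof -
  interpret prob_space "std_gauss D" by (rule prob_space_std_gauss)
  let ?E = "{z \<in> space (vspace D). \<exists>i\<in>I. \<exists>j\<in>I. s \<le> ip D z (u j) - ip D z (u i)}"
  have [measurable]: "?E \<in> sets (vspace D)" using I by measurable
  have "real (card I) * (1 - measure (std_gauss D) ?E) = (\<Sum>i\<in>I. measure (std_gauss D) (space (vspace D) - ?E))"
    using prob_compl[of ?E] by simp
  also have "\<dots> \<le> (\<Sum>i\<in>I. measure (std_gauss D) {z \<in> space (vspace D). \<forall>j\<in>I. j \<noteq> i \<longrightarrow> ip D z (u j) < ip D z (u i) + s})"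
    by (intro sum_mono finite_measure_mono) (use I in \<open>force simp: not_le\<close>)+
  also have "\<dots> \<le> real (card I) * converse_err (card I) (s\<^sup>2) T"
    by (rule sum_nn_cells_le[OF I(1) u s T])
  finally show ?thesis using I by (simp add: card_gt_0_iff)
qed

text \<open>A large range might be due to a very negative minimum. In the averaged argument,
  however, the reference index i is fixed, and a single functional is below -K only with probability
  exp (- K^2 / 2). If all functionals are below s - K, then either the i-th one is at most -K or z
  lies in the i-th cell.\<close>

lemma max_prob_ge:
  assumes I: "finite I" "I \<noteq> {}" and u: "orthonormal_fam D I u" and s: "0 < s" and T: "s\<^sup>2 / 2 \<le> T"
    and K: "0 \<le> K"
  shows "1 - (converse_err (card I) (s\<^sup>2) T + exp (- (K\<^sup>2 / 2)))
    \<le> measure (std_gauss D) {z \<in> space (vspace D). \<exists>j\<in>I. s - K \<le> ip D z (u j)}"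
proof -
  interpret prob_space "std_gauss D" by (rule prob_space_std_gauss)
  let ?E = "{z \<in> space (vspace D). \<exists>j\<in>I. s - K \<le> ip D z (u j)}"
  let ?C = "\<lambda>i. {z \<in> space (vspace D). \<forall>j\<in>I. j \<noteq> i \<longrightarrow> ip D z (u j) < ip D z (u i) + s}"
  let ?L = "\<lambda>i. {z \<in> space (vspace D). K \<le> ip D z (vscale D (-1) (u i))}"
  have [measurable]: "?E \<in> sets (vspace D)" "?C i \<in> sets (vspace D)" "?L i \<in> sets (vspace D)" for i
    using I by measurable
  have L: "measure (std_gauss D) (?L i) \<le> exp (- (K\<^sup>2 / 2))" if "i \<in> I" for i
    using gaussian_tail[of D "vscale D (-1) (u i)" 1 K] u that K by (simp add: orthonormal_fam_def)
  have "real (card I) * (1 - measure (std_gauss D) ?E) = (\<Sum>i\<in>I. measure (std_gauss D) (space (vspace D) - ?E))"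
    using prob_compl[of ?E] by simp
  also have "\<dots> \<le> (\<Sum>i\<in>I. measure (std_gauss D) (?C i) + exp (- (K\<^sup>2 / 2)))"
  proof (rule sum_mono)
    fix i assume i: "i \<in> I"
    have "measure (std_gauss D) (space (vspace D) - ?E) \<le> measure (std_gauss D) (?C i \<union> ?L i)"
      by (intro finite_measure_mono) (force simp: not_le)+
    also have "\<dots> \<le> measure (std_gauss D) (?C i) + measure (std_gauss D) (?L i)"
      by (rule measure_Un_le) simp_all
    finally show "measure (std_gauss D) (space (vspace D) - ?E) \<le> measure (std_gauss D) (?C i) + exp (- (K\<^sup>2 / 2))"
      using L[OF i] by simp
  qed
  also have "\<dots> \<le> real (card I) * (converse_err (card I) (s\<^sup>2) T + exp (- (K\<^sup>2 / 2)))"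
    using sum_nn_cells_le[OF I(1) u s T] by (simp add: sum.distrib algebra_simps)
  finally show ?thesis using I by (simp add: card_gt_0_iff)
qed

text \<open>The events that index i is the strict maximizer are disjoint, and the reflection along
  u_i - u_k carries one into another, so each has probability at most 1 / card I. Ties lie on
  finitely many hyperplanes and are null.\<close>

lemma argmax_prob_le:
  assumes I: "finite I" and u: "orthonormal_fam D I u" and k: "k \<in> I"
  shows "measure (std_gauss D) {z \<in> space (vspace D). \<forall>i\<in>I. ip D z (u i) \<le> ip D z (u k)} \<le> 1 / real (card I)"
proof -
  interpret prob_space "std_gauss D" by (rule prob_space_std_gauss)
  define B where "B k = {z \<in> space (vspace D). \<forall>i\<in>I. i \<noteq> k \<longrightarrow> ip D z (u i) < ip D z (u k)}" for k
  have Bm [measurable]: "B i \<in> sets (vspace D)" for i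
    unfolding B_def using I by measurable
  have ortho: "ip D (u i) (u j) = (if i = j then 1 else 0)" if "i \<in> I" "j \<in> I" for i j
    using u that by (simp add: orthonormal_fam_def)
  have Bk: "measure (std_gauss D) (B i) = measure (std_gauss D) (B k)" if i: "i \<in> I" for i
  proof (cases "i = k")
    case False
    define d where "d = vadd D (u i) (vscale D (-1) (u k))"
    have dd: "ip D d d = 2" using False i k by (simp add: d_def ortho)
    have r: "ip D (reflect D d z) (u j) = (if j = i then ip D z (u k) else if j = k then ip D z (u i) else ip D z (u j))"
      if "j \<in> I" for z j
      using that i k False by (auto simp: reflect_def d_def ortho)
    have sp: "reflect D d z \<in> space (vspace D)" for z by (simp add: reflect_def)
    have "(reflect D d z \<in> B k) = (z \<in> B i)" if "z \<in> space (vspace D)" for z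
    proof -
      have "(\<forall>j\<in>I. j \<noteq> k \<longrightarrow> ip D (reflect D d z) (u j) < ip D (reflect D d z) (u k))
        = (\<forall>j\<in>I. j \<noteq> k \<longrightarrow> (if j = i then ip D z (u k) else ip D z (u j)) < ip D z (u i))"
        using i k False by (intro ball_cong) (auto simp: r)
      also have "\<dots> = (\<forall>j\<in>I. j \<noteq> i \<longrightarrow> ip D z (u j) < ip D z (u i))"
        using i k False by auto
      finally show ?thesis using that sp by (simp add: B_def)
    qed
    then have "(\<integral>\<^sup>+z. indicator (B i) z \<partial>std_gauss D) = (\<integral>\<^sup>+z. indicator (B k) (reflect D d z) \<partial>std_gauss D)"
      by (intro nn_integral_cong) (simp add: indicator_def)
    also have "\<dots> = (\<integral>\<^sup>+z. indicator (B k) z \<partial>std_gauss D)"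
      by (rule gaussian_reflect[OF dd]) measurable
    finally show ?thesis by (simp add: emeasure_eq_measure)
  qed simp
  have disj: "disjoint_family_on B I"
    unfolding disjoint_family_on_def B_def by (auto dest: less_asym)
  have "real (card I) * measure (std_gauss D) (B k) = (\<Sum>i\<in>I. measure (std_gauss D) (B i))"
    by (simp add: Bk)
  also have "\<dots> = measure (std_gauss D) (\<Union>i\<in>I. B i)"
    by (rule finite_measure_finite_Union[symmetric]) (use I disj in auto)
  also have "\<dots> \<le> 1" by (rule prob_le_1)
  finally have le: "measure (std_gauss D) (B k) \<le> 1 / real (card I)"
    using I k by (subst pos_le_divide_eq) (auto simp: mult.commute card_gt_0_iff)
  have "AE z in std_gauss D. ip D z (vadd D (u i) (vscale D (-1) (u k))) \<noteq> 0" if "i \<in> I" "i \<noteq> k" for i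
    by (rule gaussian_hyperplane_null) (use that k in \<open>simp add: ortho\<close>)
  then have "AE z in std_gauss D. \<forall>i\<in>I. i \<noteq> k \<longrightarrow> ip D z (u i) \<noteq> ip D z (u k)"
    using I by (subst AE_finite_all) auto
  then have "measure (std_gauss D) {z \<in> space (vspace D). \<forall>i\<in>I. ip D z (u i) \<le> ip D z (u k)} \<le> measure (std_gauss D) (B k)"
    by (intro finite_measure_mono_AE) (use Bm[of k] in \<open>auto simp: B_def le_less\<close>)
  with le show ?thesis by simp
qed

section \<open>Expected suprema by exponential domination, and Gaussian ranges\<close>

lemma exp_ip_integrable:
  "integrable (std_gauss D) (\<lambda>z. exp (t * ip D z v))"
  "(\<integral>z. exp (t * ip D z v) \<partial>std_gauss D) = exp (t\<^sup>2 * ip D v v / 2)"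
proof -
  have "(\<integral>\<^sup>+z. ennreal (exp (t * ip D z v)) \<partial>std_gauss D) = ennreal (exp (t\<^sup>2 * ip D v v / 2))"
    using gaussian_mgf[of D "vscale D t v"] by (simp add: power2_eq_square mult.assoc)
  then have "integrable (std_gauss D) (\<lambda>z. exp (t * ip D z v)) \<and>
     (\<integral>z. exp (t * ip D z v) \<partial>std_gauss D) = exp (t\<^sup>2 * ip D v v / 2)"
    by (subst (asm) nn_integral_eq_integrable) auto
  then show "integrable (std_gauss D) (\<lambda>z. exp (t * ip D z v))"
    "(\<integral>z. exp (t * ip D z v) \<partial>std_gauss D) = exp (t\<^sup>2 * ip D v v / 2)" by auto
qed

text \<open>
  Dominates \<open>\<bar>\<langle>z, v\<rangle>\<bar> - a / t\<close> for all \<open>v \<in> V\<close> at once, by \<open>x \<le> a + exp (x - a)\<close>.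
\<close>

definition exp_dom :: "nat \<Rightarrow> vec set \<Rightarrow> real \<Rightarrow> real \<Rightarrow> vec \<Rightarrow> real" where
  "exp_dom D V a t z = exp (- a) / t * (\<Sum>v\<in>V. exp (t * ip D z v) + exp (- t * ip D z v))"

lemma exp_dom_nonneg: "0 < t \<Longrightarrow> 0 \<le> exp_dom D V a t z"
  unfolding exp_dom_def by (intro mult_nonneg_nonneg sum_nonneg) auto

lemma abs_ip_le_exp_dom:
  assumes "finite V" "v \<in> V" "0 < t"
  shows "\<bar>ip D z v\<bar> \<le> a / t + exp_dom D V a t z"
proof -
  let ?x = "ip D z v"
  have "t * \<bar>?x\<bar> - a \<le> exp (t * \<bar>?x\<bar> - a)" using exp_ge_add_one_self[of "t * \<bar>?x\<bar> - a"] by linarith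
  also have "\<dots> = exp (- a) * exp (t * \<bar>?x\<bar>)" by (simp add: exp_add[symmetric])
  also have "exp (t * \<bar>?x\<bar>) \<le> exp (t * ?x) + exp (- t * ?x)"
    by (cases "0 \<le> ?x") auto
  also have "\<dots> \<le> (\<Sum>v\<in>V. exp (t * ip D z v) + exp (- t * ip D z v))"
    using assms by (intro member_le_sum) (auto intro: add_nonneg_nonneg)
  finally have "t * \<bar>?x\<bar> \<le> a + exp (- a) * (\<Sum>v\<in>V. exp (t * ip D z v) + exp (- t * ip D z v))" by simp
  then show ?thesis using assms(3) by (simp add: exp_dom_def field_simps)
qed

lemma exp_dom_integral:
  assumes t: "0 < t" and q: "\<And>v. v \<in> V \<Longrightarrow> ip D v v \<le> q"
  shows "integrable (std_gauss D) (exp_dom D V a t)"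
    and "(\<integral>z. exp_dom D V a t z \<partial>std_gauss D) \<le> 2 * real (card V) * exp (t\<^sup>2 * q / 2 - a) / t"
proof -
  note [simp] = exp_ip_integrable exp_ip_integrable[of D "- t" for D, simplified]
  show "integrable (std_gauss D) (exp_dom D V a t)"
    unfolding exp_dom_def by auto
  have "(\<integral>z. exp_dom D V a t z \<partial>std_gauss D) = exp (- a) / t * (\<Sum>v\<in>V. 2 * exp (t\<^sup>2 * ip D v v / 2))"
    unfolding exp_dom_def by (simp add: integral_sum)
  also have "\<dots> \<le> exp (- a) / t * (\<Sum>v\<in>V. 2 * exp (t\<^sup>2 * q / 2))"
    using t by (intro mult_left_mono sum_mono) (auto intro!: mult_left_mono divide_right_mono q)
  also have "\<dots> = 2 * real (card V) * exp (t\<^sup>2 * q / 2 - a) / t"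
    by (simp add: exp_diff) (simp add: exp_minus field_simps)
  finally show "(\<integral>z. exp_dom D V a t z \<partial>std_gauss D) \<le> 2 * real (card V) * exp (t\<^sup>2 * q / 2 - a) / t" .
qed

lemma gauss_sup_ge:
  assumes V: "finite V" and "s \<in> V" "u \<in> V"
  shows "ip D z s - ip D z u \<le> (SUP (s, u)\<in>V \<times> V. ip D z s - ip D z u)"
proof -
  have bdd: "bdd_above ((\<lambda>(s, u). ip D z s - ip D z u) ` (V \<times> V))"
    using V by (intro bdd_above_finite) auto
  show ?thesis using cSUP_upper[OF _ bdd, of "(s, u)"] assms by simp
qed

lemma gauss_sup_le:
  assumes V: "finite V" "V \<noteq> {}" and t: "0 < t"
  shows "(SUP (s, u)\<in>V \<times> V. ip D z s - ip D z u) \<le> 2 * (a / t + exp_dom D V a t z)"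
proof (rule cSUP_least)
  fix p assume "p \<in> V \<times> V"
  then obtain s u where p: "p = (s, u)" "s \<in> V" "u \<in> V" by auto
  have "\<bar>ip D z s\<bar> \<le> a / t + exp_dom D V a t z" "\<bar>ip D z u\<bar> \<le> a / t + exp_dom D V a t z"
    using p V t by (auto intro!: abs_ip_le_exp_dom)
  then show "(case p of (s, u) \<Rightarrow> ip D z s - ip D z u) \<le> 2 * (a / t + exp_dom D V a t z)"
    using p by (simp add: abs_le_iff)
qed (use V in auto)

lemma gauss_sup_nonneg:
  assumes V: "finite V" "V \<noteq> {}"
  shows "0 \<le> (SUP (s, u)\<in>V \<times> V. ip D z s - ip D z u)"
proof -
  obtain v where "v \<in> V" using V by auto
  from gauss_sup_ge[OF V(1) this this] show ?thesis by simp
qed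

lemma gauss_sup_integrable:
  assumes V: "finite V" "V \<noteq> {}"
  shows "integrable (std_gauss D) (\<lambda>z. SUP (s, u)\<in>V \<times> V. ip D z s - ip D z u)"
proof (rule Bochner_Integration.integrable_bound)
  interpret prob_space "std_gauss D" by (rule prob_space_std_gauss)
  show "integrable (std_gauss D) (\<lambda>z. 2 * (1 / 1 + exp_dom D V 1 1 z))"
    using exp_dom_integral(1)[of 1 V D "Max ((\<lambda>v. ip D v v) ` V)" 1] V by auto
  have bdd: "bdd_above ((\<lambda>(s, u). ip D z s - ip D z u) ` (V \<times> V))" for z
    using V by (intro bdd_above_finite) auto
  show "(\<lambda>z. SUP (s, u)\<in>V \<times> V. ip D z s - ip D z u) \<in> borel_measurable (std_gauss D)"
    by (rule borel_measurable_cSUP) (use V bdd in \<open>auto simp: countable_finite\<close>)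
  show "AE z in std_gauss D. norm (SUP (s, u)\<in>V \<times> V. ip D z s - ip D z u) \<le> norm (2 * (1 / 1 + exp_dom D V 1 1 z))"
  proof (rule AE_I2)
    fix z
    show "norm (SUP (s, u)\<in>V \<times> V. ip D z s - ip D z u) \<le> norm (2 * (1 / 1 + exp_dom D V 1 1 z))"
      using gauss_sup_le[OF V, of 1 D z 1] gauss_sup_nonneg[OF V, of D z] by (simp only: real_norm_def) linarith
  qed
qed

lemma gauss_range_eq:
  assumes "finite V" "V \<noteq> {}"
  shows "gauss_range A V = (\<integral>z. (SUP (s, u)\<in>V \<times> V. ip (dm A) z s - ip (dm A) z u) \<partial>std_gauss (dm A))"
  unfolding gauss_range_def Z_law_def gaussian_def
  using gauss_sup_integrable[OF assms, of "dm A"] by (intro integral_completion borel_measurable_integrable)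

lemma half_le_ln:
  assumes "2 \<le> n"
  shows "1 / 2 \<le> ln (real n)"
proof -
  have "1 / 2 \<le> ln (2::real)" using ln2_ge_two_thirds by simp
  also have "\<dots> \<le> ln (real n)" using assms by simp
  finally show ?thesis .
qed

lemma gauss_range_le:
  assumes V: "finite V" "2 \<le> card V" and q: "\<And>v. v \<in> V \<Longrightarrow> ip (dm A) v v \<le> q\<^sup>2" "0 < q"
  shows "gauss_range A V \<le> 12 * (q * sqrt (ln (real (card V))))"
proof -
  interpret prob_space "std_gauss (dm A)" by (rule prob_space_std_gauss)
  let ?n = "real (card V)"
  define L where "L = ln ?n"
  have L: "1 / 2 \<le> L" "?n = exp L" using half_le_ln[OF V(2)] V(2) by (auto simp: L_def)
  have ne: "V \<noteq> {}" using V by auto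
  \<comment> \<open>Balanced so that t^2 q^2 = L. With a = 2 L the bound of
    \<open>exp_dom_integral\<close> has exponent L + L / 2 - 2 L = - L / 2, so the number of points
    is outweighed.\<close>
  define t where "t = sqrt L / q"
  have t: "0 < t" "t\<^sup>2 * q\<^sup>2 = L" using L q by (auto simp: t_def power_divide)
  have ei: "integrable (std_gauss (dm A)) (exp_dom (dm A) V (2 * L) t)"
    by (rule exp_dom_integral(1)[OF t(1) q(1)])
  have "gauss_range A V \<le> (\<integral>z. 2 * (2 * L / t + exp_dom (dm A) V (2 * L) t z) \<partial>std_gauss (dm A))"
    unfolding gauss_range_eq[OF V(1) ne]
    by (intro integral_mono gauss_sup_integrable gauss_sup_le V ne t) (use ei in auto)
  also have "\<dots> = 2 * (2 * L / t + (\<integral>z. exp_dom (dm A) V (2 * L) t z \<partial>std_gauss (dm A)))"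
    using ei prob_space by simp
  also have "\<dots> \<le> 2 * (2 * L / t + 2 * ?n * exp (t\<^sup>2 * q\<^sup>2 / 2 - 2 * L) / t)"
    using exp_dom_integral(2)[OF t(1) q(1), of V "2 * L"] by simp
  also have "?n * exp (t\<^sup>2 * q\<^sup>2 / 2 - 2 * L) = exp (- L / 2)"
    unfolding t(2) L(2) by (simp add: exp_add[symmetric])
  then have "2 * ?n * exp (t\<^sup>2 * q\<^sup>2 / 2 - 2 * L) \<le> 2"
    using L by (simp add: mult.assoc)
  then have "2 * (2 * L / t + 2 * ?n * exp (t\<^sup>2 * q\<^sup>2 / 2 - 2 * L) / t) \<le> 2 * (2 * L / t + 2 / t)"
    using t by (intro mult_left_mono add_left_mono divide_right_mono) auto
  \<comment> \<open>Since L is at least 1 / 2, the term 4 / t is at most 8 L / t.\<close>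
  also have "\<dots> \<le> 12 * L / t" using t L by (simp add: field_simps)
  also have "\<dots> = 12 * (q * sqrt L)" using L q by (simp add: t_def field_simps)
  finally show ?thesis by (simp add: L_def)
qed

text \<open>The supremum is at least r s on the event of \<open>range_prob_ge\<close> and
  nonnegative elsewhere. The points need only contain r times the orthonormal family.\<close>

lemma gauss_range_ge:
  assumes V: "finite V" and I: "finite I" "I \<noteq> {}" and u: "orthonormal_fam (dm A) I u"
    and r: "0 < r" "\<And>i. i \<in> I \<Longrightarrow> vscale (dm A) r (u i) \<in> V" and s: "0 < s" "s\<^sup>2 / 2 \<le> T"
  shows "r * s * (1 - converse_err (card I) (s\<^sup>2) T) \<le> gauss_range A V"
proof -
  interpret prob_space "std_gauss (dm A)" by (rule prob_space_std_gauss)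
  have ne: "V \<noteq> {}" using I r by auto
  let ?E = "{z \<in> space (vspace (dm A)). \<exists>i\<in>I. \<exists>j\<in>I. s \<le> ip (dm A) z (u j) - ip (dm A) z (u i)}"
  have [measurable]: "?E \<in> sets (vspace (dm A))" using I by measurable
  have "r * s * (1 - converse_err (card I) (s\<^sup>2) T) \<le> r * s * measure (std_gauss (dm A)) ?E"
    using range_prob_ge[OF I u s] r s by simp
  also have "\<dots> = (\<integral>z. r * s * indicator ?E z \<partial>std_gauss (dm A))" by simp
  also have "\<dots> \<le> gauss_range A V"
    unfolding gauss_range_eq[OF V(1) ne]
  proof (rule integral_mono[OF _ gauss_sup_integrable[OF V ne]])
    fix z
    show "r * s * indicator ?E z \<le> (SUP (s, u)\<in>V \<times> V. ip (dm A) z s - ip (dm A) z u)"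
    proof (cases "z \<in> ?E")
      case True
      then obtain i j where ij: "i \<in> I" "j \<in> I" "s \<le> ip (dm A) z (u j) - ip (dm A) z (u i)" by auto
      have "r * s \<le> r * (ip (dm A) z (u j) - ip (dm A) z (u i))"
        using ij r by (intro mult_left_mono) auto
      also have "\<dots> = ip (dm A) z (vscale (dm A) r (u j)) - ip (dm A) z (vscale (dm A) r (u i))"
        by (simp add: algebra_simps)
      also have "\<dots> \<le> (SUP (s, u)\<in>V \<times> V. ip (dm A) z s - ip (dm A) z u)"
        using ij r V by (intro gauss_sup_ge) auto
      finally show ?thesis using True by simp
    qed (use gauss_sup_nonneg[OF V ne] in auto)
  qed (auto intro!: integrable_real_indicator simp: emeasure_eq_measure)
  finally show ?thesis .
qed

section \<open>The nearest-neighbor rule on a fixed atlas\<close>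

text \<open>Used for events defined by the rule itself: they agree with Borel events off a null set,
  which is all the completed law sees.\<close>

lemma completion_AE_sets:
  assumes E': "E' \<in> sets M" and E: "E \<subseteq> space M" and ae: "AE x in M. x \<in> E \<longleftrightarrow> x \<in> E'"
  shows "E \<in> sets (completion M)" and "measure (completion M) E = measure M E'"
proof -
  obtain Z where Z: "Z \<in> null_sets M" "{x \<in> space M. \<not> (x \<in> E \<longleftrightarrow> x \<in> E')} \<subseteq> Z"
    using ae by (auto simp: eventually_ae_filter)
  have "E = (E' - Z) \<union> (E \<inter> Z)" using Z E sets.sets_into_space[OF E'] by blast
  then show *: "E \<in> sets (completion M)"
    using Z E' by (intro sets_completionI[of E "E' - Z" "E \<inter> Z" Z M]) auto
  have "measure (completion M) E = measure (completion M) E'"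
    by (rule measure_eq_AE) (use AE_completion[OF ae] * E' in auto)
  then show "measure (completion M) E = measure M E'" using E' by simp
qed

lemma completion_AE_measurable:
  assumes g: "g \<in> M \<rightarrow>\<^sub>M N" and f: "f \<in> space M \<rightarrow> space N" and ae: "AE x in M. f x = g x"
  shows "f \<in> completion M \<rightarrow>\<^sub>M N"
proof (rule measurableI)
  fix X assume X: "X \<in> sets N"
  have "f -` X \<inter> space M \<in> sets (completion M)"
    by (rule completion_AE_sets(1)[of "g -` X \<inter> space M"]) (use g X ae in \<open>auto elim!: eventually_mono\<close>)
  then show "f -` X \<inter> space (completion M) \<in> sets (completion M)" by simp
qed (use f in auto)

lemma completion_AE_integral:
  fixes f g :: "'a \<Rightarrow> real"
  assumes g: "g \<in> borel_measurable M" and ae: "AE x in M. f x = g x"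
  shows "(\<integral>x. f x \<partial>completion M) = (\<integral>x. g x \<partial>M)"
proof -
  have "(\<integral>x. f x \<partial>completion M) = (\<integral>x. g x \<partial>completion M)"
    using completion_AE_measurable[OF g _ ae] measurable_completion[OF g] AE_completion[OF ae]
    by (intro integral_cong_AE) auto
  then show ?thesis using integral_completion[OF g] by simp
qed

section \<open>Geometry of one atlas and the Borel version of its rule\<close>

locale atlas_rule =
  fixes A :: atlas and h :: "real \<Rightarrow> vec \<Rightarrow> vec"
  assumes valid: "valid_atlas A" and rule: "rnn_rule A h"
begin

abbreviation "D \<equiv> dm A"
abbreviation "\<tau> \<equiv> tau A"
abbreviation "S \<equiv> S_rad A"
abbreviation "R \<equiv> rad A"
abbreviation "lM \<equiv> ln (real (nM A))"
abbreviation "lN \<equiv> ln (real (nN A))"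

lemma MN: "2 \<le> nM A" "2 \<le> nN A"
  using valid by (auto simp: valid_atlas_def)

lemma R_pos: "0 < R" 
  using valid by (auto simp: valid_atlas_def)

lemma lM_pos: "1 / 2 \<le> lM" and lN_pos: "1 / 2 \<le> lN"
  using MN half_le_ln by auto

lemma tau_pos: "0 < \<tau>"
  using R_pos lM_pos by (simp add: tau_def)

lemma S_pos: "0 < S"
  using tau_pos lN_pos by (simp add: S_rad_def)

lemma tau_sq: "\<tau>\<^sup>2 * lM = R\<^sup>2"
  using lM_pos by (simp add: tau_def power_divide)

lemma S_sq: "S\<^sup>2 = \<tau>\<^sup>2 * lN / 64"
  using lN_pos by (simp add: S_rad_def power_mult_distrib power_divide)

lemma orthonormal_evec: "orthonormal_fam D {0..nM A} (evec A)"
  and orthonormal_fvec: "orthonormal_fam D {1..nN A} (fvec A)"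
  using valid by (auto simp: valid_atlas_def orthonormal_fam_def)

lemma ip_hub_hub: "i \<le> nM A \<Longrightarrow> i' \<le> nM A \<Longrightarrow> ip D (hub A i) (hub A i') = (if i = i' then R\<^sup>2 else 0)"
  and ip_far_far: "j \<in> {1..nN A} \<Longrightarrow> j' \<in> {1..nN A} \<Longrightarrow> ip D (far A j) (far A j') = (if j = j' then S\<^sup>2 else 0)"
  and ip_hub_far: "i \<le> nM A \<Longrightarrow> j \<in> {1..nN A} \<Longrightarrow> ip D (hub A i) (far A j) = 0"
  using valid by (auto simp: valid_atlas_def hub_def far_def power2_eq_square)

lemma ip_far_hub: "i \<le> nM A \<Longrightarrow> j \<in> {1..nN A} \<Longrightarrow> ip D (far A j) (hub A i) = 0"
  using ip_hub_far by (simp add: ip_commute)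

lemma finite_sets: "finite (H_set A)" "finite (C_set A)" "finite (T_set A)"
  by (auto simp: H_set_def C_set_def T_set_def)

lemma hub_in: "i \<le> nM A \<Longrightarrow> hub A i \<in> H_set A" "i \<le> nM A \<Longrightarrow> hub A i \<in> T_set A"
  by (auto simp: H_set_def T_set_def)

lemma far_in: "j \<in> {1..nN A} \<Longrightarrow> far A j \<in> C_set A" "j \<in> {1..nN A} \<Longrightarrow> far A j \<in> T_set A"
  by (auto simp: C_set_def T_set_def)

lemma H_ne: "H_set A \<noteq> {}" 
  by (auto simp: H_set_def)

lemma T_space: "t \<in> T_set A \<Longrightarrow> t \<in> space (vspace D)"
  by (auto simp: T_set_def H_set_def C_set_def hub_def far_def)

lemma far_notin: "j \<in> {1..nN A} \<Longrightarrow> far A j \<notin> H_set A"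
  using far_notin_H[OF valid] by simp

lemma H_C_disjoint: "t \<in> H_set A \<Longrightarrow> t \<in> C_set A \<Longrightarrow> False"
  using far_notin by (auto simp: C_set_def)

lemma T_cases:
  assumes "t \<in> T_set A"
  obtains i where "i \<le> nM A" "t = hub A i" | j where "j \<in> {1..nN A}" "t = far A j"
  using assms by (auto simp: T_set_def H_set_def C_set_def)

lemma H_cases:
  assumes "t \<in> H_set A"
  obtains i where "i \<le> nM A" "t = hub A i"
  using assms by (auto simp: H_set_def)

text \<open>The squared distances are 2 R^2, 2 S^2 and R^2 + S^2. This one separation bound serves
  to show that ties are null, that small balls are singletons, and that every error of the rule is
  costly.\<close>

lemma T_dist:
  assumes "a \<in> T_set A" "b \<in> T_set A" "a \<noteq> b"
  shows "(min R S)\<^sup>2 * 2 \<le> ip D a a - 2 * ip D a b + ip D b b"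
proof -
  have m: "(min R S)\<^sup>2 \<le> R\<^sup>2" "(min R S)\<^sup>2 \<le> S\<^sup>2"
    using R_pos S_pos by (auto intro!: power_mono)
  show ?thesis
    using assms(1,2)
    by (elim T_cases) (use m assms(3) in \<open>auto simp: ip_hub_hub ip_far_far ip_hub_far ip_far_hub\<close>)
qed

text \<open>The part quadratic in y is common to all candidates, so comparing two of them is a
  linear inequality in y.\<close>

lemma rnn_obj_eq: "rnn_obj A l y a = ip D y y - 2 * ip D y a + (1 + l) * ip D a a"
  by (simp add: rnn_obj_def vdist_sq vnorm_sq algebra_simps)

lemma rnn_obj_measurable [measurable]:
  assumes [measurable]: "f \<in> N \<rightarrow>\<^sub>M vspace D"
  shows "(\<lambda>y. rnn_obj A l (f y) a) \<in> borel_measurable N"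
proof -
  have "(\<lambda>y. ip D (f y) (f y) - 2 * ip D (f y) a + (1 + l) * ip D a a) \<in> borel_measurable N"
    by (intro borel_measurable_add borel_measurable_diff borel_measurable_times borel_measurable_const
      ip_measurable ip_measurable2 assms)
  then show ?thesis by (simp add: rnn_obj_eq)
qed

definition tiefree :: "real \<Rightarrow> vec set" where
  "tiefree l = {y \<in> space (vspace D). \<forall>a\<in>T_set A. \<forall>b\<in>T_set A. a \<noteq> b \<longrightarrow> rnn_obj A l y a \<noteq> rnn_obj A l y b}"

lemma tiefree_sets [measurable]: "tiefree l \<in> sets (vspace D)"
proof -
  have m: "(\<lambda>y. rnn_obj A l y a) \<in> borel_measurable (vspace D)" for a
    by (rule rnn_obj_measurable) simp
  have "{y \<in> space (vspace D). rnn_obj A l y a \<noteq> rnn_obj A l y b} \<in> sets (vspace D)" for a b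
    by (rule borel_measurable_neq[OF m m])
  then show ?thesis
    unfolding tiefree_def by (intro sets.sets_Collect_finite_All sets.sets_Collect_imp finite_sets) auto
qed

text \<open>
  A Borel version of the rule: ties form a null set, and only there it differs from \<open>h\<close>.
\<close>

definition tie_default :: "real \<Rightarrow> vec \<Rightarrow> vec" where
  "tie_default l y = (if y \<in> tiefree l then h l y else hub A 0)"

lemma h_arg:
  assumes "0 \<le> l" "y \<in> space (vspace D)"
  shows "h l y \<in> T_set A" and "b \<in> T_set A \<Longrightarrow> rnn_obj A l y (h l y) \<le> rnn_obj A l y b"
proof -
  have "is_arg_min (rnn_obj A l y) (\<lambda>a. a \<in> T_set A) (h l y)"
    using rule assms unfolding rnn_rule_def by blast
  then show "h l y \<in> T_set A" "b \<in> T_set A \<Longrightarrow> rnn_obj A l y (h l y) \<le> rnn_obj A l y b"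
    unfolding is_arg_min_linorder by blast+
qed

lemma tie_default_T: "0 \<le> l \<Longrightarrow> tie_default l y \<in> T_set A"
  using h_arg hub_in by (auto simp: tie_default_def tiefree_def)

lemma tie_default_le: "0 \<le> l \<Longrightarrow> y \<in> tiefree l \<Longrightarrow> b \<in> T_set A \<Longrightarrow> rnn_obj A l y (tie_default l y) \<le> rnn_obj A l y b"
  using h_arg by (auto simp: tie_default_def tiefree_def)

text \<open>Off the ties the minimizer is unique, so taking the value t is the conjunction of
  finitely many measurable inequalities. The codomain is finite, so singletons suffice.\<close>

lemma tie_default_measurable:
  assumes l: "0 \<le> l"
  shows "tie_default l \<in> vspace D \<rightarrow>\<^sub>M count_space (T_set A)"
proof (subst measurable_count_space_eq2[OF finite_sets(3)], intro conjI ballI)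
  fix t assume t: "t \<in> T_set A"
  let ?m = "\<lambda>y. \<forall>b\<in>T_set A. rnn_obj A l y t \<le> rnn_obj A l y b"
  have *: "tie_default l y = t \<longleftrightarrow> ?m y" if y: "y \<in> tiefree l" for y
  proof
    assume "tie_default l y = t" then show "?m y" using tie_default_le[OF l y] by simp
  next
    assume m: "?m y"
    show "tie_default l y = t"
    proof (rule ccontr)
      assume "tie_default l y \<noteq> t"
      then have "rnn_obj A l y (tie_default l y) \<noteq> rnn_obj A l y t"
        using y tie_default_T[OF l, of y] t unfolding tiefree_def by blast
      moreover have "rnn_obj A l y (tie_default l y) \<le> rnn_obj A l y t" using tie_default_le[OF l y t] .
      moreover have "rnn_obj A l y t \<le> rnn_obj A l y (tie_default l y)" using m tie_default_T[OF l, of y] by blast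
      ultimately show False by simp
    qed
  qed
  \<comment> \<open>The default value collects the whole tie set in the preimage of
    \<open>hub A 0\<close>.\<close>
  have "tie_default l -` {t} \<inter> space (vspace D) = ({y \<in> space (vspace D). ?m y} \<inter> tiefree l)
     \<union> (if t = hub A 0 then space (vspace D) - tiefree l else {})" (is "?L = ?R")
  proof (rule set_eqI)
    fix y
    show "y \<in> ?L \<longleftrightarrow> y \<in> ?R"
    proof (cases "y \<in> tiefree l")
      case True
      moreover have "y \<in> space (vspace D)" using True by (simp add: tiefree_def)
      ultimately show ?thesis using *[OF True] by simp
    qed (auto simp: tie_default_def)
  qed
  moreover have "{y \<in> space (vspace D). ?m y} \<in> sets (vspace D)"
    by (intro sets.sets_Collect_finite_All finite_sets) measurable
  ultimately show "tie_default l -` {t} \<inter> space (vspace D) \<in> sets (vspace D)"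
    using tiefree_sets[of l] by auto
qed (use tie_default_T[OF l] in auto)

lemma tie_default_vspace [measurable]:
  assumes l: "0 \<le> l"
  shows "tie_default l \<in> vspace D \<rightarrow>\<^sub>M vspace D"
proof -
  have "(\<lambda>x. x) \<in> count_space (T_set A) \<rightarrow>\<^sub>M vspace D" by (auto intro: T_space)
  from measurable_compose[OF tie_default_measurable[OF l] this] show ?thesis by simp
qed

lemma tie_default_pred:
  assumes "0 \<le> l" and f: "f \<in> N \<rightarrow>\<^sub>M vspace D"
  shows "Measurable.pred N (\<lambda>z. P (tie_default l (f z)))"
  using measurable_compose[OF measurable_compose[OF f tie_default_measurable[OF assms(1)]], of P "count_space UNIV"]
  by simp

lemma obs_eq: "obs A \<theta> z = vadd D \<theta> (vscale D \<tau> z)"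
  by (simp add: obs_def)

lemma obs_space [simp]: "obs A \<theta> z \<in> space (vspace D)"
  by (simp add: obs_def)

lemma obs_measurable [measurable]: "obs A \<theta> \<in> vspace D \<rightarrow>\<^sub>M vspace D"
  unfolding obs_def by measurable

lemma ip_obs [simp]: "ip D (obs A \<theta> z) v = ip D \<theta> v + \<tau> * ip D z v"
  by (simp add: obs_def)

text \<open>A tie between a and b places the observation on a hyperplane with normal a - b, which is
  nonzero by \<open>T_dist\<close>; there are finitely many pairs.\<close>

lemma AE_tiefree: "AE z in std_gauss D. obs A \<theta> z \<in> tiefree l"
proof -
  have "AE z in std_gauss D. a \<noteq> b \<longrightarrow> rnn_obj A l (obs A \<theta> z) a \<noteq> rnn_obj A l (obs A \<theta> z) b"
    if ab: "a \<in> T_set A" "b \<in> T_set A" for a b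
  proof (cases "a = b")
    case False
    let ?v = "vadd D a (vscale D (-1) b)"
    \<comment> \<open>The level of that hyperplane in terms of z, after substituting y = \<theta> +
      \<tau> z.\<close>
    let ?c = "(((1 + l) * ip D a a - (1 + l) * ip D b b) / 2 - ip D \<theta> ?v) / \<tau>"
    have "0 < (min R S)\<^sup>2 * 2" using R_pos S_pos by simp
    also have "\<dots> \<le> ip D ?v ?v"
      using T_dist[OF ab False] ip_commute[of D a b] by (simp add: algebra_simps)
    finally have "AE z in std_gauss D. ip D z ?v \<noteq> ?c" by (rule gaussian_hyperplane_null)
    then show ?thesis
      by (rule AE_mp, intro AE_I2) (use tau_pos in \<open>auto simp: rnn_obj_eq field_simps\<close>)
  qed auto
  then have "AE z in std_gauss D. \<forall>a\<in>T_set A. \<forall>b\<in>T_set A. a \<noteq> b \<longrightarrow> rnn_obj A l (obs A \<theta> z) a \<noteq> rnn_obj A l (obs A \<theta> z) b"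
    using finite_sets by (simp add: AE_finite_all)
  then show ?thesis by (simp add: tiefree_def)
qed

lemma P_law_eq: "P_law A \<theta> = completion (distr (std_gauss D) (vspace D) (obs A \<theta>))"
  and Q_law_eq: "Q_law A = completion (distr (std_gauss D) (vspace D) (obs A (\<lambda>_. 0)))"
  by (simp_all add: P_law_def Q_law_def gaussian_def gaussian_borel_affine[OF tau_pos] obs_def cong: distr_cong)

lemma AE_tie_default: "AE y in distr (std_gauss D) (vspace D) (obs A \<theta>). h l y = tie_default l y"
proof -
  have "AE y in distr (std_gauss D) (vspace D) (obs A \<theta>). y \<in> tiefree l"
    by (subst AE_distr_iff) (use AE_tiefree in \<open>auto simp: tiefree_sets\<close>)
  then show ?thesis by eventually_elim (simp add: tie_default_def)
qed

lemma prob_completed: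
  assumes l: "0 \<le> l"
  shows "measure (completion (distr (std_gauss D) (vspace D) (obs A \<theta>)))
      {y \<in> space (completion (distr (std_gauss D) (vspace D) (obs A \<theta>))). h l y \<in> B}
    = measure (std_gauss D) {z \<in> space (vspace D). tie_default l (obs A \<theta> z) \<in> B}"
proof -
  let ?G = "distr (std_gauss D) (vspace D) (obs A \<theta>)"
  have m: "{y \<in> space (vspace D). tie_default l y \<in> B} \<in> sets (vspace D)"
    using tie_default_pred[OF l measurable_ident, of "\<lambda>x. x \<in> B"] by (simp add: pred_def)
  have "measure (completion ?G) {y \<in> space (vspace D). h l y \<in> B} = measure ?G {y \<in> space (vspace D). tie_default l y \<in> B}"
    by (rule completion_AE_sets(2)) (use m AE_tie_default[of l \<theta>] in \<open>auto elim!: eventually_mono\<close>)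
  also have "\<dots> = measure (std_gauss D) {z \<in> space (vspace D). tie_default l (obs A \<theta> z) \<in> B}"
    using m by (subst measure_distr) (auto intro!: arg_cong[where f="measure (std_gauss D)"])
  finally show ?thesis by simp
qed

lemma integral_completed:
  assumes l: "0 \<le> l"
  shows "(\<integral>y. (g (h l y) :: real) \<partial>completion (distr (std_gauss D) (vspace D) (obs A \<theta>)))
    = (\<integral>z. g (tie_default l (obs A \<theta> z)) \<partial>std_gauss D)"
proof -
  have [measurable]: "(\<lambda>y. g (tie_default l y)) \<in> borel_measurable (vspace D)"
    by (rule measurable_compose[OF tie_default_measurable[OF l]]) simp
  have "(\<integral>y. g (h l y) \<partial>completion (distr (std_gauss D) (vspace D) (obs A \<theta>)))
     = (\<integral>y. g (tie_default l y) \<partial>distr (std_gauss D) (vspace D) (obs A \<theta>))"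
    by (rule completion_AE_integral) (use AE_tie_default[of l \<theta>] in \<open>auto elim!: eventually_mono\<close>)
  also have "\<dots> = (\<integral>z. g (tie_default l (obs A \<theta> z)) \<partial>std_gauss D)"
    by (rule integral_distr) measurable
  finally show ?thesis .
qed

section \<open>Capture by the far points, errors on the hubs, and prior mass of small balls\<close>

lemma ip_hub: "ip D z (hub A i) = R * ip D z (evec A i)"
  and ip_far: "ip D z (far A j) = S * ip D z (fvec A j)"
  by (simp_all add: hub_def far_def)

lemma tie_default_event [measurable]:
  "0 \<le> l \<Longrightarrow> {z \<in> space (vspace D). tie_default l (obs A \<theta> z) \<in> B} \<in> sets (vspace D)"
  using tie_default_pred[OF _ obs_measurable, of l "\<lambda>x. x \<in> B" \<theta>] by (simp add: pred_def)

text \<open>A winning far point must in particular beat one fixed hub i, and this forces a Gaussian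
  variable of variance S^2 + R^2 above a fixed level; the union bound runs over the far points
  alone. The hypotheses on \<theta> cover both a hub as true mean, compared with itself, and the
  mean 0 of \<open>Q_law\<close>.\<close>

lemma C_prob_le:
  assumes l: "0 \<le> l" and RS: "R \<le> S" and i: "i \<le> nM A" "0 \<le> ip D \<theta> (hub A i)"
    and \<theta>: "\<And>j. j \<in> {1..nN A} \<Longrightarrow> ip D \<theta> (far A j) = 0"
  shows "measure (std_gauss D) {z \<in> space (vspace D). tie_default l (obs A \<theta> z) \<in> C_set A}
    \<le> real (nN A) * exp (- (((1 + l) * (S\<^sup>2 - R\<^sup>2) / (2 * \<tau>))\<^sup>2 / (2 * (S\<^sup>2 + R\<^sup>2))))"
proof -
  interpret prob_space "std_gauss D" by (rule prob_space_std_gauss)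
  define t where "t = (1 + l) * (S\<^sup>2 - R\<^sup>2) / (2 * \<tau>)"
  define v where "v j = vadd D (far A j) (vscale D (-1) (hub A i))" for j
  let ?E = "\<lambda>j. {z \<in> space (vspace D). t \<le> ip D z (v j)}"
  have RS2: "R\<^sup>2 \<le> S\<^sup>2" using RS R_pos by (intro power_mono) auto
  have t0: "0 \<le> t" using l RS2 tau_pos by (simp add: t_def)
  have vv: "ip D (v j) (v j) = S\<^sup>2 + R\<^sup>2" if "j \<in> {1..nN A}" for j
    using that i by (simp add: v_def ip_hub_hub ip_far_far ip_hub_far ip_far_hub)
  have sub: "{z \<in> space (vspace D). tie_default l (obs A \<theta> z) \<in> C_set A} \<subseteq> (\<Union>j\<in>{1..nN A}. ?E j)"
  proof safe
    fix z assume z: "z \<in> space (vspace D)" "tie_default l (obs A \<theta> z) \<in> C_set A"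
    then obtain j where j: "j \<in> {1..nN A}" "tie_default l (obs A \<theta> z) = far A j" by (auto simp: C_set_def)
    \<comment> \<open>The default at ties is a hub, so an output among the far points excludes
      ties.\<close>
    have tf: "obs A \<theta> z \<in> tiefree l"
    proof (rule ccontr)
      assume "obs A \<theta> z \<notin> tiefree l"
      then have "tie_default l (obs A \<theta> z) = hub A 0" by (simp add: tie_default_def)
      then show False using H_C_disjoint[of "hub A 0"] z(2) hub_in by auto
    qed
    have "rnn_obj A l (obs A \<theta> z) (far A j) \<le> rnn_obj A l (obs A \<theta> z) (hub A i)"
      using tie_default_le[OF l tf hub_in(2)[OF i(1)]] j by simp
    then have "(1 + l) * (S\<^sup>2 - R\<^sup>2) + 2 * ip D \<theta> (hub A i) \<le> 2 * \<tau> * ip D z (v j)"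
      using j i by (simp add: rnn_obj_eq \<theta> ip_hub_hub ip_far_far v_def algebra_simps)
    then have "t \<le> ip D z (v j)" using i tau_pos by (simp add: t_def field_simps)
    then show "z \<in> (\<Union>j\<in>{1..nN A}. ?E j)" using z j by auto
  qed
  have Em: "?E j \<in> sets (vspace D)" for j by measurable
  have "measure (std_gauss D) {z \<in> space (vspace D). tie_default l (obs A \<theta> z) \<in> C_set A}
      \<le> measure (std_gauss D) (\<Union>j\<in>{1..nN A}. ?E j)"
    using sub Em by (intro finite_measure_mono) auto
  also have "\<dots> \<le> (\<Sum>j\<in>{1..nN A}. measure (std_gauss D) (?E j))"
    using Em by (intro finite_measure_subadditive_finite) auto
  also have "\<dots> \<le> (\<Sum>j\<in>{1..nN A}. exp (- (t\<^sup>2 / (2 * (S\<^sup>2 + R\<^sup>2)))))"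
    using vv t0 R_pos S_pos by (intro sum_mono gaussian_tail) (auto simp: add_pos_pos)
  finally show ?thesis by (simp add: t_def)
qed

text \<open>If a hub wins, it beats every far point. \<open>cond\<close> makes this impossible when
  some far coordinate reaches x and all hub coordinates stay below K; 2 R^2 covers the most
  favourable hub, the true one. The subtracted term is the union bound over the M + 1 hubs.\<close>

lemma C_prob_ge:
  assumes l: "0 \<le> l" and i0: "i0 \<le> nM A" and K: "0 \<le> K"
    and cond: "2 * R\<^sup>2 + 2 * R * \<tau> * K - (1 + l) * R\<^sup>2 < 2 * S * \<tau> * x - (1 + l) * S\<^sup>2"
  shows "measure (std_gauss D) {z \<in> space (vspace D). \<exists>j\<in>{1..nN A}. x \<le> ip D z (fvec A j)}
      - (real (nM A) + 1) * exp (- (K\<^sup>2 / 2))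
    \<le> measure (std_gauss D) {z \<in> space (vspace D). tie_default l (obs A (hub A i0) z) \<in> C_set A}"
proof -
  interpret prob_space "std_gauss D" by (rule prob_space_std_gauss)
  let ?F = "{z \<in> space (vspace D). \<exists>j\<in>{1..nN A}. x \<le> ip D z (fvec A j)}"
  let ?C = "{z \<in> space (vspace D). tie_default l (obs A (hub A i0) z) \<in> C_set A}"
  let ?G = "\<lambda>i. {z \<in> space (vspace D). K \<le> ip D z (evec A i)}"
  have [measurable]: "?F \<in> sets (vspace D)" "?G i \<in> sets (vspace D)" for i by measurable
  have Cm: "?C \<in> sets (vspace D)" using l by (rule tie_default_event)
  have "measure (std_gauss D) ?F \<le> measure (std_gauss D) (?C \<union> (\<Union>i\<in>{0..nM A}. ?G i))"
  proof (rule finite_measure_mono_AE)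
    show "AE z in std_gauss D. z \<in> ?F \<longrightarrow> z \<in> ?C \<union> (\<Union>i\<in>{0..nM A}. ?G i)"
      using AE_tiefree[of "hub A i0" l]
    proof eventually_elim
      case (elim z)
      show ?case
      proof (rule impI, rule ccontr)
        assume z: "z \<in> ?F" and n: "z \<notin> ?C \<union> (\<Union>i\<in>{0..nM A}. ?G i)"
        then obtain j where j: "j \<in> {1..nN A}" "x \<le> ip D z (fvec A j)" by auto
        have "tie_default l (obs A (hub A i0) z) \<in> H_set A"
          using n z tie_default_T[OF l, of "obs A (hub A i0) z"] by (auto simp: T_set_def)
        then obtain i where i: "i \<le> nM A" "tie_default l (obs A (hub A i0) z) = hub A i" by (auto elim: H_cases)
        have zi: "ip D z (evec A i) < K" using n z i(1) by (auto simp: not_le)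
        have "rnn_obj A l (obs A (hub A i0) z) (hub A i) \<le> rnn_obj A l (obs A (hub A i0) z) (far A j)"
          using tie_default_le[OF l elim far_in(2)[OF j(1)]] i by simp
        then have "2 * S * \<tau> * ip D z (fvec A j) - (1 + l) * S\<^sup>2
           \<le> 2 * ip D (hub A i0) (hub A i) + 2 * R * \<tau> * ip D z (evec A i) - (1 + l) * R\<^sup>2"
          using j i i0 ip_hub_hub[OF i(1) i(1)] ip_hub_far[OF i0 j(1)]
          by (simp add: rnn_obj_eq ip_far_far ip_hub[of z] ip_far[of z] algebra_simps)
        moreover have "2 * S * \<tau> * x \<le> 2 * S * \<tau> * ip D z (fvec A j)"
          using j S_pos tau_pos by (intro mult_left_mono) auto
        moreover have "2 * R * \<tau> * ip D z (evec A i) \<le> 2 * R * \<tau> * K"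
          using zi R_pos tau_pos by (intro mult_left_mono) auto
        moreover have "ip D (hub A i0) (hub A i) \<le> R\<^sup>2" using i i0 by (simp add: ip_hub_hub)
        ultimately show False using cond by linarith
      qed
    qed
    show "?C \<union> (\<Union>i\<in>{0..nM A}. ?G i) \<in> events" using Cm by auto
  qed
  also have "\<dots> \<le> measure (std_gauss D) ?C + measure (std_gauss D) (\<Union>i\<in>{0..nM A}. ?G i)"
    using Cm by (intro measure_Un_le) auto
  also have "measure (std_gauss D) (\<Union>i\<in>{0..nM A}. ?G i) \<le> (\<Sum>i\<in>{0..nM A}. measure (std_gauss D) (?G i))"
    by (intro finite_measure_subadditive_finite) auto
  also have "\<dots> \<le> (\<Sum>i\<in>{0..nM A}. exp (- (K\<^sup>2 / (2 * 1))))"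
    using orthonormal_evec K by (intro sum_mono gaussian_tail) (auto simp: orthonormal_fam_def)
  finally show ?thesis by (simp add: algebra_simps)
qed

text \<open>The converse for the M hubs other than \<open>hub A 0\<close>, decoded by the rule.
  Their squared norm is ln M times \<tau>^2, so q / 2 is only half of ln M, and most of them must be
  missed on average. It holds for every penalty.\<close>

lemma hub_error_sum:
  assumes l: "0 \<le> l" and T: "lM / 2 \<le> T"
  shows "real (nM A) * (1 - converse_err (nM A) lM T)
    \<le> (\<Sum>i\<in>{1..nM A}. measure (std_gauss D) {z \<in> space (vspace D). tie_default l (obs A (hub A i) z) \<noteq> hub A i})"
proof -
  interpret prob_space "std_gauss D" by (rule prob_space_std_gauss)
  define B where "B i = {y \<in> space (vspace D). tie_default l y = hub A i}" for i
  have inj: "inj_on (hub A) {0..nM A}" by (rule hub_inj[OF valid])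
  have Bm: "B i \<in> sets (vspace D)" for i
    using tie_default_pred[OF l measurable_ident, of "\<lambda>x. x = hub A i"] by (simp add: pred_def B_def)
  have "(\<Sum>i\<in>{1..nM A}. measure (std_gauss D) {z \<in> space (vspace D). vadd D (hub A i) (vscale D \<tau> z) \<in> B i})
    \<le> exp T + real (card {1..nM A}) * exp (- ((T - lM / 2)\<^sup>2 / (2 * lM)))"
  proof (rule sum_success_le)
    show "disjoint_family_on B {1..nM A}"
      using inj by (auto simp: disjoint_family_on_def B_def inj_on_def)
    show "ip D (hub A i) (hub A i) = lM * \<tau>\<^sup>2" if "i \<in> {1..nM A}" for i
      using that tau_sq by (simp add: ip_hub_hub mult.commute)
  qed (use tau_pos lM_pos T Bm in auto)
  also have "\<dots> = real (nM A) * converse_err (nM A) lM T"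
    using MN by (simp add: converse_err_def algebra_simps)
  finally have le: "(\<Sum>i\<in>{1..nM A}. measure (std_gauss D) {z \<in> space (vspace D). tie_default l (obs A (hub A i) z) = hub A i})
     \<le> real (nM A) * converse_err (nM A) lM T"
    by (simp add: B_def obs_eq)
  have "measure (std_gauss D) {z \<in> space (vspace D). tie_default l (obs A (hub A i) z) \<noteq> hub A i}
     = 1 - measure (std_gauss D) {z \<in> space (vspace D). tie_default l (obs A (hub A i) z) = hub A i}" for i
    using prob_neg[of "\<lambda>z. tie_default l (obs A (hub A i) z) = hub A i"] tie_default_event[OF l, of "hub A i" "{hub A i}"] by simp
  then have "(\<Sum>i\<in>{1..nM A}. measure (std_gauss D) {z \<in> space (vspace D). tie_default l (obs A (hub A i) z) \<noteq> hub A i})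
     = real (nM A) - (\<Sum>i\<in>{1..nM A}. measure (std_gauss D) {z \<in> space (vspace D). tie_default l (obs A (hub A i) z) = hub A i})"
    by (simp only: sum_subtractf) simp
  with le show ?thesis by (simp add: algebra_simps)
qed

text \<open>Under mean 0 the hubs differ only by their noise coordinates, because their norms and
  penalties agree. So the output \<open>hub A 0\<close> forces its coordinate to be the largest of M
  + 1.\<close>

lemma hub_argmax_prob:
  assumes l: "0 \<le> l"
  shows "measure (std_gauss D) {z \<in> space (vspace D). tie_default l (obs A (\<lambda>_. 0) z) = hub A 0} \<le> 1 / (real (nM A) + 1)"
proof -
  interpret prob_space "std_gauss D" by (rule prob_space_std_gauss)
  let ?E = "{z \<in> space (vspace D). \<forall>i\<in>{0..nM A}. ip D z (evec A i) \<le> ip D z (evec A 0)}"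
  have "measure (std_gauss D) {z \<in> space (vspace D). tie_default l (obs A (\<lambda>_. 0) z) = hub A 0} \<le> measure (std_gauss D) ?E"
  proof (rule finite_measure_mono_AE)
    show "AE z in std_gauss D. z \<in> {z \<in> space (vspace D). tie_default l (obs A (\<lambda>_. 0) z) = hub A 0} \<longrightarrow> z \<in> ?E"
      using AE_tiefree[of "\<lambda>_. 0" l]
    proof eventually_elim
      case (elim z)
      show ?case
      proof safe
        fix i assume i: "i \<in> {0..nM A}" and eq: "tie_default l (obs A (\<lambda>_. 0) z) = hub A 0"
        have "rnn_obj A l (obs A (\<lambda>_. 0) z) (hub A 0) \<le> rnn_obj A l (obs A (\<lambda>_. 0) z) (hub A i)"
          using tie_default_le[OF l elim hub_in(2), of i] i eq by simp
        then have "\<tau> * (R * ip D z (evec A i)) \<le> \<tau> * (R * ip D z (evec A 0))"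
          using i by (simp add: rnn_obj_eq ip_hub_hub ip_hub[of z]) (simp add: ip_def)
        then show "ip D z (evec A i) \<le> ip D z (evec A 0)" using tau_pos R_pos by simp
      qed
    qed
    have "{z \<in> space (vspace D). ip D z (evec A i) \<le> ip D z (evec A 0)} \<in> sets (vspace D)" for i
      by (rule borel_measurable_le) simp_all
    then show "?E \<in> events" by (simp add: sets.sets_Collect_finite_All)
  qed
  also have "\<dots> \<le> 1 / real (card {0..nM A})"
    by (rule argmax_prob_le[OF _ orthonormal_evec]) auto
  finally show ?thesis by (simp add: add.commute)
qed

lemma T_ball_singleton:
  assumes RS: "R \<le> S" and t: "t \<in> T_set A"
  shows "T_ball A t (R / 3) = {t}"
proof -
  have "R / 3 < vdist D t b" if b: "b \<in> T_set A" "b \<noteq> t" for b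
  proof -
    have "(R / 3)\<^sup>2 < R\<^sup>2 * 2" using R_pos by (simp add: power_divide)
    also have "\<dots> \<le> (vdist D t b)\<^sup>2"
      using T_dist[of t b] t b RS by (simp add: vdist_sq)
    finally show ?thesis by (rule power_less_imp_less_base) simp
  qed
  moreover have "vdist D t t = 0" by (simp add: vdist_def vnorm_def L2_set_def)
  ultimately show ?thesis using t R_pos by (auto simp: T_ball_def not_le[symmetric])
qed

text \<open>The balls of radius R / 3 are singletons, and every point but \<open>hub A 0\<close> has
  prior mass at most 1 / (2 M). The heavy atom is output only with probability of order 1 / M, so it
  contributes on the same scale.\<close>

lemma rho_le:
  assumes l: "0 \<le> l" and RS: "R \<le> S"
  shows "rho A (R / 3) (Q_law A) (h l) \<le> 1 / real (nM A)"
proof -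
  interpret prob_space "std_gauss D" by (rule prob_space_std_gauss)
  let ?E = "{z \<in> space (vspace D). tie_default l (obs A (\<lambda>_. 0) z) = hub A 0}"
  have Em: "?E \<in> sets (vspace D)" using tie_default_event[OF l, of _ "{hub A 0}"] by simp
  have p: "measure_pmf.prob (prior A) (T_ball A t (R / 3)) \<le> 1 / (2 * real (nM A)) + 1 / 2 * (if t = hub A 0 then 1 else 0)"
    if "t \<in> T_set A" for t
    using that
  proof (cases rule: T_cases)
    case (1 i)
    show ?thesis
    proof (cases "i = 0")
      case True
      have "measure_pmf.prob (prior A) (T_ball A t (R / 3)) = 1 / 2"
        unfolding T_ball_singleton[OF RS that] measure_pmf_single using 1 True pmf_prior(1)[OF valid] by simp
      moreover have t: "t = hub A 0" using 1 True by simp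
      ultimately have "measure_pmf.prob (prior A) (T_ball A (hub A 0) (R / 3)) = 1 / 2" by (simp only:)
      then show ?thesis unfolding t if_P[OF refl] by (simp only:) simp
    next
      case False
      then have "pmf (prior A) (hub A i) = 1 / (2 * real (nM A))" using 1 by (intro pmf_prior(2)[OF valid]) auto
      then show ?thesis using 1 that by (simp add: T_ball_singleton[OF RS] measure_pmf_single)
    qed
  next
    case (2 j)
    then show ?thesis using that pmf_prior[OF valid] by (simp add: T_ball_singleton[OF RS] measure_pmf_single)
  qed
  have "rho A (R / 3) (Q_law A) (h l)
     = (\<integral>z. measure_pmf.prob (prior A) (T_ball A (tie_default l (obs A (\<lambda>_. 0) z)) (R / 3)) \<partial>std_gauss D)"
    unfolding rho_def Q_law_eq by (rule integral_completed[OF l])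
  also have "\<dots> \<le> (\<integral>z. 1 / (2 * real (nM A)) + 1 / 2 * indicator ?E z \<partial>std_gauss D)"
  proof (rule integral_mono)
    show "integrable (std_gauss D) (\<lambda>z. measure_pmf.prob (prior A) (T_ball A (tie_default l (obs A (\<lambda>_. 0) z)) (R / 3)))"
    proof (rule integrable_const_bound[where B = 1])
      show "(\<lambda>z. measure_pmf.prob (prior A) (T_ball A (tie_default l (obs A (\<lambda>_. 0) z)) (R / 3))) \<in> borel_measurable (std_gauss D)"
        by (rule measurable_compose[OF measurable_compose[OF _ tie_default_measurable[OF l]]]) auto
    qed auto
    show "integrable (std_gauss D) (\<lambda>z. 1 / (2 * real (nM A)) + 1 / 2 * indicator ?E z)"
      using Em by (auto intro!: integrable_real_indicator simp: emeasure_eq_measure)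
    show "measure_pmf.prob (prior A) (T_ball A (tie_default l (obs A (\<lambda>_. 0) z)) (R / 3)) \<le> 1 / (2 * real (nM A)) + 1 / 2 * indicator ?E z"
      if "z \<in> space (std_gauss D)" for z
      using p[OF tie_default_T[OF l, of "obs A (\<lambda>_. 0) z"]] that by (simp add: indicator_def split: if_splits)
  qed
  also have "\<dots> = 1 / (2 * real (nM A)) + 1 / 2 * measure (std_gauss D) ?E"
    using Em by (subst Bochner_Integration.integral_add)
      (auto intro!: integrable_real_indicator simp: emeasure_eq_measure prob_space)
  also have "\<dots> \<le> 1 / (2 * real (nM A)) + 1 / 2 * (1 / real (nM A))"
    using hub_argmax_prob[OF l] MN by (intro add_left_mono mult_left_mono) (auto elim!: order_trans intro!: divide_left_mono)
  also have "\<dots> = 1 / real (nM A)" by simp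
  finally show ?thesis .
qed

section \<open>The joint law of parameter and noise, and the algorithmic Gaussian range\<close>

lemma set_prior: "set_pmf (prior A) \<subseteq> H_set A"
  using MN by (auto simp: prior_def set_pmf_of_set H_set_def split: if_splits)

lemma prior_AE: "AE \<theta> in measure_pmf (prior A). \<theta> \<in> H_set A"
  using set_prior by (auto simp: AE_measure_pmf_iff)

lemma obs_pair_measurable [measurable]:
  "(\<lambda>x. obs A (fst x) (snd x)) \<in> measure_pmf (prior A) \<Otimes>\<^sub>M std_gauss D \<rightarrow>\<^sub>M vspace D"
proof -
  have "(\<lambda>x. fst x i) \<in> borel_measurable (measure_pmf (prior A) \<Otimes>\<^sub>M std_gauss D)" for i
    by (rule measurable_compose[OF measurable_fst]) simp
  moreover have "(\<lambda>x. snd x i) \<in> borel_measurable (measure_pmf (prior A) \<Otimes>\<^sub>M std_gauss D)" if "i < D" for i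
    by (rule measurable_compose[OF measurable_snd]) (use coord_measurable[OF that] in \<open>simp cong: measurable_cong_sets\<close>)
  ultimately show ?thesis
    unfolding obs_def vadd_def vscale_def by (subst vspace_def, intro measurable_restrict) auto
qed

text \<open>For each hub the ties form a null set in z, so by Fubini they are null for the pair.
  Almost sure claims about the rule thus become deterministic claims off the ties.\<close>

lemma joint_AE:
  assumes "\<And>\<theta> z. \<theta> \<in> H_set A \<Longrightarrow> z \<in> space (vspace D) \<Longrightarrow> obs A \<theta> z \<in> tiefree l \<Longrightarrow> P \<theta> z"
  shows "AE x in measure_pmf (prior A) \<Otimes>\<^sub>M std_gauss D. P (fst x) (snd x)"
proof -
  interpret Z: prob_space "std_gauss D" by (rule prob_space_std_gauss)
  interpret PP: pair_sigma_finite "measure_pmf (prior A)" "std_gauss D" ..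
  have "AE x in measure_pmf (prior A) \<Otimes>\<^sub>M std_gauss D. fst x \<in> H_set A \<and> obs A (fst x) (snd x) \<in> tiefree l"
  proof (rule PP.AE_pair_measure)
    show "{x \<in> space (measure_pmf (prior A) \<Otimes>\<^sub>M std_gauss D). fst x \<in> H_set A \<and> obs A (fst x) (snd x) \<in> tiefree l}
      \<in> sets (measure_pmf (prior A) \<Otimes>\<^sub>M std_gauss D)"
    proof -
      have "(\<lambda>x. fst x) -` H_set A \<inter> space (measure_pmf (prior A) \<Otimes>\<^sub>M std_gauss D) \<in> sets (measure_pmf (prior A) \<Otimes>\<^sub>M std_gauss D)"
        by (rule measurable_sets[OF measurable_fst]) simp
      from sets.Int[OF this measurable_sets[OF obs_pair_measurable tiefree_sets[of l]]]
      show ?thesis by (rule back_subst[where P = "\<lambda>E. E \<in> sets _"]) auto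
    qed
    show "AE x in measure_pmf (prior A). AE y in std_gauss D. fst (x, y) \<in> H_set A \<and> obs A (fst (x, y)) (snd (x, y)) \<in> tiefree l"
      using prior_AE by eventually_elim (use AE_tiefree in simp)
  qed
  then show ?thesis
    using AE_space by eventually_elim (use assms in \<open>auto simp: space_pair_measure\<close>)
qed

lemma joint_law_eq: "joint_law A = completion (measure_pmf (prior A) \<Otimes>\<^sub>M std_gauss D)"
  by (simp add: joint_law_def)

lemma H_T: "\<theta> \<in> H_set A \<Longrightarrow> \<theta> \<in> T_set A"
  by (simp add: T_set_def)

lemma obj_AE:
  assumes l: "0 \<le> l"
  shows "AE (\<theta>, z) in joint_law A. rnn_obj A l (obs A \<theta> z) (h l (obs A \<theta> z)) \<le> rnn_obj A l (obs A \<theta> z) \<theta>"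
  unfolding joint_law_eq split_beta'
  by (intro AE_completion joint_AE[of l]) (use h_arg[OF l] H_T in auto)

lemma T_norm_ge:
  assumes "R \<le> S" "t \<in> T_set A" "\<theta> \<in> H_set A"
  shows "ip D \<theta> \<theta> = R\<^sup>2" "R\<^sup>2 \<le> ip D t t" "ip D t t \<le> S\<^sup>2"
proof -
  have "R\<^sup>2 \<le> S\<^sup>2" using assms R_pos by (intro power_mono) auto
  then show "R\<^sup>2 \<le> ip D t t" "ip D t t \<le> S\<^sup>2"
    using assms(2) by (auto elim!: T_cases simp: ip_hub_hub ip_far_far)
  show "ip D \<theta> \<theta> = R\<^sup>2" using assms(3) by (auto elim!: H_cases simp: ip_hub_hub)
qed

lemma norm_AE:
  assumes l: "0 \<le> l" and RS: "R \<le> S"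
  shows "AE (\<theta>, z) in joint_law A. l * (vnorm D (h l (obs A \<theta> z)))\<^sup>2 \<ge> l * (vnorm D \<theta>)\<^sup>2"
  unfolding joint_law_eq split_beta'
proof (intro AE_completion joint_AE[of l])
  fix \<theta> z assume "\<theta> \<in> H_set A"
  then show "l * (vnorm D \<theta>)\<^sup>2 \<le> l * (vnorm D (h l (obs A \<theta> z)))\<^sup>2"
    using T_norm_ge[OF RS h_arg(1)[OF l obs_space]] l by (auto simp: vnorm_sq intro!: mult_left_mono)
qed

text \<open>The integrand of \<open>G_alg\<close>, with the Borel version in place of the
  rule.\<close>

definition gain :: "real \<Rightarrow> vec \<Rightarrow> vec \<Rightarrow> real" where
  "gain l \<theta> z = ip D z (tie_default l (obs A \<theta> z)) - ip D z \<theta>"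

lemma gain_measurable:
  assumes l [measurable]: "0 \<le> l"
  shows "gain l \<theta> \<in> borel_measurable (vspace D)"
    and "(\<lambda>x. gain l (fst x) (snd x)) \<in> borel_measurable (measure_pmf (prior A) \<Otimes>\<^sub>M std_gauss D)"
proof -
  have 1: "(\<lambda>z. tie_default l (obs A \<theta> z)) \<in> vspace D \<rightarrow>\<^sub>M vspace D"
    by (rule measurable_compose[OF obs_measurable tie_default_vspace[OF l]])
  show "gain l \<theta> \<in> borel_measurable (vspace D)"
    unfolding gain_def[abs_def] 
    by (intro borel_measurable_diff ip_measurable ip_measurable2 1) simp_all
  let ?J = "measure_pmf (prior A) \<Otimes>\<^sub>M std_gauss D"
  have 2: "(\<lambda>x. tie_default l (obs A (fst x) (snd x))) \<in> ?J \<rightarrow>\<^sub>M vspace D"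
    by (rule measurable_compose[OF obs_pair_measurable tie_default_vspace[OF l]])
  have 3: "snd \<in> ?J \<rightarrow>\<^sub>M vspace D"
    using measurable_snd[of "measure_pmf (prior A)" "std_gauss D"] by (simp cong: measurable_cong_sets)
  have 4: "(\<lambda>x. ip D (snd x) (fst x)) \<in> borel_measurable ?J"
    unfolding ip_def
    by (intro borel_measurable_sum borel_measurable_times measurable_compose[OF 3 coord_measurable]
        measurable_compose[OF measurable_fst]) auto
  show "(\<lambda>x. gain l (fst x) (snd x)) \<in> borel_measurable ?J"
    unfolding gain_def by (intro borel_measurable_diff ip_measurable2 2 3 4)
qed

text \<open>The large far level a2 / t2 is paid only on the capture event, so its expectation is
  damped by the capture probability. The exponential terms are nonnegative and can be kept
  always.\<close>

lemma gain_bound: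
  assumes l: "0 \<le> l" and \<theta>: "\<theta> \<in> H_set A" and t: "0 < t1" "0 < t2"
  shows "gain l \<theta> z \<le> 2 * (a1 / t1 + exp_dom D (H_set A) a1 t1 z)
     + (a2 / t2 * (if tie_default l (obs A \<theta> z) \<in> C_set A then 1 else 0) + exp_dom D (C_set A) a2 t2 z)"
proof -
  have H: "\<bar>ip D z v\<bar> \<le> a1 / t1 + exp_dom D (H_set A) a1 t1 z" if "v \<in> H_set A" for v
    using that t finite_sets by (intro abs_ip_le_exp_dom) auto
  have C: "\<bar>ip D z v\<bar> \<le> a2 / t2 + exp_dom D (C_set A) a2 t2 z" if "v \<in> C_set A" for v
    using that t finite_sets by (intro abs_ip_le_exp_dom) auto
  have "0 \<le> exp_dom D (H_set A) a1 t1 z" "0 \<le> exp_dom D (C_set A) a2 t2 z"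
    using t by (auto intro: exp_dom_nonneg)
  moreover have "tie_default l (obs A \<theta> z) \<in> H_set A \<or> tie_default l (obs A \<theta> z) \<in> C_set A"
    using tie_default_T[OF l] by (auto simp: T_set_def)
  moreover have "0 \<le> a1 / t1 + exp_dom D (H_set A) a1 t1 z" using H[OF \<theta>] by linarith
  ultimately show ?thesis
    unfolding gain_def using H[OF \<theta>] H[of "tie_default l (obs A \<theta> z)"] C[of "tie_default l (obs A \<theta> z)"] H_C_disjoint
    by (cases "tie_default l (obs A \<theta> z) \<in> C_set A") (auto simp: abs_le_iff)
qed

lemma gain_ge:
  assumes l: "0 \<le> l" and \<theta>: "\<theta> \<in> H_set A" and RS: "R \<le> S" and tf: "obs A \<theta> z \<in> tiefree l"
  shows "R\<^sup>2 / \<tau> * (if tie_default l (obs A \<theta> z) \<noteq> \<theta> then 1 else 0) \<le> gain l \<theta> z"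
proof -
  let ?a = "tie_default l (obs A \<theta> z)"
  note aT = tie_default_T[OF l, of "obs A \<theta> z"]
  have obj: "rnn_obj A l (obs A \<theta> z) ?a \<le> rnn_obj A l (obs A \<theta> z) \<theta>"
    by (rule tie_default_le[OF l tf H_T[OF \<theta>]])
  have nn: "0 \<le> l * (ip D ?a ?a - ip D \<theta> \<theta>)"
    using T_norm_ge[OF RS aT \<theta>] l by (intro mult_nonneg_nonneg) auto
  from obj have g: "ip D ?a ?a - 2 * ip D ?a \<theta> + ip D \<theta> \<theta> + l * (ip D ?a ?a - ip D \<theta> \<theta>) \<le> 2 * \<tau> * gain l \<theta> z"
    by (simp add: rnn_obj_eq gain_def algebra_simps ip_commute[of D \<theta> ?a])
  have "2 * R\<^sup>2 * (if ?a \<noteq> \<theta> then 1 else 0) \<le> ip D ?a ?a - 2 * ip D ?a \<theta> + ip D \<theta> \<theta>"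
    using T_dist[OF aT H_T[OF \<theta>]] RS by (auto simp: min_def)
  with g nn have "2 * R\<^sup>2 * (if ?a \<noteq> \<theta> then 1 else 0) \<le> 2 * \<tau> * gain l \<theta> z" by linarith
  then show ?thesis using tau_pos by (simp add: field_simps split: if_splits)
qed

lemma gain_integrable:
  assumes l: "0 \<le> l" and \<theta>: "\<theta> \<in> H_set A"
  shows "integrable (std_gauss D) (gain l \<theta>)"
proof (rule Bochner_Integration.integrable_bound)
  interpret prob_space "std_gauss D" by (rule prob_space_std_gauss)
  show "integrable (std_gauss D) (\<lambda>z. 2 * (1 / 1 + exp_dom D (T_set A) 1 1 z))"
    using exp_dom_integral(1)[of 1 "T_set A" D "Max ((\<lambda>v. ip D v v) ` T_set A)" 1] finite_sets by auto
  show "gain l \<theta> \<in> borel_measurable (std_gauss D)" using gain_measurable(1)[OF l] by (simp cong: measurable_cong_sets)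
  show "AE z in std_gauss D. norm (gain l \<theta> z) \<le> norm (2 * (1 / 1 + exp_dom D (T_set A) 1 1 z))"
  proof (rule AE_I2)
    fix z
    have "\<bar>ip D z v\<bar> \<le> 1 / 1 + exp_dom D (T_set A) 1 1 z" if "v \<in> T_set A" for v
      using that finite_sets by (intro abs_ip_le_exp_dom) auto
    from this[OF tie_default_T[OF l, of "obs A \<theta> z"]] this[OF H_T[OF \<theta>]]
    have "\<bar>gain l \<theta> z\<bar> \<le> 2 * (1 / 1 + exp_dom D (T_set A) 1 1 z)"
      using abs_triangle_ineq4[of "ip D z (tie_default l (obs A \<theta> z))" "ip D z \<theta>"] by (simp add: gain_def)
    then show "norm (gain l \<theta> z) \<le> norm (2 * (1 / 1 + exp_dom D (T_set A) 1 1 z))"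
      unfolding real_norm_def by (rule order_trans) (rule abs_ge_self)
  qed
qed

lemma G_alg_eq:
  assumes l: "0 \<le> l"
  shows "G_alg A h l = (\<Sum>\<theta>\<in>H_set A. (\<integral>z. gain l \<theta> z \<partial>std_gauss D) * pmf (prior A) \<theta>)"
proof -
  interpret Z: prob_space "std_gauss D" by (rule prob_space_std_gauss)
  interpret PP: pair_sigma_finite "measure_pmf (prior A)" "std_gauss D" ..
  let ?J = "measure_pmf (prior A) \<Otimes>\<^sub>M std_gauss D"
  have "G_alg A h l = (\<integral>x. gain l (fst x) (snd x) \<partial>?J)"
    unfolding G_alg_def joint_law_eq split_beta'
  proof (rule completion_AE_integral)
    show "AE x in ?J. ip D (snd x) (h l (obs A (fst x) (snd x))) - ip D (snd x) (fst x) = gain l (fst x) (snd x)"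
      by (rule joint_AE[of l]) (simp add: gain_def tie_default_def)
  qed (rule gain_measurable(2)[OF l])
  also have "\<dots> = (\<integral>\<theta>. \<integral>z. gain l \<theta> z \<partial>std_gauss D \<partial>measure_pmf (prior A))"
  proof (subst PP.integral_fst'[symmetric])
    have fin: "finite (set_pmf (prior A))" using set_prior finite_sets finite_subset by blast
    show "integrable ?J (\<lambda>x. gain l (fst x) (snd x))"
    proof (rule PP.Fubini_integrable)
      show "integrable (measure_pmf (prior A)) (\<lambda>x. \<integral>y. norm (gain l (fst (x, y)) (snd (x, y))) \<partial>std_gauss D)"
        by (rule integrable_measure_pmf_finite[OF fin])
      show "AE x in measure_pmf (prior A). integrable (std_gauss D) (\<lambda>y. gain l (fst (x, y)) (snd (x, y)))"
        using prior_AE by eventually_elim (use gain_integrable[OF l] in simp)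
    qed (rule gain_measurable(2)[OF l])
  qed simp
  also have "\<dots> = (\<Sum>\<theta>\<in>H_set A. (\<integral>z. gain l \<theta> z \<partial>std_gauss D) * pmf (prior A) \<theta>)"
    using finite_sets set_prior by (intro integral_measure_pmf_real) auto
  finally show ?thesis .
qed

lemma pmf_prior_sum: "(\<Sum>\<theta>\<in>H_set A. pmf (prior A) \<theta>) = 1"
  using sum_pmf_eq_1[OF finite_sets(1) set_prior] .

text \<open>The factor 1 / 2 is the prior mass of the M hubs to which \<open>hub_error_sum\<close>
  applies; the nonnegative contribution of \<open>hub A 0\<close> is dropped. The cost of an error
  is R^2 / \<tau> = R sqrt (ln M).\<close>

lemma G_alg_ge:
  assumes l: "0 \<le> l" and RS: "R \<le> S" and T: "lM / 2 \<le> T"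
  shows "R * sqrt lM / 2 * (1 - converse_err (nM A) lM T) \<le> G_alg A h l"
proof -
  interpret Z: prob_space "std_gauss D" by (rule prob_space_std_gauss)
  let ?p = "\<lambda>\<theta>. measure (std_gauss D) {z \<in> space (vspace D). tie_default l (obs A \<theta> z) \<noteq> \<theta>}"
  have wm: "{z \<in> space (vspace D). tie_default l (obs A \<theta> z) \<noteq> \<theta>} \<in> sets (vspace D)" for \<theta>
    using tie_default_event[OF l, of \<theta> "- {\<theta>}"] by simp
  have g: "R\<^sup>2 / \<tau> * ?p \<theta> \<le> (\<integral>z. gain l \<theta> z \<partial>std_gauss D)" if \<theta>: "\<theta> \<in> H_set A" for \<theta>
  proof -
    have "R\<^sup>2 / \<tau> * ?p \<theta> = (\<integral>z. R\<^sup>2 / \<tau> * indicator {z \<in> space (vspace D). tie_default l (obs A \<theta> z) \<noteq> \<theta>} z \<partial>std_gauss D)"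
      using wm[of \<theta>] by simp
    also have "\<dots> \<le> (\<integral>z. gain l \<theta> z \<partial>std_gauss D)"
    proof (rule integral_mono_AE[OF _ gain_integrable[OF l \<theta>]])
      show "AE z in std_gauss D. R\<^sup>2 / \<tau> * indicator {z \<in> space (vspace D). tie_default l (obs A \<theta> z) \<noteq> \<theta>} z \<le> gain l \<theta> z"
        using AE_tiefree[of \<theta> l] AE_space
      proof eventually_elim
        case (elim z)
        then show ?case using gain_ge[OF l \<theta> RS elim(1)] by (cases "tie_default l (obs A \<theta> z) = \<theta>") simp_all
      qed
    qed (use wm[of \<theta>] in \<open>auto intro!: integrable_real_indicator simp: Z.emeasure_eq_measure\<close>)
    finally show ?thesis .
  qed
  have inj: "inj_on (hub A) {1..nM A}" using hub_inj[OF valid] by (rule inj_on_subset) auto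
  have Rt: "R\<^sup>2 / \<tau> = R * sqrt lM" using R_pos lM_pos by (simp add: tau_def power2_eq_square)
  have "R * sqrt lM / 2 * (1 - converse_err (nM A) lM T)
     = R\<^sup>2 / \<tau> * (1 / (2 * real (nM A))) * (real (nM A) * (1 - converse_err (nM A) lM T))"
    unfolding Rt using MN by simp
  also have "\<dots> \<le> R\<^sup>2 / \<tau> * (1 / (2 * real (nM A))) * (\<Sum>i\<in>{1..nM A}. ?p (hub A i))"
    by (intro mult_left_mono hub_error_sum[OF l T]) (use tau_pos in auto)
  also have "\<dots> = (\<Sum>i\<in>{1..nM A}. R\<^sup>2 / \<tau> * ?p (hub A i) * pmf (prior A) (hub A i))"
    unfolding sum_distrib_left by (intro sum.cong) (simp_all add: pmf_prior(2)[OF valid])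
  also have "\<dots> = (\<Sum>\<theta>\<in>hub A ` {1..nM A}. R\<^sup>2 / \<tau> * ?p \<theta> * pmf (prior A) \<theta>)"
    by (subst sum.reindex[OF inj]) simp
  also have "\<dots> \<le> (\<Sum>\<theta>\<in>H_set A. R\<^sup>2 / \<tau> * ?p \<theta> * pmf (prior A) \<theta>)"
    using tau_pos finite_sets by (intro sum_mono2) (auto simp: H_set_def)
  also have "\<dots> \<le> G_alg A h l"
    unfolding G_alg_eq[OF l] by (intro sum_mono mult_right_mono g) auto
  finally show ?thesis .
qed

lemma card_H: "card (H_set A) = nM A + 1"
  unfolding H_set_def using card_image[OF hub_inj[OF valid]] by simp

lemma far_inj: "inj_on (far A) {1..nN A}"
proof (rule inj_onI)
  fix i j assume ij: "i \<in> {1..nN A}" "j \<in> {1..nN A}" "far A i = far A j"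
  then have "ip D (far A i) (far A j) = S\<^sup>2" by (simp add: ip_far_far)
  then show "i = j" using ip_far_far[OF ij(1,2)] S_pos by (auto split: if_splits)
qed

lemma card_C: "card (C_set A) = nN A"
  unfolding C_set_def using card_image[OF far_inj] by simp

text \<open>The full atlas has a much larger Gaussian range, of order S sqrt (ln N). It does not
  show up because far points are output so rarely that \<open>p1\<close> holds, which leaves a far
  contribution of order \<tau>.\<close>

lemma G_alg_le:
  assumes l: "0 \<le> l" and lM1: "1 \<le> lM"
    and p: "\<And>\<theta>. \<theta> \<in> H_set A \<Longrightarrow> measure (std_gauss D) {z \<in> space (vspace D). tie_default l (obs A \<theta> z) \<in> C_set A} \<le> p"
    and p1: "2 * lN * p \<le> 1"
  shows "G_alg A h l \<le> 13 * (R * sqrt lM)"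
proof -
  interpret Z: prob_space "std_gauss D" by (rule prob_space_std_gauss)
  \<comment> \<open>Both slopes are balanced as in \<open>gauss_range_le\<close>, one for each scale
    of the atlas.\<close>
  define t1 where "t1 = sqrt lM / R"
  define t2 where "t2 = sqrt lN / S"
  have t: "0 < t1" "0 < t2" "t1\<^sup>2 * R\<^sup>2 = lM" "t2\<^sup>2 * S\<^sup>2 = lN"
    using lM_pos lN_pos R_pos S_pos by (auto simp: t1_def t2_def power_divide)
  have nH: "ip D v v \<le> R\<^sup>2" if "v \<in> H_set A" for v
    using that by (auto elim!: H_cases simp: ip_hub_hub)
  have nC: "ip D v v \<le> S\<^sup>2" if "v \<in> C_set A" for v
    using that by (auto simp: C_set_def ip_far_far)
  note eH = exp_dom_integral[where V = "H_set A" and a = "2 * lM", OF t(1) nH, unfolded card_H]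
  note eC = exp_dom_integral[where V = "C_set A" and a = "2 * lN", OF t(2) nC, unfolded card_C]
  have hM: "2 * real (nM A + 1) * exp (t1\<^sup>2 * R\<^sup>2 / 2 - 2 * lM) \<le> 4"
  proof -
    have "real (nM A + 1) \<le> 2 * exp lM" using MN by simp
    then have "2 * real (nM A + 1) * exp (t1\<^sup>2 * R\<^sup>2 / 2 - 2 * lM) \<le> 4 * exp lM * exp (lM / 2 - 2 * lM)"
      unfolding t(3) by (intro mult_right_mono) auto
    also have "\<dots> = 4 * exp (- lM / 2)" by (simp add: exp_add[symmetric])
    also have "\<dots> \<le> 4" using lM1 by simp
    finally show ?thesis .
  qed
  have hN: "2 * real (nN A) * exp (t2\<^sup>2 * S\<^sup>2 / 2 - 2 * lN) \<le> 2"
  proof -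
    have "real (nN A) = exp lN" using MN by simp
    then have "2 * real (nN A) * exp (t2\<^sup>2 * S\<^sup>2 / 2 - 2 * lN) = 2 * (exp lN * exp (lN / 2 - 2 * lN))"
      unfolding t(4) by simp
    also have "\<dots> = 2 * exp (- lN / 2)" by (simp add: exp_add[symmetric])
    also have "\<dots> \<le> 2" using lN_pos by simp
    finally show ?thesis .
  qed
  have one: "(\<integral>z. gain l \<theta> z \<partial>std_gauss D) \<le> 13 * (R * sqrt lM)" if \<theta>: "\<theta> \<in> H_set A" for \<theta>
  proof -
    let ?C = "{z \<in> space (vspace D). tie_default l (obs A \<theta> z) \<in> C_set A}"
    have Cm: "?C \<in> sets (vspace D)" by (rule tie_default_event[OF l])
    have Ci: "integrable (std_gauss D) (indicator ?C :: vec \<Rightarrow> real)"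
      using Cm by (auto intro!: integrable_real_indicator simp: Z.emeasure_eq_measure)
    have "(\<integral>z. gain l \<theta> z \<partial>std_gauss D) \<le> (\<integral>z. 2 * (2 * lM / t1 + exp_dom D (H_set A) (2 * lM) t1 z)
       + (2 * lN / t2 * indicator ?C z + exp_dom D (C_set A) (2 * lN) t2 z) \<partial>std_gauss D)"
    proof (rule integral_mono[OF gain_integrable[OF l \<theta>]])
      fix z assume "z \<in> space (std_gauss D)"
      then show "gain l \<theta> z \<le> 2 * (2 * lM / t1 + exp_dom D (H_set A) (2 * lM) t1 z)
       + (2 * lN / t2 * indicator ?C z + exp_dom D (C_set A) (2 * lN) t2 z)"
        using gain_bound[OF l \<theta> t(1,2), of z "2 * lM" "2 * lN"] by (simp add: indicator_def split: if_splits)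
    qed (use eH(1) eC(1) Ci in auto)
    also have "\<dots> = 2 * (2 * lM / t1 + (\<integral>z. exp_dom D (H_set A) (2 * lM) t1 z \<partial>std_gauss D))
       + (2 * lN / t2 * measure (std_gauss D) ?C + (\<integral>z. exp_dom D (C_set A) (2 * lN) t2 z \<partial>std_gauss D))"
      using eH(1) eC(1) Ci Cm by (simp add: Z.prob_space)
    also have "\<dots> \<le> 2 * (2 * lM / t1 + 4 / t1) + (1 / t2 + 2 / t2)"
    proof (intro add_mono mult_left_mono order_refl)
      show "(\<integral>z. exp_dom D (H_set A) (2 * lM) t1 z \<partial>std_gauss D) \<le> 4 / t1"
        using eH(2) hM t by (meson divide_right_mono order_trans less_imp_le)
      show "(\<integral>z. exp_dom D (C_set A) (2 * lN) t2 z \<partial>std_gauss D) \<le> 2 / t2"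
        using eC(2) hN t by (meson divide_right_mono order_trans less_imp_le)
      have "2 * lN * measure (std_gauss D) ?C \<le> 2 * lN * p"
        using p[OF \<theta>] lN_pos by (intro mult_left_mono) auto
      then show "2 * lN / t2 * measure (std_gauss D) ?C \<le> 1 / t2"
        using p1 t by (simp add: field_simps)
    qed simp
    also have "\<dots> = (4 * lM + 8) / t1 + 3 / t2" by (simp add: add_divide_distrib)
    also have "\<dots> \<le> 12 * lM / t1 + 3 / t2"
      using lM1 t by (intro add_right_mono divide_right_mono) auto
    also have "lM / t1 = R * sqrt lM"
      using lM_pos R_pos by (simp add: t1_def field_simps)
    then have "12 * lM / t1 = 12 * (R * sqrt lM)" by simp
    \<comment> \<open>1 / t2 = S / sqrt (ln N) = \<tau> / 8: the far scale cancels and only the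
      noise level is left.\<close>
    also have "3 / t2 \<le> R * sqrt lM"
    proof -
      have "3 / t2 = 3 / 8 * (R / sqrt lM)" using lN_pos by (simp add: t2_def S_rad_def tau_def)
      also have "\<dots> \<le> R * sqrt lM"
      proof -
        have "1 \<le> sqrt lM" using lM1 by simp
        then have "R / sqrt lM \<le> R / 1" using R_pos by (intro divide_left_mono) auto
        then have "3 / 8 * (R / sqrt lM) \<le> R" using R_pos by linarith
        also have "R * 1 \<le> R * sqrt lM" using lM1 R_pos by (intro mult_left_mono) auto
        finally show ?thesis by simp
      qed
      finally show ?thesis .
    qed
    finally show ?thesis by simp
  qed
  have "G_alg A h l \<le> (\<Sum>\<theta>\<in>H_set A. 13 * (R * sqrt lM) * pmf (prior A) \<theta>)"
    unfolding G_alg_eq[OF l] by (intro sum_mono mult_right_mono one) auto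
  also have "\<dots> = 13 * (R * sqrt lM)" by (simp add: sum_distrib_left[symmetric] pmf_prior_sum)
  finally show ?thesis .
qed


section \<open>Risk of the rule and the full minimax value\<close>

lemma vdist_le_2S:
  assumes "R \<le> S" "a \<in> T_set A" "b \<in> T_set A"
  shows "vdist D a b \<le> 2 * S"
proof -
  have "R\<^sup>2 \<le> S\<^sup>2" using assms R_pos by (intro power_mono) auto
  then have RS2: "R\<^sup>2 \<le> S\<^sup>2" "R\<^sup>2 \<le> 2 * S\<^sup>2" "R\<^sup>2 \<le> 3 * S\<^sup>2" "0 \<le> S\<^sup>2" using zero_le_power2[of S] by linarith+
  have "(vdist D a b)\<^sup>2 \<le> (2 * S)\<^sup>2"
    using assms(2,3) unfolding vdist_sq
    by (elim T_cases) (auto simp: RS2 ip_hub_hub ip_far_far ip_hub_far ip_far_hub power_mult_distrib)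
  then show ?thesis by (rule power2_le_imp_le) (use S_pos in simp)
qed

lemma vdist_le_2R:
  assumes "a \<in> H_set A" "b \<in> H_set A"
  shows "vdist D a b \<le> 2 * R"
proof -
  have "(vdist D a b)\<^sup>2 \<le> (2 * R)\<^sup>2"
    using assms unfolding vdist_sq
    by (elim H_cases) (auto simp: ip_hub_hub power_mult_distrib)
  then show ?thesis by (rule power2_le_imp_le) (use R_pos in simp)
qed

lemma vdist_ge_R:
  assumes "R \<le> S" "a \<in> T_set A" "b \<in> T_set A" "a \<noteq> b"
  shows "R \<le> vdist D a b"
proof -
  have "R\<^sup>2 * 2 \<le> (vdist D a b)\<^sup>2"
    using T_dist[OF assms(2-4)] assms(1) by (simp add: vdist_sq)
  then have "R\<^sup>2 \<le> (vdist D a b)\<^sup>2" using zero_le_power2[of R] by linarith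
  then show ?thesis by (rule power2_le_imp_le) simp
qed

lemma vdist_ge_S:
  assumes "a \<in> H_set A" "b \<in> C_set A"
  shows "S \<le> vdist D a b"
proof -
  have "S\<^sup>2 \<le> (vdist D a b)\<^sup>2"
    using assms unfolding vdist_sq C_set_def
    by (elim H_cases) (auto simp: ip_hub_hub ip_far_far ip_hub_far)
  then show ?thesis by (rule power2_le_imp_le) simp
qed

definition risk :: "real \<Rightarrow> vec \<Rightarrow> real" where
  "risk l \<theta> = (\<integral>y. vdist D \<theta> (h l y) \<partial>P_law A \<theta>)"

lemma risk_eq: "0 \<le> l \<Longrightarrow> risk l \<theta> = (\<integral>z. vdist D \<theta> (tie_default l (obs A \<theta> z)) \<partial>std_gauss D)"
  unfolding risk_def P_law_eq by (rule integral_completed)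

lemma risk_nonneg: "0 \<le> risk l \<theta>"
  unfolding risk_def by (rule Bochner_Integration.integral_nonneg) simp

lemma risk_integrable:
  assumes l: "0 \<le> l"
  shows "integrable (std_gauss D) (\<lambda>z. vdist D \<theta> (tie_default l (obs A \<theta> z)))"
proof -
  interpret prob_space "std_gauss D" by (rule prob_space_std_gauss)
  show ?thesis
  proof (rule integrable_const_bound[where B = "Max (vdist D \<theta> ` T_set A)"])
    show "AE z in std_gauss D. norm (vdist D \<theta> (tie_default l (obs A \<theta> z))) \<le> Max (vdist D \<theta> ` T_set A)"
      using tie_default_T[OF l] finite_sets by (intro AE_I2) simp
    show "(\<lambda>z. vdist D \<theta> (tie_default l (obs A \<theta> z))) \<in> borel_measurable (std_gauss D)"
      by (rule measurable_compose[OF measurable_compose[OF _ tie_default_measurable[OF l]]]) auto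
  qed
qed

lemma risk_le:
  assumes l: "0 \<le> l" and RS: "R \<le> S" and \<theta>: "\<theta> \<in> H_set A"
  shows "risk l \<theta> \<le> 2 * R + 2 * S * measure (std_gauss D) {z \<in> space (vspace D). tie_default l (obs A \<theta> z) \<in> C_set A}"
    and "risk l \<theta> \<le> 2 * S"
proof -
  interpret prob_space "std_gauss D" by (rule prob_space_std_gauss)
  let ?C = "{z \<in> space (vspace D). tie_default l (obs A \<theta> z) \<in> C_set A}"
  have Cm: "?C \<in> sets (vspace D)" by (rule tie_default_event[OF l])
  have Ci: "integrable (std_gauss D) (indicator ?C :: vec \<Rightarrow> real)"
    using Cm by (auto intro!: integrable_real_indicator simp: emeasure_eq_measure)
  have "risk l \<theta> \<le> (\<integral>z. 2 * R + 2 * S * indicator ?C z \<partial>std_gauss D)"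
    unfolding risk_eq[OF l]
  proof (rule integral_mono[OF risk_integrable[OF l]])
    fix z assume z: "z \<in> space (std_gauss D)"
    show "vdist D \<theta> (tie_default l (obs A \<theta> z)) \<le> 2 * R + 2 * S * indicator ?C z"
    proof (cases "tie_default l (obs A \<theta> z) \<in> C_set A")
      case True
      then show ?thesis using vdist_le_2S[OF RS H_T[OF \<theta>] tie_default_T[OF l, of "obs A \<theta> z"]] z R_pos by simp
    next
      case False
      then have "tie_default l (obs A \<theta> z) \<in> H_set A" using tie_default_T[OF l, of "obs A \<theta> z"] by (auto simp: T_set_def)
      from vdist_le_2R[OF \<theta> this] show ?thesis using False by simp
    qed
  qed (use Ci in auto)
  also have "\<dots> = 2 * R + 2 * S * measure (std_gauss D) ?C"
    using Cm Ci by (simp add: prob_space)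
  finally show "risk l \<theta> \<le> 2 * R + 2 * S * measure (std_gauss D) ?C" .
  have "risk l \<theta> \<le> (\<integral>z. 2 * S \<partial>std_gauss D)"
    unfolding risk_eq[OF l]
    by (rule integral_mono[OF risk_integrable[OF l]]) (use vdist_le_2S[OF RS H_T[OF \<theta>] tie_default_T[OF l]] in auto)
  then show "risk l \<theta> \<le> 2 * S" by (simp add: prob_space)
qed

lemma risk_ge:
  assumes l: "0 \<le> l" and c: "0 \<le> c" "\<And>b. b \<in> T_set A \<Longrightarrow> b \<in> B \<Longrightarrow> c \<le> vdist D \<theta> b"
  shows "c * measure (std_gauss D) {z \<in> space (vspace D). tie_default l (obs A \<theta> z) \<in> B} \<le> risk l \<theta>"
proof -
  interpret prob_space "std_gauss D" by (rule prob_space_std_gauss)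
  let ?B = "{z \<in> space (vspace D). tie_default l (obs A \<theta> z) \<in> B}"
  have Bm: "?B \<in> sets (vspace D)" by (rule tie_default_event[OF l])
  have "c * measure (std_gauss D) ?B = (\<integral>z. c * indicator ?B z \<partial>std_gauss D)"
    using Bm by simp
  also have "\<dots> \<le> risk l \<theta>"
    unfolding risk_eq[OF l]
  proof (rule integral_mono[OF _ risk_integrable[OF l]])
    show "integrable (std_gauss D) (\<lambda>z. c * indicator ?B z)"
      using Bm by (auto intro!: integrable_real_indicator simp: emeasure_eq_measure)
  qed (use c tie_default_T[OF l] in \<open>auto simp: indicator_def\<close>)
  finally show ?thesis .
qed

lemma sup_risk_upper: "\<theta> \<in> H_set A \<Longrightarrow> risk l \<theta> \<le> (SUP \<theta>\<in>H_set A. risk l \<theta>)"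
  using finite_sets by (intro cSUP_upper bdd_above_finite) auto

lemma rnn_risk_eq: "rnn_risk A h \<Lambda> = (INF l\<in>\<Lambda>. SUP \<theta>\<in>H_set A. risk l \<theta>)"
  by (simp add: rnn_risk_def risk_def)

lemma rnn_risk_le:
  assumes l: "l \<in> \<Lambda>" and b: "\<And>\<theta>. \<theta> \<in> H_set A \<Longrightarrow> risk l \<theta> \<le> b"
  shows "rnn_risk A h \<Lambda> \<le> b"
  unfolding rnn_risk_eq
proof (rule cINF_lower2[OF _ l])
  show "(SUP \<theta>\<in>H_set A. risk l \<theta>) \<le> b" using H_ne b by (intro cSUP_least) auto
  \<comment> \<open>The real infimum obeys the expected inequality only for sets bounded below;
    nonnegativity of the risk provides this.\<close>
  show "bdd_below ((\<lambda>l. SUP \<theta>\<in>H_set A. risk l \<theta>) ` \<Lambda>)"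
  proof (rule bdd_belowI[of _ 0])
    fix x assume "x \<in> (\<lambda>l. SUP \<theta>\<in>H_set A. risk l \<theta>) ` \<Lambda>"
    then obtain l where "x = (SUP \<theta>\<in>H_set A. risk l \<theta>)" by auto
    moreover have "hub A 0 \<in> H_set A" by (rule hub_in) simp
    ultimately show "0 \<le> x" using sup_risk_upper[of "hub A 0" l] risk_nonneg[of l "hub A 0"] by simp
  qed
qed

text \<open>The worst risk dominates the average over the M hubs, and each error costs at least R.
  The bound is the same for every penalty.\<close>

lemma rnn_risk_ge_R:
  assumes \<Lambda>: "\<Lambda> \<noteq> {}" "\<And>l. l \<in> \<Lambda> \<Longrightarrow> 0 \<le> l" and RS: "R \<le> S" and T: "lM / 2 \<le> T"
  shows "R * (1 - converse_err (nM A) lM T) \<le> rnn_risk A h \<Lambda>"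
  unfolding rnn_risk_eq
proof (rule cINF_greatest[OF \<Lambda>(1)])
  fix l assume "l \<in> \<Lambda>"
  then have l: "0 \<le> l" by (rule \<Lambda>)
  let ?s = "SUP \<theta>\<in>H_set A. risk l \<theta>"
  have one: "R * measure (std_gauss D) {z \<in> space (vspace D). tie_default l (obs A (hub A i) z) \<noteq> hub A i} \<le> ?s"
    if "i \<in> {1..nM A}" for i
  proof -
    have "R * measure (std_gauss D) {z \<in> space (vspace D). tie_default l (obs A (hub A i) z) \<in> - {hub A i}} \<le> risk l (hub A i)"
      by (rule risk_ge[OF l]) (use R_pos that vdist_ge_R[OF RS hub_in(2)[of i]] in auto)
    also have "\<dots> \<le> ?s" using that by (intro sup_risk_upper hub_in) auto
    finally show ?thesis by simp
  qed
  have "real (nM A) * (R * (1 - converse_err (nM A) lM T)) = R * (real (nM A) * (1 - converse_err (nM A) lM T))"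
    by simp
  also have "\<dots> \<le> R * (\<Sum>i\<in>{1..nM A}. measure (std_gauss D) {z \<in> space (vspace D). tie_default l (obs A (hub A i) z) \<noteq> hub A i})"
    using R_pos by (intro mult_left_mono hub_error_sum[OF l T]) auto
  also have "\<dots> \<le> (\<Sum>i\<in>{1..nM A}. ?s)"
    unfolding sum_distrib_left by (intro sum_mono one)
  finally show "R * (1 - converse_err (nM A) lM T) \<le> ?s" using MN by simp
qed

lemma rnn_risk_ge_S:
  assumes \<Lambda>: "\<Lambda> \<noteq> {}" "\<And>l. l \<in> \<Lambda> \<Longrightarrow> 0 \<le> l"
    and p: "\<And>l. l \<in> \<Lambda> \<Longrightarrow> p \<le> measure (std_gauss D) {z \<in> space (vspace D). tie_default l (obs A (hub A 0) z) \<in> C_set A}"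
  shows "S * p \<le> rnn_risk A h \<Lambda>"
  unfolding rnn_risk_eq
proof (rule cINF_greatest[OF \<Lambda>(1)])
  fix l assume l: "l \<in> \<Lambda>"
  have "S * p \<le> S * measure (std_gauss D) {z \<in> space (vspace D). tie_default l (obs A (hub A 0) z) \<in> C_set A}"
    using p[OF l] S_pos by (intro mult_left_mono) auto
  also have "\<dots> \<le> risk l (hub A 0)"
    by (rule risk_ge[OF \<Lambda>(2)[OF l]]) (use S_pos vdist_ge_S[OF hub_in(1)[of 0]] in auto)
  also have "\<dots> \<le> (SUP \<theta>\<in>H_set A. risk l \<theta>)" by (intro sup_risk_upper hub_in) auto
  finally show "S * p \<le> (SUP \<theta>\<in>H_set A. risk l \<theta>)" .
qed

text \<open>An estimator is read as a decoder of the far points: the sets where it comes within S /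
  2 of a far point are disjoint, as far points are at least S apart. The converse applies with q =
  S^2 / \<tau>^2 = ln N / 64, well below 2 ln N.\<close>

lemma minimax_lower:
  assumes est [measurable]: "est \<in> vspace D \<rightarrow>\<^sub>M vspace D" and T: "lN / 128 \<le> T"
  shows "ennreal (S / 2 * (1 - converse_err (nN A) (lN / 64) T))
    \<le> (SUP \<theta>\<in>T_set A. \<integral>\<^sup>+y. ennreal (vdist D \<theta> (est y)) \<partial>P_law A \<theta>)"
proof -
  interpret prob_space "std_gauss D" by (rule prob_space_std_gauss)
  let ?e = "converse_err (nN A) (lN / 64) T"
  define B where "B j = {y \<in> space (vspace D). vdist D (far A j) (est y) < S / 2}" for j
  have vm: "(\<lambda>y. vdist D (far A j) (f y)) \<in> borel_measurable K" if "f \<in> K \<rightarrow>\<^sub>M vspace D" for j f K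
  proof -
    have "(\<lambda>y. ip D (far A j) (far A j) - 2 * ip D (far A j) (f y) + ip D (f y) (f y)) \<in> borel_measurable K"
      by (intro borel_measurable_add borel_measurable_diff borel_measurable_times
        ip_measurable ip_measurable2 that borel_measurable_const)
    from measurable_compose[OF this, of sqrt borel] show ?thesis by (simp add: vdist_eq)
  qed
  have Bm: "B j \<in> sets (vspace D)" for j
    unfolding B_def by (intro borel_measurable_less vm est) simp
  have disj: "disjoint_family_on B {1..nN A}"
  proof (unfold disjoint_family_on_def, intro ballI impI)
    fix j k assume jk: "j \<in> {1..nN A}" "k \<in> {1..nN A}" "j \<noteq> k"
    have "S\<^sup>2 \<le> (vdist D (far A j) (far A k))\<^sup>2"
      using jk by (simp add: vdist_sq ip_far_far)
    then have "S \<le> vdist D (far A j) (far A k)" by (rule power2_le_imp_le) simp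
    have "False" if y: "y \<in> B j" "y \<in> B k" for y
    proof -
      have "vdist D (far A j) (far A k) \<le> vdist D (far A j) (est y) + vdist D (far A k) (est y)"
        using vdist_triangle[of D "far A j" "far A k" "est y"] vdist_commute[of D "est y" "far A k"] by simp
      moreover have "vdist D (far A j) (est y) < S / 2" "vdist D (far A k) (est y) < S / 2"
        using y by (simp_all add: B_def)
      ultimately show False using \<open>S \<le> vdist D (far A j) (far A k)\<close> by linarith
    qed
    then show "B j \<inter> B k = {}" by blast
  qed
  have "(\<Sum>j\<in>{1..nN A}. measure (std_gauss D) {z \<in> space (vspace D). vadd D (far A j) (vscale D \<tau> z) \<in> B j})
    \<le> exp T + real (card {1..nN A}) * exp (- ((T - (lN / 64) / 2)\<^sup>2 / (2 * (lN / 64))))"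
  proof (rule sum_success_le)
    show "ip D (far A j) (far A j) = lN / 64 * \<tau>\<^sup>2" if "j \<in> {1..nN A}" for j
      using that by (simp add: ip_far_far S_sq)
  qed (use disj Bm tau_pos lN_pos T in auto)
  also have "\<dots> = real (nN A) * ?e"
    using MN by (simp add: converse_err_def algebra_simps)
  finally have sum: "(\<Sum>j\<in>{1..nN A}. measure (std_gauss D) {z \<in> space (vspace D). obs A (far A j) z \<in> B j}) \<le> real (nN A) * ?e"
    by (simp add: obs_eq)
  \<comment> \<open>Some far point has success probability no larger than the average.\<close>
  have "\<exists>j\<in>{1..nN A}. measure (std_gauss D) {z \<in> space (vspace D). obs A (far A j) z \<in> B j} \<le> ?e"
  proof (rule ccontr)
    assume "\<not> ?thesis"
    then have "(\<Sum>j\<in>{1..nN A}. ?e) < (\<Sum>j\<in>{1..nN A}. measure (std_gauss D) {z \<in> space (vspace D). obs A (far A j) z \<in> B j})"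
      using MN by (intro sum_strict_mono) (auto simp: not_le)
    then show False using sum by simp
  qed
  then obtain j where j: "j \<in> {1..nN A}"
    "measure (std_gauss D) {z \<in> space (vspace D). obs A (far A j) z \<in> B j} \<le> ?e" by blast
  let ?E = "{z \<in> space (vspace D). obs A (far A j) z \<in> B j}"
  have Em: "?E \<in> sets (vspace D)"
    using measurable_sets[OF obs_measurable Bm[of j], of "far A j"] by (simp add: vimage_def Int_def conj_commute)
  have "ennreal (S / 2 * (1 - ?e)) \<le> ennreal (S / 2 * measure (std_gauss D) (space (vspace D) - ?E))"
    using j(2) prob_compl[of ?E] Em S_pos by (intro ennreal_leI mult_left_mono) auto
  also have "\<dots> = (\<integral>\<^sup>+z. ennreal (S / 2) * indicator (space (vspace D) - ?E) z \<partial>std_gauss D)"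
    using Em S_pos by (subst nn_integral_cmult_indicator) (auto simp: emeasure_eq_measure ennreal_mult[symmetric])
  also have "\<dots> \<le> (\<integral>\<^sup>+z. ennreal (vdist D (far A j) (est (obs A (far A j) z))) \<partial>std_gauss D)"
    by (intro nn_integral_mono) (auto simp: indicator_def B_def not_less intro!: ennreal_leI)
  also have "\<dots> = (\<integral>\<^sup>+y. ennreal (vdist D (far A j) (est y)) \<partial>P_law A (far A j))"
    unfolding P_law_eq nn_integral_completion
    by (subst nn_integral_distr) (use vm[OF est] in auto)
  also have "\<dots> \<le> (SUP \<theta>\<in>T_set A. \<integral>\<^sup>+y. ennreal (vdist D \<theta> (est y)) \<partial>P_law A \<theta>)"
    by (rule SUP_upper[OF far_in(2)[OF j(1)]])
  finally show ?thesis .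
qed

lemma minimax_full_bounds:
  assumes RS: "R \<le> S" and T: "lN / 128 \<le> T" and e: "converse_err (nN A) (lN / 64) T \<le> 1"
  shows "S / 2 * (1 - converse_err (nN A) (lN / 64) T) \<le> minimax_full A" and "minimax_full A \<le> 2 * S"
proof -
  let ?m = "INF est \<in> vspace D \<rightarrow>\<^sub>M vspace D. SUP \<theta>\<in>T_set A. \<integral>\<^sup>+y. ennreal (vdist D \<theta> (est y)) \<partial>P_law A \<theta>"
  have lower: "ennreal (S / 2 * (1 - converse_err (nN A) (lN / 64) T)) \<le> ?m"
    by (rule INF_greatest) (rule minimax_lower[OF _ T])
  \<comment> \<open>The constant estimator gives the upper bound and, as important, the finiteness
    without which \<open>enn2real\<close> would not be monotone.\<close>
  have c: "(\<lambda>_. hub A 0) \<in> vspace D \<rightarrow>\<^sub>M vspace D" using T_space[OF hub_in(2)] by simp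
  have "?m \<le> (SUP \<theta>\<in>T_set A. \<integral>\<^sup>+y. ennreal (vdist D \<theta> (hub A 0)) \<partial>P_law A \<theta>)"
    by (rule INF_lower[OF c])
  also have "\<dots> \<le> ennreal (2 * S)"
  proof (rule SUP_least)
    fix \<theta> assume \<theta>: "\<theta> \<in> T_set A"
    have "emeasure (P_law A \<theta>) (space (P_law A \<theta>)) = 1"
      using prob_space.emeasure_space_1[OF prob_space_gaussian_borel[OF tau_pos, of D \<theta>]]
      by (simp add: P_law_def gaussian_def)
    then show "(\<integral>\<^sup>+y. ennreal (vdist D \<theta> (hub A 0)) \<partial>P_law A \<theta>) \<le> ennreal (2 * S)"
      using vdist_le_2S[OF RS \<theta> hub_in(2)] by (simp add: ennreal_leI)
  qed
  finally have upper: "?m \<le> ennreal (2 * S)" .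
  have m: "minimax_full A = enn2real ?m" by (simp add: minimax_full_def)
  show "minimax_full A \<le> 2 * S" unfolding m using enn2real_mono[OF upper] S_pos by simp
  have "?m < top" using upper by (rule le_less_trans) simp
  from enn2real_mono[OF lower this] show "S / 2 * (1 - converse_err (nN A) (lN / 64) T) \<le> minimax_full A"
    unfolding m using S_pos e by simp
qed

end

section \<open>Explicit rates\<close>

text \<open>For q and T proportional to ln n both error terms are negative powers of n as soon as s
  / 2 < k < 1.\<close>

lemma converse_err_scaled:
  assumes n: "0 < n" "L = ln n" and L: "0 < L" and s: "0 < s"
  shows "converse_err n (s * L) (k * L) = exp (- ((1 - k) * L)) + exp (- ((k - s / 2)\<^sup>2 / (2 * s) * L))"
proof -
  have "exp (k * L) / n = exp (- ((1 - k) * L))"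
    using n by (simp add: exp_diff left_diff_distrib)
  moreover have "(k * L - s * L / 2)\<^sup>2 / (2 * (s * L)) = (k - s / 2)\<^sup>2 / (2 * s) * L"
  proof -
    have "k * L - s * L / 2 = (k - s / 2) * L" by (simp add: algebra_simps)
    then show ?thesis using L s by (simp add: power_mult_distrib power2_eq_square)
  qed
  ultimately show ?thesis by (simp add: converse_err_def)
qed

lemma exp_neg_le:
  fixes x :: real
  assumes "2 \<le> x"
  shows "exp (- x) \<le> 1 / 4"
proof -
  have "1 + 1 \<le> exp (1::real)" by (rule exp_ge_add_one_self)
  then have "2 * 2 \<le> exp (1::real) * exp 1" by (intro mult_mono) auto
  also have "\<dots> = exp 2" by (simp add: exp_add[symmetric])
  also have "\<dots> \<le> exp x" using assms by simp
  finally show ?thesis by (simp add: exp_minus field_simps)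
qed

text \<open>The threshold 64 makes both exponents at least 2, as 64 / 32 = 2, and then each of the
  two terms is at most 1 / 4.\<close>

lemma converse_err_le_half:
  assumes n: "0 < n" "64 \<le> ln n" and s: "0 < s" "k \<le> 3 / 4" "1 / 32 \<le> (k - s / 2)\<^sup>2 / (2 * s)"
  shows "converse_err n (s * ln n) (k * ln n) \<le> 1 / 2"
proof -
  have "1 / 4 * 64 \<le> (1 - k) * ln n" using n s by (intro mult_mono) auto
  moreover have "1 / 32 * 64 \<le> (k - s / 2)\<^sup>2 / (2 * s) * ln n" using n s by (intro mult_mono) auto
  ultimately have "exp (- ((1 - k) * ln n)) \<le> 1 / 4" "exp (- ((k - s / 2)\<^sup>2 / (2 * s) * ln n)) \<le> 1 / 4"
    by (intro exp_neg_le; simp)+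
  moreover have "0 < ln n" using n by linarith
  ultimately show ?thesis unfolding converse_err_scaled[OF n(1) refl \<open>0 < ln n\<close> s(1)] by linarith
qed

context atlas_rule
begin

lemma R_le_S: 
  assumes "64 * lM \<le> lN" 
  shows "R \<le> S"
proof -
  have "R\<^sup>2 \<le> S\<^sup>2"
    unfolding S_sq tau_sq[symmetric] times_divide_eq_right[symmetric] using assms by (intro mult_left_mono) auto
  then show ?thesis by (rule power2_le_imp_le) (use S_pos in simp)
qed

text \<open>b is the margin by which (1 + l)^2 / 512 exceeds 1. The finite ratio \<delta> = R^2 /
  S^2 = 64 ln M / ln N costs a factor (1 - \<delta>)^2 / (1 + \<delta>), at least 1 - 3 \<delta>;
  since 384 = 6 * 64, the condition \<open>r\<close> says 6 (1 + b) \<delta> is at most b, so half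
  of the margin survives.\<close>

lemma opt_exponent:
  assumes b: "0 < b" "512 * (1 + b) \<le> (1 + l)\<^sup>2" and r: "384 * (1 + b) * lM \<le> b * lN"
  shows "(1 + b / 2) * lN \<le> ((1 + l) * (S\<^sup>2 - R\<^sup>2) / (2 * \<tau>))\<^sup>2 / (2 * (S\<^sup>2 + R\<^sup>2))"
proof -
  define \<delta> where "\<delta> = 64 * lM / lN"
  have \<delta>0: "0 < \<delta>" using lM_pos lN_pos by (simp add: \<delta>_def)
  have \<delta>1: "6 * (1 + b) * \<delta> \<le> b" using r lN_pos by (simp add: \<delta>_def field_simps)
  have RS: "R\<^sup>2 = \<delta> * S\<^sup>2" using lN_pos by (simp add: \<delta>_def S_sq tau_sq[symmetric])
  have eq: "((1 + l) * (S\<^sup>2 - R\<^sup>2) / (2 * \<tau>))\<^sup>2 / (2 * (S\<^sup>2 + R\<^sup>2))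
      = (1 + l)\<^sup>2 / 512 * (lN * ((1 - \<delta>)\<^sup>2 / (1 + \<delta>)))"
  proof -
    have "S\<^sup>2 - R\<^sup>2 = S\<^sup>2 * (1 - \<delta>)" "S\<^sup>2 + R\<^sup>2 = S\<^sup>2 * (1 + \<delta>)" by (simp_all add: RS algebra_simps)
    then have "((1 + l) * (S\<^sup>2 - R\<^sup>2) / (2 * \<tau>))\<^sup>2 / (2 * (S\<^sup>2 + R\<^sup>2))
      = (1 + l)\<^sup>2 * (S\<^sup>2)\<^sup>2 * (1 - \<delta>)\<^sup>2 / (4 * \<tau>\<^sup>2) / (2 * (S\<^sup>2 * (1 + \<delta>)))"
      by (simp add: power_mult_distrib power_divide)
    also have "\<dots> = (1 + l)\<^sup>2 * (S\<^sup>2 / (8 * \<tau>\<^sup>2)) * ((1 - \<delta>)\<^sup>2 / (1 + \<delta>))"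
    proof -
      have "P * X\<^sup>2 * Q / (4 * T) / (2 * (X * Z)) = P * (X / (8 * T)) * (Q / Z)" if "0 < X" for P X Q T Z :: real
        using that by (simp add: power2_eq_square)
      then show ?thesis using S_pos by (simp only: zero_less_power)
    qed
    also have "S\<^sup>2 / (8 * \<tau>\<^sup>2) = lN / 512" using tau_pos by (simp add: S_sq)
    finally show ?thesis by simp
  qed
  have 1: "1 - 3 * \<delta> \<le> (1 - \<delta>)\<^sup>2 / (1 + \<delta>)"
    using \<delta>0 by (simp add: pos_le_divide_eq) (simp add: power2_eq_square algebra_simps)
  have 2: "1 + b / 2 \<le> (1 + b) * (1 - 3 * \<delta>)" using \<delta>1 by (simp add: algebra_simps)
  have "0 < (1 + b) * (1 - 3 * \<delta>)" using 2 b by linarith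
  then have 3: "0 \<le> 1 - 3 * \<delta>" using b by (simp add: zero_less_mult_iff)
  have "1 + b / 2 \<le> (1 + l)\<^sup>2 / 512 * ((1 - \<delta>)\<^sup>2 / (1 + \<delta>))"
    using b by (intro order_trans[OF 2] mult_mono 1 3) auto
  then have "(1 + b / 2) * lN \<le> (1 + l)\<^sup>2 / 512 * ((1 - \<delta>)\<^sup>2 / (1 + \<delta>)) * lN"
    using lN_pos by (intro mult_right_mono) auto
  then show ?thesis unfolding eq by (simp only: mult_ac)
qed

text \<open>The union bound over N points consumes exp (ln N), that is the 1 in 1 + b / 2, and
  leaves b / 2.\<close>

lemma opt_C_prob:
  assumes b: "0 < b" "512 * (1 + b) \<le> (1 + l)\<^sup>2" and l: "0 \<le> l" and r: "384 * (1 + b) * lM \<le> b * lN"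
    and \<theta>: "\<theta> \<in> H_set A \<or> \<theta> = (\<lambda>_. 0)"
  shows "measure (std_gauss D) {z \<in> space (vspace D). tie_default l (obs A \<theta> z) \<in> C_set A} \<le> exp (- (b / 2 * lN))"
proof -
  have "b * (64 * lM) \<le> 384 * (1 + b) * lM" using b lM_pos by (simp add: algebra_simps)
  also note r
  finally have RS: "R \<le> S" using b by (intro R_le_S) simp
  obtain i where i: "i \<le> nM A" "0 \<le> ip D \<theta> (hub A i)"
  proof (cases "\<theta> \<in> H_set A")
    case True
    then obtain i where "i \<le> nM A" "\<theta> = hub A i" by (rule H_cases)
    then show ?thesis using that by (simp add: ip_hub_hub)
  next
    case False
    then show ?thesis using \<theta> that[of 0] by (simp add: ip_def)
  qed
  have z: "ip D \<theta> (far A j) = 0" if "j \<in> {1..nN A}" for j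
    using \<theta> that by (auto elim!: H_cases simp: ip_hub_far ip_def[of D "\<lambda>_. 0"])
  have "measure (std_gauss D) {z \<in> space (vspace D). tie_default l (obs A \<theta> z) \<in> C_set A}
     \<le> real (nN A) * exp (- (((1 + l) * (S\<^sup>2 - R\<^sup>2) / (2 * \<tau>))\<^sup>2 / (2 * (S\<^sup>2 + R\<^sup>2))))"
    by (rule C_prob_le[OF l RS i z])
  also have "\<dots> \<le> exp lN * exp (- ((1 + b / 2) * lN))"
    using opt_exponent[OF b r] MN by (intro mult_mono) auto
  also have "\<dots> = exp (- (b / 2 * lN))" by (simp add: exp_add[symmetric] algebra_simps)
  finally show ?thesis .
qed

text \<open>s is taken slightly below sqrt 2 and k is the further loss of
  \<open>max_prob_ge\<close>. The rate g is the least of three exponents, two from the converse and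
  one from the single tail, whence the factor 3.\<close>

lemma far_max_prob:
  assumes s: "0 < s" "s\<^sup>2 < 2" and k: "0 \<le> k"
  defines "g \<equiv> min ((1 - s\<^sup>2 / 2) / 2) (min (((1 - s\<^sup>2 / 2) / 2)\<^sup>2 / (2 * s\<^sup>2)) (k\<^sup>2 / 2))"
  shows "1 - 3 * exp (- (g * lN))
    \<le> measure (std_gauss D) {z \<in> space (vspace D). \<exists>j\<in>{1..nN A}. (s - k) * sqrt lN \<le> ip D z (fvec A j)}"
proof -
  \<comment> \<open>The midpoint between s^2 / 2 and 1, so that both gaps in
    \<open>converse_err_scaled\<close> are equal and positive.\<close>
  define \<kappa> where "\<kappa> = (1 + s\<^sup>2 / 2) / 2"
  have N0: "0 < real (nN A)" "0 < lN" using MN lN_pos by auto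
  have sq: "(s * sqrt lN)\<^sup>2 = s\<^sup>2 * lN" "(k * sqrt lN)\<^sup>2 = k\<^sup>2 * lN" using N0 by (simp_all add: power_mult_distrib)
  have T: "(s * sqrt lN)\<^sup>2 / 2 \<le> \<kappa> * lN"
    unfolding sq using s N0 by (simp add: \<kappa>_def)
  have k1: "1 - \<kappa> = (1 - s\<^sup>2 / 2) / 2" and k2: "\<kappa> - s\<^sup>2 / 2 = (1 - s\<^sup>2 / 2) / 2"
    by (simp_all add: \<kappa>_def field_simps)
  have E: "exp (- (g' * lN)) \<le> exp (- (g * lN))" if "g \<le> g'" for g'
    using that N0 by simp
  have g: "g \<le> (1 - s\<^sup>2 / 2) / 2" "g \<le> ((1 - s\<^sup>2 / 2) / 2)\<^sup>2 / (2 * s\<^sup>2)" "g \<le> k\<^sup>2 / 2"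
    unfolding g_def by (simp_all only: min.cobounded1 min.coboundedI2 min.cobounded2)
  have c: "converse_err (nN A) ((s * sqrt lN)\<^sup>2) (\<kappa> * lN) \<le> 2 * exp (- (g * lN))"
    unfolding sq converse_err_scaled[OF N0(1) refl N0(2) zero_less_power[OF s(1)]] k1 k2
    using E[OF g(1)] E[OF g(2)] by linarith
  have d: "exp (- ((k * sqrt lN)\<^sup>2 / 2)) \<le> exp (- (g * lN))"
    unfolding sq using E[OF g(3)] by simp
  have "1 - (converse_err (card {1..nN A}) ((s * sqrt lN)\<^sup>2) (\<kappa> * lN) + exp (- ((k * sqrt lN)\<^sup>2 / 2)))
    \<le> measure (std_gauss D) {z \<in> space (vspace D). \<exists>j\<in>{1..nN A}. s * sqrt lN - k * sqrt lN \<le> ip D z (fvec A j)}"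
    by (rule max_prob_ge[OF _ _ orthonormal_fvec _ T]) (use MN s N0 k in auto)
  then have "1 - (converse_err (nN A) ((s * sqrt lN)\<^sup>2) (\<kappa> * lN) + exp (- ((k * sqrt lN)\<^sup>2 / 2)))
    \<le> measure (std_gauss D) {z \<in> space (vspace D). \<exists>j\<in>{1..nN A}. (s - k) * sqrt lN \<le> ip D z (fvec A j)}"
    unfolding left_diff_distrib card_atLeastAtMost diff_Suc_1 by simp
  then show ?thesis using c d by linarith
qed

text \<open>Being \<eta> below the threshold gives the far side a surplus \<eta> \<tau>^2 ln N / 64;
  using sqrt 2 - \<eta> / 32 for the maximum spends half of it. The rest, \<eta> \<tau>^2 ln N /
  128, has to exceed the hub side, at most 5 R^2 = 640 \<tau>^2 ln M / 128.\<close>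

lemma under_C_prob:
  assumes \<eta>: "0 < \<eta>" "\<eta> < lambda_c" and l: "l \<in> Lambda_under \<eta>" and r: "640 * lM < \<eta> * lN"
    and \<theta>: "\<theta> \<in> H_set A"
    and p: "p \<le> measure (std_gauss D) {z \<in> space (vspace D). \<exists>j\<in>{1..nN A}. (sqrt 2 - \<eta> / 32) * sqrt lN \<le> ip D z (fvec A j)}"
  shows "p - 2 * exp (- lM) \<le> measure (std_gauss D) {z \<in> space (vspace D). tie_default l (obs A \<theta> z) \<in> C_set A}"
proof -
  have l0: "0 \<le> l" and l1: "1 + l \<le> 16 * sqrt 2 - \<eta>"
    using l by (auto simp: Lambda_under_def lambda_c_def)
  obtain i where i: "i \<le> nM A" "\<theta> = hub A i" using \<theta> by (rule H_cases)
  have Rt: "R * \<tau> * sqrt lM = R\<^sup>2" using lM_pos by (simp add: tau_def power2_eq_square)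
  have St: "S * \<tau> * sqrt lN = \<tau>\<^sup>2 * lN / 8" using lN_pos by (simp add: S_rad_def power2_eq_square)
  have cond: "2 * R\<^sup>2 + 2 * R * \<tau> * (2 * sqrt lM) - (1 + l) * R\<^sup>2
      < 2 * S * \<tau> * ((sqrt 2 - \<eta> / 32) * sqrt lN) - (1 + l) * S\<^sup>2"
  proof -
    have "2 * R\<^sup>2 + 2 * R * \<tau> * (2 * sqrt lM) - (1 + l) * R\<^sup>2 = 6 * R\<^sup>2 - (1 + l) * R\<^sup>2"
      using Rt by simp
    also have "\<dots> \<le> 5 * R\<^sup>2" using mult_nonneg_nonneg[OF l0, of "R\<^sup>2"] by (simp add: algebra_simps)
    also have "\<dots> = \<tau>\<^sup>2 * (640 * lM) / 128" by (simp add: tau_sq[symmetric])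
    also have "\<dots> < \<tau>\<^sup>2 * (\<eta> * lN) / 128"
      using r tau_pos by (intro divide_strict_right_mono mult_strict_left_mono) auto
    also have "\<dots> = \<tau>\<^sup>2 * lN / 4 * (sqrt 2 - \<eta> / 32) - (16 * sqrt 2 - \<eta>) * (\<tau>\<^sup>2 * lN / 64)"
      by (simp add: field_simps)
    also have "\<dots> \<le> \<tau>\<^sup>2 * lN / 4 * (sqrt 2 - \<eta> / 32) - (1 + l) * (\<tau>\<^sup>2 * lN / 64)"
      using l1 lN_pos by (intro diff_left_mono mult_right_mono) auto
    also have "\<dots> = 2 * (S * \<tau> * sqrt lN) * (sqrt 2 - \<eta> / 32) - (1 + l) * S\<^sup>2"
      unfolding St S_sq by simp
    also have "2 * (S * \<tau> * sqrt lN) * (sqrt 2 - \<eta> / 32) = 2 * S * \<tau> * ((sqrt 2 - \<eta> / 32) * sqrt lN)"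
      by (simp only: mult_ac)
    finally show ?thesis .
  qed
  \<comment> \<open>K = 2 sqrt (ln M) makes each hub tail M^(-2), which survives the sum over M + 1
    hubs.\<close>
  have "(real (nM A) + 1) * exp (- ((2 * sqrt lM)\<^sup>2 / 2)) \<le> (2 * exp lM) * exp (- (2 * lM))"
    using MN lM_pos by (intro mult_mono) (auto simp: power_mult_distrib)
  also have "\<dots> = 2 * exp (- lM)" by (simp add: exp_add[symmetric])
  finally show ?thesis
    using C_prob_ge[OF l0 i(1) _ cond] p lM_pos unfolding i(2) by simp
qed

section \<open>Gaussian ranges of the hubs and of the full atlas\<close>

lemma gauss_range_H:
  assumes "64 \<le> lM"
  shows "R * sqrt lM / 4 \<le> gauss_range A (H_set A)" and "gauss_range A (H_set A) \<le> 24 * (R * sqrt lM)"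
proof -
  \<comment> \<open>s^2 is an eighth of the critical value 2 ln M, far enough for the crude bound
    \<open>converse_err_le_half\<close>.\<close>
  let ?s = "sqrt lM / 2"
  have s2: "?s\<^sup>2 = 1 / 4 * lM" using assms by (simp add: power_divide)
  have e: "converse_err (nM A) (?s\<^sup>2) (1 / 2 * lM) \<le> 1 / 2"
    unfolding s2 by (rule converse_err_le_half) (use MN assms in \<open>auto simp: power2_eq_square\<close>)
  have "R * ?s * (1 - converse_err (card {1..nM A}) (?s\<^sup>2) (1 / 2 * lM)) \<le> gauss_range A (H_set A)"
  proof (rule gauss_range_ge)
    show "orthonormal_fam D {1..nM A} (evec A)"
      using orthonormal_evec by (auto simp: orthonormal_fam_def)
    show "vscale D R (evec A i) \<in> H_set A" if "i \<in> {1..nM A}" for i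
      using that hub_in(1)[of i] by (simp add: hub_def)
    show "?s\<^sup>2 / 2 \<le> 1 / 2 * lM" unfolding s2 using assms by simp
  qed (use finite_sets MN R_pos assms in auto)
  moreover have "R * ?s * (1 / 2) \<le> R * ?s * (1 - converse_err (card {1..nM A}) (?s\<^sup>2) (1 / 2 * lM))"
    using e R_pos assms by (intro mult_left_mono) auto
  ultimately show "R * sqrt lM / 4 \<le> gauss_range A (H_set A)" by simp
  have "gauss_range A (H_set A) \<le> 12 * (R * sqrt (ln (real (card (H_set A)))))"
    by (rule gauss_range_le) (use finite_sets MN R_pos in \<open>auto simp: card_H elim!: H_cases simp: ip_hub_hub\<close>)
  also have "\<dots> \<le> 12 * (R * sqrt (4 * lM))"
  proof (intro mult_left_mono real_sqrt_le_mono)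
    \<comment> \<open>A crude fourth power: the logarithm grows by a factor 4, the bound by its
      square root.\<close>
    have "real (card (H_set A)) \<le> real (nM A) ^ 4"
    proof -
      have "nM A + 1 \<le> nM A * 2" "nM A * 2 \<le> nM A * nM A ^ 3"
        using MN power_increasing[of 1 3 "nM A"] by (auto intro!: mult_left_mono)
      then have "nM A + 1 \<le> nM A ^ 4" by (simp add: numeral_eq_Suc)
      then show ?thesis unfolding card_H of_nat_power[symmetric] of_nat_le_iff .
    qed
    then have "ln (real (card (H_set A))) \<le> ln (real (nM A) ^ 4)"
      using MN by (subst ln_le_cancel_iff) (auto simp: card_H)
    then show "ln (real (card (H_set A))) \<le> 4 * lM" using MN by (simp add: ln_realpow)
  qed (use R_pos in auto)
  finally show "gauss_range A (H_set A) \<le> 24 * (R * sqrt lM)" by (simp add: real_sqrt_mult)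
qed

lemma gauss_range_T:
  assumes "64 \<le> lM" "64 * lM \<le> lN"
  shows "S * sqrt lN / 4 \<le> gauss_range A (T_set A)" and "gauss_range A (T_set A) \<le> 24 * (S * sqrt lN)"
proof -
  have RS: "R \<le> S" by (rule R_le_S) fact
  have lN: "64 \<le> lN" using assms by linarith
  let ?s = "sqrt lN / 2"
  have s2: "?s\<^sup>2 = 1 / 4 * lN" using lN by (simp add: power_divide)
  have e: "converse_err (nN A) (?s\<^sup>2) (1 / 2 * lN) \<le> 1 / 2"
    unfolding s2 by (rule converse_err_le_half) (use MN lN in \<open>auto simp: power2_eq_square\<close>)
  have "S * ?s * (1 - converse_err (card {1..nN A}) (?s\<^sup>2) (1 / 2 * lN)) \<le> gauss_range A (T_set A)"
  proof (rule gauss_range_ge[OF _ _ _ orthonormal_fvec])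
    show "vscale D S (fvec A i) \<in> T_set A" if "i \<in> {1..nN A}" for i
      using far_in(2)[OF that] by (simp add: far_def)
    show "?s\<^sup>2 / 2 \<le> 1 / 2 * lN" unfolding s2 using lN by simp
  qed (use finite_sets MN S_pos lN in auto)
  moreover have "S * ?s * (1 / 2) \<le> S * ?s * (1 - converse_err (card {1..nN A}) (?s\<^sup>2) (1 / 2 * lN))"
    using e S_pos lN by (intro mult_left_mono) auto
  ultimately show "S * sqrt lN / 4 \<le> gauss_range A (T_set A)" by simp
  have cT: "card (T_set A) = nM A + 1 + nN A"
    unfolding T_set_def using finite_sets H_C_disjoint by (subst card_Un_disjoint) (auto simp: card_H card_C)
  have "gauss_range A (T_set A) \<le> 12 * (S * sqrt (ln (real (card (T_set A)))))"
    by (rule gauss_range_le) (use finite_sets MN S_pos T_norm_ge(3)[OF RS _ hub_in(1)[of 0]] cT in auto)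
  also have "\<dots> \<le> 12 * (S * sqrt (4 * lN))"
  proof (intro mult_left_mono real_sqrt_le_mono)
    have "lM \<le> lN" using assms by linarith
    then have "nM A \<le> nN A" using MN by simp
    have "real (card (T_set A)) \<le> real (nN A) ^ 4"
    proof -
      have "2 ^ 3 \<le> nN A ^ 3" using MN by (intro power_mono) auto
      then have "nN A * 8 \<le> nN A * nN A ^ 3" by (intro mult_left_mono) auto
      moreover have "nM A + 1 + nN A \<le> nN A * 8" using MN \<open>nM A \<le> nN A\<close> by simp
      ultimately have "nM A + 1 + nN A \<le> nN A ^ 4" by (simp add: numeral_eq_Suc)
      then show ?thesis unfolding cT of_nat_power[symmetric] of_nat_le_iff .
    qed
    then have "ln (real (card (T_set A))) \<le> ln (real (nN A) ^ 4)"
      using MN by (subst ln_le_cancel_iff) (auto simp: cT)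
    then show "ln (real (card (T_set A))) \<le> 4 * lN" using MN by (simp add: ln_realpow)
  qed (use S_pos in auto)
  finally show "gauss_range A (T_set A) \<le> 24 * (S * sqrt lN)" by (simp add: real_sqrt_mult)
qed

end

text \<open>The margin b of \<open>opt_C_prob\<close> at the smallest penalty of
  \<open>Lambda_opt\<close>.\<close>

definition opt_rate :: "real \<Rightarrow> real" where
  "opt_rate \<eta> = (lambda_c + 1 + \<eta>)\<^sup>2 / 512 - 1"

text \<open>The rate of \<open>far_max_prob\<close> for s = sqrt 2 - \<eta> / 64 and k = \<eta> /
  64, so that s - k is the level used in \<open>under_C_prob\<close>.\<close>

definition under_rate :: "real \<Rightarrow> real" where
  "under_rate \<eta> = (let s = sqrt 2 - \<eta> / 64 in
     min ((1 - s\<^sup>2 / 2) / 2) (min (((1 - s\<^sup>2 / 2) / 2)\<^sup>2 / (2 * s\<^sup>2)) ((\<eta> / 64)\<^sup>2 / 2)))"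

text \<open>The sum of all lower bounds needed for ln N / ln M, hence above each of them. As ln M is
  at least 1, it also enforces the absolute bounds on ln N. The 641, instead of 640, yields a strict
  inequality.\<close>

definition large_ratio :: "real \<Rightarrow> real" where
  "large_ratio \<eta> = 64 + 384 * (1 + opt_rate \<eta>) / opt_rate \<eta> + 641 / \<eta> + 16 / (opt_rate \<eta>)\<^sup>2
     + 4 / opt_rate \<eta> + 4 / under_rate \<eta>"

lemma half_le_complement:
  fixes x e :: real
  assumes "0 \<le> x" "e \<le> 1 / 2"
  shows "x / 2 \<le> x * (1 - e)"
  using mult_left_mono[of "1 / 2" "1 - e" x] assms by simp

lemma opt_rate_pos:
  assumes "0 < \<eta>"
  shows "0 < opt_rate \<eta>"
proof -
  have "(16 * sqrt 2)\<^sup>2 < (16 * sqrt 2 + \<eta>)\<^sup>2" using assms by (intro power_strict_mono) auto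
  then show ?thesis by (simp add: opt_rate_def lambda_c_def power_mult_distrib)
qed

lemma under_param:
  assumes "0 < \<eta>" "\<eta> < lambda_c"
  shows "0 < sqrt 2 - \<eta> / 64" "(sqrt 2 - \<eta> / 64)\<^sup>2 < 2"
proof -
  show 0: "0 < sqrt 2 - \<eta> / 64" using assms real_sqrt_gt_0_iff[of 2] unfolding lambda_c_def by linarith
  have "(sqrt 2 - \<eta> / 64)\<^sup>2 < (sqrt 2)\<^sup>2" using assms 0 by (intro power_strict_mono) auto
  then show "(sqrt 2 - \<eta> / 64)\<^sup>2 < 2" by simp
qed

lemma under_rate_pos:
  assumes "0 < \<eta>" "\<eta> < lambda_c"
  shows "0 < under_rate \<eta>"
  using under_param[OF assms] assms(1) by (simp add: under_rate_def Let_def)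

context atlas_rule
begin

section \<open>All estimates for a sufficiently large atlas\<close>

definition p_C :: "real \<Rightarrow> vec \<Rightarrow> real" where
  "p_C l \<theta> = measure (std_gauss D) {z \<in> space (vspace D). tie_default l (obs A \<theta> z) \<in> C_set A}"

lemma P_prob: "0 \<le> l \<Longrightarrow> \<P>(y in P_law A \<theta>. h l y \<in> C_set A) = p_C l \<theta>"
  and Q_prob: "0 \<le> l \<Longrightarrow> \<P>(y in Q_law A. h l y \<in> C_set A) = p_C l (\<lambda>_. 0)"
  unfolding P_law_eq Q_law_eq p_C_def by (rule prob_completed; assumption)+

lemma p_C_01: "0 \<le> p_C l \<theta>" "p_C l \<theta> \<le> 1"
  using prob_space.prob_le_1[OF prob_space_std_gauss] by (auto simp: p_C_def)

end

locale large_atlas = atlas_rule +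
  fixes \<eta> :: real
  assumes \<eta>: "0 < \<eta>" "\<eta> < lambda_c"
    and lM_large: "64 \<le> lM" and lN_large: "large_ratio \<eta> * lM \<le> lN"
begin

lemma lN_bounds:
  shows "64 * lM \<le> lN" "384 * (1 + opt_rate \<eta>) * lM \<le> opt_rate \<eta> * lN" "640 * lM < \<eta> * lN"
    "16 / (opt_rate \<eta>)\<^sup>2 \<le> lN" "4 / opt_rate \<eta> \<le> lN" "4 / under_rate \<eta> \<le> lN"
proof -
  let ?b = "opt_rate \<eta>" and ?g = "under_rate \<eta>"
  have pos: "0 < ?b" "0 < ?g" using opt_rate_pos under_rate_pos \<eta> by auto
  have nn: "0 < 384 * (1 + ?b) / ?b" "0 < 641 / \<eta>" "0 < 16 / ?b\<^sup>2" "0 < 4 / ?b" "0 < 4 / ?g"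
    using pos \<eta> by auto
  have le: "x * lM \<le> lN" if "x \<le> large_ratio \<eta>" for x
    using mult_right_mono[OF that, of lM] lN_large lM_large by linarith
  have le1: "x \<le> lN" if "x \<le> large_ratio \<eta>" "0 < x" for x
    using le[OF that(1)] mult_left_mono[of 1 lM x] that(2) lM_large by linarith
  show "64 * lM \<le> lN" by (rule le) (use nn in \<open>unfold large_ratio_def, linarith\<close>)
  have "384 * (1 + ?b) / ?b * lM \<le> lN" by (rule le) (use nn in \<open>unfold large_ratio_def, linarith\<close>)
  then show "384 * (1 + ?b) * lM \<le> ?b * lN" using pos by (simp add: field_simps)
  have "641 / \<eta> * lM \<le> lN" by (rule le) (use nn in \<open>unfold large_ratio_def, linarith\<close>)
  then have "641 * lM \<le> \<eta> * lN" using \<eta> by (simp add: field_simps)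
  then show "640 * lM < \<eta> * lN" using lM_large by linarith
  show "16 / ?b\<^sup>2 \<le> lN" by (rule le1) (use nn in \<open>unfold large_ratio_def, linarith\<close>, use nn in simp)
  show "4 / ?b \<le> lN" by (rule le1) (use nn in \<open>unfold large_ratio_def, linarith\<close>, use nn in simp)
  show "4 / ?g \<le> lN" by (rule le1) (use nn in \<open>unfold large_ratio_def, linarith\<close>, use nn in simp)
qed

lemma RS: "R \<le> S"
  by (rule R_le_S) (rule lN_bounds)

lemma Lambda_optD:
  assumes "l \<in> Lambda_opt \<eta>"
  shows "0 \<le> l" "512 * (1 + opt_rate \<eta>) \<le> (1 + l)\<^sup>2"
proof -
  have l: "lambda_c + \<eta> \<le> l" using assms by (simp add: Lambda_opt_def)
  then show "0 \<le> l" using \<eta> by simp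
  have "(lambda_c + 1 + \<eta>)\<^sup>2 \<le> (1 + l)\<^sup>2" using l \<eta> by (intro power_mono) auto
  then show "512 * (1 + opt_rate \<eta>) \<le> (1 + l)\<^sup>2" by (simp add: opt_rate_def)
qed

lemma Lambda_ne: "Lambda_opt \<eta> \<noteq> {}" "Lambda_under \<eta> \<noteq> {}" "0 \<in> Lambda_under \<eta>"
  using \<eta> by (auto simp: Lambda_opt_def Lambda_under_def)

lemma Lambda_underD: "l \<in> Lambda_under \<eta> \<Longrightarrow> 0 \<le> l"
  by (simp add: Lambda_under_def)

lemma opt_p_C:
  assumes "l \<in> Lambda_opt \<eta>" "\<theta> \<in> H_set A \<or> \<theta> = (\<lambda>_. 0)"
  shows "p_C l \<theta> \<le> exp (- (opt_rate \<eta> / 2 * lN))"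
  unfolding p_C_def
  by (rule opt_C_prob[OF opt_rate_pos[OF \<eta>(1)] _ _ _ assms(2)]) (use Lambda_optD[OF assms(1)] lN_bounds in auto)

text \<open>With x = b ln N / 2 the bound exp x \<ge> x^2 / 2 suffices, because ln N \<ge> 16 / b^2.
  The factor ln N is a crude bound for S / R in the risk and appears as \<open>p1\<close> in
  \<open>G_alg_le\<close>.\<close>

lemma lN_opt_small: "lN * exp (- (opt_rate \<eta> / 2 * lN)) \<le> 1 / 2"
proof -
  let ?b = "opt_rate \<eta>"
  let ?x = "?b / 2 * lN"
  have b: "0 < ?b" by (rule opt_rate_pos[OF \<eta>(1)])
  have x: "0 \<le> ?x" using b lN_pos by simp
  have "?x\<^sup>2 / 2 \<le> exp ?x" using exp_lower_Taylor_quadratic[OF x] x by linarith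
  moreover have "2 * lN \<le> ?x\<^sup>2 / 2"
  proof -
    have "16 \<le> ?b\<^sup>2 * lN" using lN_bounds(4) b by (simp add: field_simps)
    then have "16 * lN \<le> ?b\<^sup>2 * lN * lN" using lN_pos by (intro mult_right_mono) auto
    then show ?thesis by (simp add: power2_eq_square algebra_simps)
  qed
  ultimately have "2 * lN \<le> exp ?x" by linarith
  then show ?thesis by (simp add: exp_minus field_simps)
qed

lemma opt_capture:
  "(SUP l\<in>Lambda_opt \<eta>. \<P>(y in Q_law A. h l y \<in> C_set A) + (SUP \<theta>\<in>H_set A. \<P>(y in P_law A \<theta>. h l y \<in> C_set A)))
    \<le> real (nN A) powr (- (opt_rate \<eta> / 4))"
proof (rule cSUP_least[OF Lambda_ne(1)])
  fix l assume l: "l \<in> Lambda_opt \<eta>"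
  let ?e = "exp (- (opt_rate \<eta> / 2 * lN))"
  note l0 = Lambda_optD(1)[OF l]
  have "\<P>(y in Q_law A. h l y \<in> C_set A) \<le> ?e"
    unfolding Q_prob[OF l0] by (rule opt_p_C[OF l]) simp
  moreover have "(SUP \<theta>\<in>H_set A. \<P>(y in P_law A \<theta>. h l y \<in> C_set A)) \<le> ?e"
    unfolding P_prob[OF l0] by (rule cSUP_least[OF H_ne]) (use opt_p_C[OF l] in auto)
  \<comment> \<open>Two probabilities are added; the factor 2 is absorbed by halving the
    rate.\<close>
  moreover have "2 * ?e \<le> exp (- (opt_rate \<eta> / 4 * lN))"
  proof -
    have "1 \<le> opt_rate \<eta> / 4 * lN" using lN_bounds(5) opt_rate_pos[OF \<eta>(1)] by (simp add: field_simps)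
    then have "2 \<le> exp (opt_rate \<eta> / 4 * lN)" using exp_ge_add_one_self[of "opt_rate \<eta> / 4 * lN"] by linarith
    then have "2 * ?e \<le> exp (opt_rate \<eta> / 4 * lN) * ?e" by (intro mult_right_mono) auto
    also have "\<dots> = exp (- (opt_rate \<eta> / 4 * lN))" by (simp add: exp_add[symmetric])
    finally show ?thesis .
  qed
  moreover have "exp (- (opt_rate \<eta> / 4 * lN)) = real (nN A) powr (- (opt_rate \<eta> / 4))"
    using MN by (simp add: powr_def)
  ultimately show "\<P>(y in Q_law A. h l y \<in> C_set A) + (SUP \<theta>\<in>H_set A. \<P>(y in P_law A \<theta>. h l y \<in> C_set A))
    \<le> real (nN A) powr (- (opt_rate \<eta> / 4))" by linarith
qed

lemma under_p_C:
  assumes l: "l \<in> Lambda_under \<eta>" and \<theta>: "\<theta> \<in> H_set A"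
  shows "1 - 3 * exp (- (under_rate \<eta> * lN)) - 2 * exp (- lM) \<le> p_C l \<theta>"
proof -
  have "1 - 3 * exp (- (under_rate \<eta> * lN))
    \<le> measure (std_gauss D) {z \<in> space (vspace D). \<exists>j\<in>{1..nN A}. (sqrt 2 - \<eta> / 64 - \<eta> / 64) * sqrt lN \<le> ip D z (fvec A j)}"
    unfolding under_rate_def Let_def
    by (rule far_max_prob) (use under_param[OF \<eta>] \<eta> in auto)
  also have "sqrt 2 - \<eta> / 64 - \<eta> / 64 = sqrt 2 - \<eta> / 32" by simp
  finally show ?thesis
    unfolding p_C_def by (rule under_C_prob[OF \<eta> l lN_bounds(3) \<theta>])
qed

lemma under_capture:
  "1 - 3 * exp (- (under_rate \<eta> * lN)) - 2 * exp (- lM)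
    \<le> (INF l\<in>Lambda_under \<eta>. INF \<theta>\<in>H_set A. \<P>(y in P_law A \<theta>. h l y \<in> C_set A))"
  "(INF l\<in>Lambda_under \<eta>. INF \<theta>\<in>H_set A. \<P>(y in P_law A \<theta>. h l y \<in> C_set A)) \<le> 1"
proof -
  show "1 - 3 * exp (- (under_rate \<eta> * lN)) - 2 * exp (- lM)
    \<le> (INF l\<in>Lambda_under \<eta>. INF \<theta>\<in>H_set A. \<P>(y in P_law A \<theta>. h l y \<in> C_set A))"
    by (intro cINF_greatest Lambda_ne H_ne) (simp add: P_prob Lambda_underD under_p_C)
  have H0: "hub A 0 \<in> H_set A" by (rule hub_in) simp
  have inner: "0 \<le> (INF \<theta>\<in>H_set A. \<P>(y in P_law A \<theta>. h l y \<in> C_set A))" for l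
    by (rule cINF_greatest[OF H_ne]) simp
  let ?f = "\<lambda>l. INF \<theta>\<in>H_set A. \<P>(y in P_law A \<theta>. h l y \<in> C_set A)"
  have "?f 0 \<le> 1"
    by (rule cINF_lower2[OF _ H0]) (use p_C_01 finite_sets in \<open>auto simp: P_prob intro!: bdd_below_finite\<close>)
  moreover have "bdd_below (?f ` Lambda_under \<eta>)"
    using inner by (intro bdd_belowI2[where m = 0]) auto
  ultimately show "(INF l\<in>Lambda_under \<eta>. ?f l) \<le> 1"
    using Lambda_ne(3) by (intro cINF_lower2[where x = 0 and f = ?f]) auto
qed

text \<open>For s = 1 the value k = 3 / 4 meets both requirements of
  \<open>converse_err_le_half\<close> with equality, as (1 / 4)^2 / 2 = 1 / 32.\<close>

lemma hub_conv_err: "converse_err (nM A) lM (3 / 4 * lM) \<le> 1 / 2"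
  using converse_err_le_half[of "real (nM A)" 1 "3 / 4"] MN lM_large by (simp add: power2_eq_square)

lemma risk_opt: "R / 2 \<le> rnn_risk A h (Lambda_opt \<eta>)" "rnn_risk A h (Lambda_opt \<eta>) \<le> 3 * R"
proof -
  have "R / 2 \<le> R * (1 - converse_err (nM A) lM (3 / 4 * lM))"
    using half_le_complement[OF _ hub_conv_err, of R] R_pos by simp
  also have "\<dots> \<le> rnn_risk A h (Lambda_opt \<eta>)"
    by (rule rnn_risk_ge_R[OF Lambda_ne(1) _ RS]) (use Lambda_optD lM_large in auto)
  finally show "R / 2 \<le> rnn_risk A h (Lambda_opt \<eta>)" .
  obtain l where l: "l \<in> Lambda_opt \<eta>" using Lambda_ne by auto
  show "rnn_risk A h (Lambda_opt \<eta>) \<le> 3 * R"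
  proof (rule rnn_risk_le[OF l])
    fix \<theta> assume \<theta>: "\<theta> \<in> H_set A"
    \<comment> \<open>Any polynomial bound in ln N for S / R would do against the exponentially
      small capture probability.\<close>
    have "S = R * (sqrt lN / (8 * sqrt lM))" by (simp add: S_rad_def tau_def)
    also have "\<dots> \<le> R * (lN / 1)"
    proof (intro mult_left_mono frac_le)
      have "1 \<le> lN" using lN_bounds(1) lM_large by linarith
      then have "sqrt lN * 1 \<le> sqrt lN * sqrt lN" by (intro mult_left_mono) auto
      then show "sqrt lN \<le> lN" using lN_pos by simp
      show "1 \<le> 8 * sqrt lM" using lM_large real_sqrt_ge_1_iff[of lM] by linarith
    qed (use R_pos lN_pos in auto)
    finally have SR: "2 * S \<le> 2 * (R * lN)" by simp
    have "risk l \<theta> \<le> 2 * R + 2 * S * p_C l \<theta>"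
      unfolding p_C_def by (rule risk_le(1)[OF Lambda_optD(1)[OF l] RS \<theta>])
    also have "2 * S * p_C l \<theta> \<le> 2 * (R * lN) * exp (- (opt_rate \<eta> / 2 * lN))"
      by (rule mult_mono[OF SR opt_p_C[OF l]]) (use \<theta> R_pos lN_pos p_C_01 in auto)
    also have "\<dots> = 2 * R * (lN * exp (- (opt_rate \<eta> / 2 * lN)))" by simp
    also have "\<dots> \<le> 2 * R * (1 / 2)"
      using lN_opt_small R_pos by (intro mult_left_mono) auto
    finally show "risk l \<theta> \<le> 3 * R" by simp
  qed
qed

lemma risk_under: "S / 2 \<le> rnn_risk A h (Lambda_under \<eta>)" "rnn_risk A h (Lambda_under \<eta>) \<le> 2 * S"
proof -
  have H0: "hub A 0 \<in> H_set A" by (rule hub_in) simp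
  have "S * (1 / 2) \<le> rnn_risk A h (Lambda_under \<eta>)"
  proof (rule rnn_risk_ge_S[OF Lambda_ne(2)], goal_cases)
    case (2 l)
    \<comment> \<open>Both exponentials are at most 1 / 16, so at least 1 - 3 / 16 - 2 / 16 > 1 / 2
      remains.\<close>
    have "4 \<le> under_rate \<eta> * lN" using lN_bounds(6) under_rate_pos[OF \<eta>] by (simp add: field_simps)
    then have "exp (- (under_rate \<eta> * lN)) \<le> exp (- 4)" "exp (- lM) \<le> exp (- 4)" using lM_large by simp_all
    moreover have "exp (- 4) \<le> 1 / (16::real)"
    proof -
      have "exp (- 2) * exp (- 2) \<le> 1 / 4 * (1 / (4::real))" using exp_neg_le[of 2] by (intro mult_mono) auto
      then show ?thesis by (simp only: exp_add[symmetric]) simp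
    qed
    ultimately have h1: "exp (- (under_rate \<eta> * lN)) \<le> 1 / 16" "exp (- lM) \<le> 1 / 16" by linarith+
    then have "1 / 2 \<le> 1 - 3 * exp (- (under_rate \<eta> * lN)) - 2 * exp (- lM)" using h1 by linarith
    also have "\<dots> \<le> p_C l (hub A 0)" by (rule under_p_C[OF 2 H0])
    finally show ?case by (simp add: p_C_def)
  qed (rule Lambda_underD)
  then show "S / 2 \<le> rnn_risk A h (Lambda_under \<eta>)" by simp
  show "rnn_risk A h (Lambda_under \<eta>) \<le> 2 * S"
    by (rule rnn_risk_le[OF Lambda_ne(3)]) (rule risk_le(2)[OF _ RS], simp)
qed

lemma minimax_bounds: "S / 4 \<le> minimax_full A" "minimax_full A \<le> 2 * S"
proof -
  have "64 \<le> lN" using lN_bounds(1) lM_large by linarith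
  then have e: "converse_err (nN A) (lN / 64) (1 / 2 * lN) \<le> 1 / 2"
    using converse_err_le_half[of "real (nN A)" "1 / 64" "1 / 2"] MN by (simp add: power2_eq_square)
  have T: "lN / 128 \<le> 1 / 2 * lN" using lN_pos by simp
  have "S / 4 \<le> S / 2 * (1 - converse_err (nN A) (lN / 64) (1 / 2 * lN))"
    using half_le_complement[OF _ e, of "S / 2"] S_pos by simp
  also have "\<dots> \<le> minimax_full A" by (rule minimax_full_bounds(1)[OF RS T]) (use e in simp)
  finally show "S / 4 \<le> minimax_full A" .
  show "minimax_full A \<le> 2 * S" by (rule minimax_full_bounds(2)[OF RS T]) (use e in simp)
qed

lemma G_alg_bounds:
  assumes l: "l \<in> Lambda_opt \<eta>"
  shows "R * sqrt lM / 4 \<le> G_alg A h l" "G_alg A h l \<le> 13 * (R * sqrt lM)"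
proof -
  note l0 = Lambda_optD(1)[OF l]
  have "R * sqrt lM / 4 \<le> R * sqrt lM / 2 * (1 - converse_err (nM A) lM (3 / 4 * lM))"
    using half_le_complement[OF _ hub_conv_err, of "R * sqrt lM / 2"] R_pos lM_pos by simp
  also have "\<dots> \<le> G_alg A h l"
    by (rule G_alg_ge[OF l0 RS]) (use lM_large in simp)
  finally show "R * sqrt lM / 4 \<le> G_alg A h l" .
  show "G_alg A h l \<le> 13 * (R * sqrt lM)"
    by (rule G_alg_le[OF l0, where p = "exp (- (opt_rate \<eta> / 2 * lN))"])
       (use lM_large opt_p_C[OF l] lN_opt_small in \<open>auto simp: p_C_def\<close>)
qed

lemma S_R_ratio: "S / R = 1 / 8 * sqrt (lN / lM)"
  using R_pos by (simp add: S_rad_def tau_def real_sqrt_divide)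

lemma S_range: "S * sqrt lN = 1 / 8 * R * (lN / sqrt lM)"
  using lN_pos by (simp add: S_rad_def tau_def)

lemma range_ratio: "S * sqrt lN / (R * sqrt lM) = 1 / 8 * (lN / lM)"
  using lN_pos lM_pos R_pos unfolding S_range by (simp add: field_simps)

end

lemma asymp_withinI:
  assumes "c' * b \<le> a" "a \<le> C' * b" "c \<le> c'" "C' \<le> C" "0 \<le> b"
  shows "asymp_within c C a b"
  using assms mult_right_mono[of c c' b] mult_right_mono[of C' C b]
  by (auto simp: asymp_within_def)

context large_atlas
begin

lemma asymp_risks:
  "asymp_within (1 / 1000) 1000 (rnn_risk A h (Lambda_opt \<eta>)) R"
  "asymp_within (1 / 1000) 1000 (rnn_risk A h (Lambda_under \<eta>)) S"
  "asymp_within (1 / 1000) 1000 (minimax_full A) S"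
  using risk_opt risk_under minimax_bounds R_pos S_pos
  by (auto intro: asymp_withinI[of "1 / 2" _ _ 3] asymp_withinI[of "1 / 2" _ _ 2] asymp_withinI[of "1 / 4" _ _ 2])

lemma asymp_risk_ratios:
  "asymp_within (1 / 1000) 1000 (rnn_risk A h (Lambda_under \<eta>) / rnn_risk A h (Lambda_opt \<eta>))
     (minimax_full A / rnn_risk A h (Lambda_opt \<eta>))"
  "asymp_within (1 / 1000) 1000 (minimax_full A / rnn_risk A h (Lambda_opt \<eta>)) (S / R)"
  "asymp_within (1 / 100) 100 (rnn_risk A h (Lambda_under \<eta>) / rnn_risk A h (Lambda_opt \<eta>)) (S / R)"
proof -
  let ?o = "rnn_risk A h (Lambda_opt \<eta>)" and ?u = "rnn_risk A h (Lambda_under \<eta>)" and ?m = "minimax_full A"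
  have o: "0 < ?o" using risk_opt R_pos by linarith
  have m: "0 < ?m" using minimax_bounds S_pos by linarith
  have "1 / 4 * ?m \<le> ?u" "?u \<le> 8 * ?m"
    using risk_under minimax_bounds by linarith+
  then show "asymp_within (1 / 1000) 1000 (?u / ?o) (?m / ?o)"
    by (intro asymp_withinI[of "1 / 4" _ _ 8]) (use o m in \<open>auto simp: field_simps\<close>)
  have q: "1 / 12 * (S / R) \<le> x / ?o \<and> x / ?o \<le> 4 * (S / R)" if "S / 4 \<le> x" "x \<le> 2 * S" for x
  proof
    have "1 / 12 * (S / R) = (S / 4) / (3 * R)" by simp
    also have "\<dots> \<le> x / ?o" using that risk_opt o S_pos R_pos by (intro frac_le) auto
    finally show "1 / 12 * (S / R) \<le> x / ?o" .
    have "x / ?o \<le> (2 * S) / (R / 2)" using that risk_opt o S_pos R_pos by (intro frac_le) auto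
    then show "x / ?o \<le> 4 * (S / R)" by simp
  qed
  show "asymp_within (1 / 1000) 1000 (?m / ?o) (S / R)"
    by (rule asymp_withinI[of "1 / 12" _ _ 4]) (use q[OF minimax_bounds] S_pos R_pos in auto)
  have "S / 4 \<le> ?u" using risk_under S_pos by linarith
  \<comment> \<open>The tighter window leaves room for the factor 1 / 8 in S / R when this ratio is
    replaced by sqrt K in \<open>asymp_power\<close>.\<close>
  from q[OF this risk_under(2)] show "asymp_within (1 / 100) 100 (?u / ?o) (S / R)"
    by (intro asymp_withinI[of "1 / 12" _ _ 4]) (use S_pos R_pos in auto)
qed

lemma asymp_G_alg:
  assumes "l \<in> Lambda_opt \<eta>"
  shows "asymp_within (1 / 1000) 1000 (G_alg A h l) (R * sqrt lM)"
  by (rule asymp_withinI[of "1 / 4" _ _ 13]) (use G_alg_bounds[OF assms] R_pos lM_pos in auto)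

lemma asymp_ranges:
  "asymp_within (1 / 1000) 1000 (gauss_range A (H_set A)) (R * sqrt lM)"
  "asymp_within (1 / 1000) 1000 (gauss_range A (T_set A)) (S * sqrt lN)"
  using gauss_range_H[OF lM_large] gauss_range_T[OF lM_large lN_bounds(1)] R_pos S_pos lM_pos lN_pos
  by (auto intro!: asymp_withinI[of "1 / 4" _ _ 24])

lemma asymp_power:
  assumes K: "real (nN A) = real (nM A) powr K"
  shows "asymp_within (1 / 1000) 1000 (rnn_risk A h (Lambda_under \<eta>) / rnn_risk A h (Lambda_opt \<eta>)) (sqrt K)"
    and "l \<in> Lambda_opt \<eta> \<Longrightarrow> asymp_within (1 / 1000) 1000 (gauss_range A (T_set A) / G_alg A h l) K"
proof -
  have "lN = K * lM" unfolding K using MN by (simp add: ln_powr)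
  then have r: "lN / lM = K" using lM_pos by simp
  then have K0: "0 \<le> K" using lN_pos lM_pos by (metis divide_nonneg_nonneg dual_order.trans zero_le_divide_1_iff zero_le_numeral)
  have "S / R = 1 / 8 * sqrt K" by (simp add: S_R_ratio r)
  with asymp_risk_ratios(3)
  show "asymp_within (1 / 1000) 1000 (rnn_risk A h (Lambda_under \<eta>) / rnn_risk A h (Lambda_opt \<eta>)) (sqrt K)"
    using real_sqrt_ge_zero[OF K0] by (auto simp: asymp_within_def)
  show "asymp_within (1 / 1000) 1000 (gauss_range A (T_set A) / G_alg A h l) K" if l: "l \<in> Lambda_opt \<eta>"
  proof -
    let ?x = "R * sqrt lM" and ?y = "S * sqrt lN"
    have x: "0 < ?x" "0 < ?y" using R_pos S_pos lM_pos lN_pos by auto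
    note G = G_alg_bounds[OF l] and T = gauss_range_T[OF lM_large lN_bounds(1)]
    have yx: "?y / ?x = 1 / 8 * K" by (simp add: range_ratio r)
    \<comment> \<open>416 = 4 * 13 * 8, from the bounds on the range, on \<open>G_alg\<close> and
      from the factor 1 / 8 in \<open>range_ratio\<close>.\<close>
    have "1 / 416 * K = (?y / 4) / (13 * ?x)" using yx by (simp add: field_simps)
    also have "\<dots> \<le> gauss_range A (T_set A) / G_alg A h l"
      using G T x by (intro frac_le) auto
    finally have 1: "1 / 416 * K \<le> gauss_range A (T_set A) / G_alg A h l" .
    have "gauss_range A (T_set A) / G_alg A h l \<le> (24 * ?y) / (?x / 4)"
      using G T x by (intro frac_le) auto
    also have "\<dots> = 96 * (?y / ?x)" by simp
    also have "\<dots> = 12 * K" unfolding yx by simp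
    finally have 2: "gauss_range A (T_set A) / G_alg A h l \<le> 12 * K" .
    show ?thesis by (rule asymp_withinI[OF 1 2]) (use K0 in auto)
  qed
qed

end

theorem theorem1p8:
  fixes \<eta> :: real
  assumes "0 < \<eta>" and "\<eta> < lambda_c"
  shows "\<exists>a c C :: real. 0 < a \<and> 0 < c \<and> c < C \<and>
    (\<forall>(R :: real) (A :: nat \<Rightarrow> atlas) (h :: nat \<Rightarrow> real \<Rightarrow> vec \<Rightarrow> vec).
      (\<forall>k. valid_atlas (A k) \<and> rad (A k) = R \<and> rnn_rule (A k) (h k)) \<longrightarrow>
      filterlim (\<lambda>k. nM (A k)) at_top sequentially \<longrightarrow>
      filterlim (\<lambda>k. nN (A k)) at_top sequentially \<longrightarrow>
      filterlim (\<lambda>k. ln (real (nN (A k))) / ln (real (nM (A k)))) at_top sequentially \<longrightarrow>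
      \<comment> \<open>(1)\<close>
      (\<forall>\<^sub>F k in sequentially.
        (SUP l\<in>Lambda_opt \<eta>.
           \<P>(y in Q_law (A k). h k l y \<in> C_set (A k))
           + (SUP \<theta>\<in>H_set (A k). \<P>(y in P_law (A k) \<theta>. h k l y \<in> C_set (A k))))
        \<le> real (nN (A k)) powr (- a)) \<and>
      (\<forall>\<^sub>F k in sequentially. \<forall>l\<in>Lambda_opt \<eta>.
        rho (A k) (R / 3) (Q_law (A k)) (h k l) \<le> C / real (nM (A k))) \<and>
      \<comment> \<open>(2)\<close>
      (\<lambda>k. INF l\<in>Lambda_under \<eta>. INF \<theta>\<in>H_set (A k).
         \<P>(y in P_law (A k) \<theta>. h k l y \<in> C_set (A k))) \<longlonglongrightarrow> 1 \<and>
      \<comment> \<open>(3)\<close>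
      (\<forall>\<^sub>F k in sequentially.
        asymp_within c C (rnn_risk (A k) (h k) (Lambda_opt \<eta>)) R \<and>
        asymp_within c C (rnn_risk (A k) (h k) (Lambda_under \<eta>)) (S_rad (A k))) \<and>
      \<comment> \<open>(4)\<close>
      (\<forall>\<^sub>F k in sequentially.
        asymp_within c C (minimax_full (A k)) (S_rad (A k)) \<and>
        asymp_within c C
          (rnn_risk (A k) (h k) (Lambda_under \<eta>) / rnn_risk (A k) (h k) (Lambda_opt \<eta>))
          (minimax_full (A k) / rnn_risk (A k) (h k) (Lambda_opt \<eta>)) \<and>
        asymp_within c C
          (minimax_full (A k) / rnn_risk (A k) (h k) (Lambda_opt \<eta>)) (S_rad (A k) / R) \<and>
        S_rad (A k) / R = 1 / 8 * sqrt (ln (real (nN (A k))) / ln (real (nM (A k))))) \<and>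
      \<comment> \<open>(5)\<close>
      (\<forall>k. \<forall>l\<in>Lambda_opt \<eta>. AE (\<theta>, z) in joint_law (A k).
        rnn_obj (A k) l (obs (A k) \<theta> z) (h k l (obs (A k) \<theta> z))
        \<le> rnn_obj (A k) l (obs (A k) \<theta> z) \<theta>) \<and>
      (\<forall>\<^sub>F k in sequentially. \<forall>l\<in>Lambda_opt \<eta>. AE (\<theta>, z) in joint_law (A k).
        l * (vnorm (dm (A k)) (h k l (obs (A k) \<theta> z)))\<^sup>2 \<ge> l * (vnorm (dm (A k)) \<theta>)\<^sup>2) \<and>
      (\<forall>\<^sub>F k in sequentially. \<forall>l\<in>Lambda_opt \<eta>.
        asymp_within c C (G_alg (A k) (h k) l) (R * sqrt (ln (real (nM (A k)))))) \<and>
      (\<forall>\<^sub>F k in sequentially.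
        asymp_within c C (gauss_range (A k) (H_set (A k))) (R * sqrt (ln (real (nM (A k))))) \<and>
        asymp_within c C (gauss_range (A k) (T_set (A k)))
          (S_rad (A k) * sqrt (ln (real (nN (A k))))) \<and>
        S_rad (A k) * sqrt (ln (real (nN (A k))))
          = 1 / 8 * R * (ln (real (nN (A k))) / sqrt (ln (real (nM (A k)))))) \<and>
      (\<forall>K :: nat \<Rightarrow> real.
        (\<forall>k. real (nN (A k)) = real (nM (A k)) powr K k) \<longrightarrow>
        filterlim K at_top sequentially \<longrightarrow>
        (\<forall>\<^sub>F k in sequentially.
          asymp_within c C
            (rnn_risk (A k) (h k) (Lambda_under \<eta>) / rnn_risk (A k) (h k) (Lambda_opt \<eta>))
            (sqrt (K k)) \<and>
          (\<forall>l\<in>Lambda_opt \<eta>.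
            asymp_within c C (gauss_range (A k) (T_set (A k)) / G_alg (A k) (h k) l) (K k)))))"
\<comment> \<open>The exponent is the rate of \<open>opt_capture\<close>; 1 / 1000 and 1000 are wide
  enough for all explicit constants.\<close>
proof (rule exI[of _ "opt_rate \<eta> / 4"], rule exI[of _ "1 / 1000"], rule exI[of _ 1000],
    intro conjI allI impI)
  show "0 < opt_rate \<eta> / 4" "(0::real) < 1 / 1000" "1 / 1000 < (1000::real)"
    using opt_rate_pos[OF assms(1)] by auto
  fix R :: real and A :: "nat \<Rightarrow> atlas" and h :: "nat \<Rightarrow> real \<Rightarrow> vec \<Rightarrow> vec"
  assume A: "\<forall>k. valid_atlas (A k) \<and> rad (A k) = R \<and> rnn_rule (A k) (h k)"
    and M: "filterlim (\<lambda>k. nM (A k)) at_top sequentially"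
    and N: "filterlim (\<lambda>k. nN (A k)) at_top sequentially"
    and MN: "filterlim (\<lambda>k. ln (real (nN (A k))) / ln (real (nM (A k)))) at_top sequentially"
  have rad: "rad (A k) = R" for k using A by simp
  have rule: "atlas_rule (A k) (h k)" for k using A by unfold_locales auto
  have lnM: "filterlim (\<lambda>k. ln (real (nM (A k)))) at_top sequentially"
    by (rule filterlim_compose[OF ln_at_top filterlim_compose[OF filterlim_real_sequentially M]])
  have lnN: "filterlim (\<lambda>k. ln (real (nN (A k)))) at_top sequentially"
    by (rule filterlim_compose[OF ln_at_top filterlim_compose[OF filterlim_real_sequentially N]])
  \<comment> \<open>Everything required of a large atlas is ln M \<ge> 64 and a large ratio ln N /
    ln M, so it holds eventually.\<close>
  have big: "\<forall>\<^sub>F k in sequentially. large_atlas (A k) (h k) \<eta>"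
    using filterlim_at_top[THEN iffD1, OF lnM, rule_format, of 64]
      filterlim_at_top[THEN iffD1, OF MN, rule_format, of "large_ratio \<eta>"]
  proof eventually_elim
    case (elim k)
    interpret atlas_rule "A k" "h k" by (rule rule)
    show ?case
      by unfold_locales (use assms elim in \<open>auto simp: pos_le_divide_eq\<close>)
  qed
  have opt_nonneg: "0 \<le> l" if "l \<in> Lambda_opt \<eta>" for l
    using that assms by (simp add: Lambda_opt_def)
  show "\<forall>\<^sub>F k in sequentially.
        (SUP l\<in>Lambda_opt \<eta>.
           \<P>(y in Q_law (A k). h k l y \<in> C_set (A k))
           + (SUP \<theta>\<in>H_set (A k). \<P>(y in P_law (A k) \<theta>. h k l y \<in> C_set (A k))))
        \<le> real (nN (A k)) powr (- (opt_rate \<eta> / 4))"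
    using big by eventually_elim (rule large_atlas.opt_capture)
  show "\<forall>\<^sub>F k in sequentially. \<forall>l\<in>Lambda_opt \<eta>.
        rho (A k) (R / 3) (Q_law (A k)) (h k l) \<le> 1000 / real (nM (A k))"
    using big
  proof eventually_elim
    case (elim k)
    interpret large_atlas "A k" "h k" \<eta> by (rule elim)
    show ?case
    proof
      fix l assume "l \<in> Lambda_opt \<eta>"
      from rho_le[OF opt_nonneg[OF this] RS]
      have "rho (A k) (R / 3) (Q_law (A k)) (h k l) \<le> 1 / real (nM (A k))" by (simp add: rad)
      also have "\<dots> \<le> 1000 / real (nM (A k))" by (intro divide_right_mono) auto
      finally show "rho (A k) (R / 3) (Q_law (A k)) (h k l) \<le> 1000 / real (nM (A k))" .
    qed
  qed
  show "(\<lambda>k. INF l\<in>Lambda_under \<eta>. INF \<theta>\<in>H_set (A k).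
         \<P>(y in P_law (A k) \<theta>. h k l y \<in> C_set (A k))) \<longlonglongrightarrow> 1"
  proof (rule tendsto_sandwich)
    show "\<forall>\<^sub>F k in sequentially. 1 - 3 * exp (- (under_rate \<eta> * ln (real (nN (A k))))) - 2 * exp (- ln (real (nM (A k))))
      \<le> (INF l\<in>Lambda_under \<eta>. INF \<theta>\<in>H_set (A k). \<P>(y in P_law (A k) \<theta>. h k l y \<in> C_set (A k)))"
      using big by eventually_elim (rule large_atlas.under_capture(1))
    show "\<forall>\<^sub>F k in sequentially.
      (INF l\<in>Lambda_under \<eta>. INF \<theta>\<in>H_set (A k). \<P>(y in P_law (A k) \<theta>. h k l y \<in> C_set (A k))) \<le> 1"
      using big by eventually_elim (rule large_atlas.under_capture(2))
    have "filterlim (\<lambda>k. under_rate \<eta> * ln (real (nN (A k)))) at_top sequentially"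
      by (rule filterlim_tendsto_pos_mult_at_top[OF tendsto_const under_rate_pos[OF assms] lnN])
    then have "(\<lambda>k. exp (- (under_rate \<eta> * ln (real (nN (A k)))))) \<longlonglongrightarrow> 0"
      by (intro filterlim_compose[OF exp_at_bot] filterlim_uminus_at_top[THEN iffD1])
    moreover have "(\<lambda>k. exp (- ln (real (nM (A k))))) \<longlonglongrightarrow> 0"
      using lnM by (intro filterlim_compose[OF exp_at_bot] filterlim_uminus_at_top[THEN iffD1])
    ultimately have "(\<lambda>k. 1 - 3 * exp (- (under_rate \<eta> * ln (real (nN (A k))))) - 2 * exp (- ln (real (nM (A k)))))
       \<longlonglongrightarrow> 1 - 3 * 0 - 2 * 0"
      by (intro tendsto_diff tendsto_mult tendsto_const)
    then show "(\<lambda>k. 1 - 3 * exp (- (under_rate \<eta> * ln (real (nN (A k))))) - 2 * exp (- ln (real (nM (A k)))))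
       \<longlonglongrightarrow> 1" by simp
  qed simp
  show "\<forall>\<^sub>F k in sequentially.
        asymp_within (1 / 1000) 1000 (rnn_risk (A k) (h k) (Lambda_opt \<eta>)) R \<and>
        asymp_within (1 / 1000) 1000 (rnn_risk (A k) (h k) (Lambda_under \<eta>)) (S_rad (A k))"
    using big by eventually_elim (use large_atlas.asymp_risks rad in metis)
  show "\<forall>\<^sub>F k in sequentially.
        asymp_within (1 / 1000) 1000 (minimax_full (A k)) (S_rad (A k)) \<and>
        asymp_within (1 / 1000) 1000
          (rnn_risk (A k) (h k) (Lambda_under \<eta>) / rnn_risk (A k) (h k) (Lambda_opt \<eta>))
          (minimax_full (A k) / rnn_risk (A k) (h k) (Lambda_opt \<eta>)) \<and>
        asymp_within (1 / 1000) 1000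
          (minimax_full (A k) / rnn_risk (A k) (h k) (Lambda_opt \<eta>)) (S_rad (A k) / R) \<and>
        S_rad (A k) / R = 1 / 8 * sqrt (ln (real (nN (A k))) / ln (real (nM (A k))))"
    using big
  proof eventually_elim
    case (elim k)
    interpret large_atlas "A k" "h k" \<eta> by (rule elim)
    show ?case
      using asymp_risks(3) asymp_risk_ratios(1,2) S_R_ratio unfolding rad by blast
  qed
  show "\<forall>l\<in>Lambda_opt \<eta>. AE (\<theta>, z) in joint_law (A k).
        rnn_obj (A k) l (obs (A k) \<theta> z) (h k l (obs (A k) \<theta> z)) \<le> rnn_obj (A k) l (obs (A k) \<theta> z) \<theta>"
    for k
    using atlas_rule.obj_AE[OF rule opt_nonneg] by blast
  show "\<forall>\<^sub>F k in sequentially. \<forall>l\<in>Lambda_opt \<eta>. AE (\<theta>, z) in joint_law (A k).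
        l * (vnorm (dm (A k)) (h k l (obs (A k) \<theta> z)))\<^sup>2 \<ge> l * (vnorm (dm (A k)) \<theta>)\<^sup>2"
    using big
  proof eventually_elim
    case (elim k)
    interpret large_atlas "A k" "h k" \<eta> by (rule elim)
    show ?case using norm_AE[OF opt_nonneg RS] by blast
  qed
  show "\<forall>\<^sub>F k in sequentially. \<forall>l\<in>Lambda_opt \<eta>.
        asymp_within (1 / 1000) 1000 (G_alg (A k) (h k) l) (R * sqrt (ln (real (nM (A k)))))"
    using big by eventually_elim (use large_atlas.asymp_G_alg rad in metis)
  show "\<forall>\<^sub>F k in sequentially.
        asymp_within (1 / 1000) 1000 (gauss_range (A k) (H_set (A k))) (R * sqrt (ln (real (nM (A k))))) \<and>
        asymp_within (1 / 1000) 1000 (gauss_range (A k) (T_set (A k)))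
          (S_rad (A k) * sqrt (ln (real (nN (A k))))) \<and>
        S_rad (A k) * sqrt (ln (real (nN (A k))))
          = 1 / 8 * R * (ln (real (nN (A k))) / sqrt (ln (real (nM (A k)))))"
    using big
  proof eventually_elim
    case (elim k)
    interpret large_atlas "A k" "h k" \<eta> by (rule elim)
    show ?case using asymp_ranges S_range unfolding rad by blast
  qed
  show "\<forall>\<^sub>F k in sequentially.
          asymp_within (1 / 1000) 1000
            (rnn_risk (A k) (h k) (Lambda_under \<eta>) / rnn_risk (A k) (h k) (Lambda_opt \<eta>))
            (sqrt (K k)) \<and>
          (\<forall>l\<in>Lambda_opt \<eta>.
            asymp_within (1 / 1000) 1000 (gauss_range (A k) (T_set (A k)) / G_alg (A k) (h k) l) (K k))"
    if K: "\<forall>k. real (nN (A k)) = real (nM (A k)) powr K k" for K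
    using big
  proof eventually_elim
    case (elim k)
    interpret large_atlas "A k" "h k" \<eta> by (rule elim)
    show ?case using asymp_power[OF K[rule_format]] by blast
  qed
qed

end
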